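(* Let $a \in \mathbb{R}^{d+p}$, let $\underline{y}, \bar{y} \in \mathbb{R}^{d+p}$ with $\underline{y} \le \bar{y}$ componentwise, let $\lambda > 0$, and let $\Phi = \{(y, w) \in [\underline{y}, \bar{y}] \times \mathbb{R} \mid w = \mathcal{T}_\lambda(a^T y)\}$, where $\mathcal{T}_\lambda$ is the soft-thresholding operator. Then the separation problem for $\operatorname{conv}(\Phi)$ is solvable in $O(d + p)$ time.
   Context: The soft-thresholding operator with constant $\lambda>0$ is $\mathcal{T}_\lambda(t) = t - \lambda$ if $t > \lambda$, $\mathcal{T}_\lambda(t) = 0$ if $|t| \le \lambda$, and $\mathcal{T}_\lambda(t) = t + \lambda$ if $t < -\lambda$. $[\underline{y}, \bar{y}]$ denotes the box $\{y \in \mathbb{R}^{d+p} \mid \underline{y} \le y \le \bar{y}\}$. The separation problem for $\operatorname{conv}(\Phi)$ is: given a point $(\hat{y}, \hat{w}) \in \mathbb{R}^{d+p} \times \mathbb{R}$ (together with the data $a, \underline{y}, \bar{y}, \lambda$), verify that $(\hat{y}, \hat{w}) \in \operatorname{conv}(\Phi)$, or otherwise return a linear inequality that is valid for $\operatorname{conv}(\Phi)$ and violated by $(\hat{y}, \hat{w})$. *)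

theory Defs
  imports
    "HOL-Analysis.Analysis"
    "HOL-Analysis.Finite_Function_Topology"
    "HOL-Library.Landau_Symbols"
begin

section \<open>The set whose convex hull is separated\<close>

text \<open>
  The dimension \<open>n = d + p\<close> is quantified under the existential quantifier over programs, so it
  cannot be a type. The space \<open>\<real>\<^sup>n\<close> is taken to be the subspace of the real vector space
  \<open>nat \<Rightarrow>\<^sub>0 real\<close> of the vectors supported on \<open>{..<n}\<close>; this makes \<open>hull\<close> from the library applicable.
\<close>

type_synonym rvec = "nat \<Rightarrow>\<^sub>0 real"

definition Rn :: "nat \<Rightarrow> rvec set" where
  "Rn n = {y. Poly_Mapping.keys y \<subseteq> {..<n}}"

definition dot :: "nat \<Rightarrow> (nat \<Rightarrow> real) \<Rightarrow> rvec \<Rightarrow> real" where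
  "dot n c y = (\<Sum>i<n. c i * Poly_Mapping.lookup y i)"

definition vec_le :: "nat \<Rightarrow> rvec \<Rightarrow> rvec \<Rightarrow> bool" where
  "vec_le n x y \<longleftrightarrow> (\<forall>i<n. Poly_Mapping.lookup x i \<le> Poly_Mapping.lookup y i)"

definition vec_box :: "nat \<Rightarrow> rvec \<Rightarrow> rvec \<Rightarrow> rvec set" where
  "vec_box n yl yu = {y \<in> Rn n. vec_le n yl y \<and> vec_le n y yu}"

definition soft_threshold :: "real \<Rightarrow> real \<Rightarrow> real" where
  "soft_threshold lam t =
     (if t > lam then t - lam else if \<bar>t\<bar> \<le> lam then 0 else t + lam)"

definition Phi :: "nat \<Rightarrow> rvec \<Rightarrow> rvec \<Rightarrow> rvec \<Rightarrow> real \<Rightarrow> (rvec \<times> real) set" where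
  "Phi n a yl yu lam =
     {(y, w). y \<in> vec_box n yl yu \<and> w = soft_threshold lam (dot n (Poly_Mapping.lookup a) y)}"


section \<open>The separation problem\<close>

text \<open>\<open>Cut \<alpha> \<beta> \<gamma>\<close> stands for the linear inequality \<open>\<alpha>\<^sup>T y + \<beta> w \<le> \<gamma>\<close>; only \<open>\<alpha> i\<close> with \<open>i < n\<close> matter.\<close>

datatype answer = Member | Cut "nat \<Rightarrow> real" real real

fun separates :: "nat \<Rightarrow> (rvec \<times> real) set \<Rightarrow> rvec \<Rightarrow> real \<Rightarrow> answer \<Rightarrow> bool" where
  "separates n C yhat what Member \<longleftrightarrow> (yhat, what) \<in> C"
| "separates n C yhat what (Cut \<alpha> \<beta> \<gamma>) \<longleftrightarrow>
     (\<forall>(y, w) \<in> C. dot n \<alpha> y + \<beta> * w \<le> \<gamma>) \<and> dot n \<alpha> yhat + \<beta> * what > \<gamma>"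


section \<open>A unit-cost real RAM\<close>

text \<open>
  Running time is counted on a real RAM. Its memory consists of index arrays (over \<open>nat\<close>) and
  real arrays; a program refers to finitely many arrays, each by a literal name. Array cells
  are addressed indirectly through computed indices. Reals cannot be converted into
  indices, so there is no rounding, and real literals are integers, so no information can be hidden
  in a program constant. Indices have no multiplication. Evaluating a literal, a read, an
  arithmetic operation, a comparison or a connective costs one step each.

  Conventions: subtraction of indices is truncated, as usual for \<open>nat\<close>, and division by
  the real number zero yields zero, as usual in HOL; a test of the divisor simulates this at
  constant cost.
\<close>

record ram_state =
  imem :: "nat \<Rightarrow> nat \<Rightarrow> nat"
  rmem :: "nat \<Rightarrow> nat \<Rightarrow> real"

datatype iexp =
    IConst nat
  | IRead nat iexp
  | IAdd iexp iexp
  | ISub iexp iexp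

datatype rexp =
    RConst int
  | RRead nat iexp
  | RAdd rexp rexp
  | RSub rexp rexp
  | RMul rexp rexp
  | RDiv rexp rexp

datatype test =
    ILess iexp iexp
  | RLess rexp rexp
  | TNot test
  | TAnd test test

datatype com =
    Skip
  | IWrite nat iexp iexp
  | RWrite nat iexp rexp
  | Seq com com
  | Cond test com com
  | While test com

primrec ival :: "ram_state \<Rightarrow> iexp \<Rightarrow> nat" where
  "ival s (IConst k) = k"
| "ival s (IRead x e) = imem s x (ival s e)"
| "ival s (IAdd e f) = ival s e + ival s f"
| "ival s (ISub e f) = ival s e - ival s f"

primrec rval :: "ram_state \<Rightarrow> rexp \<Rightarrow> real" where
  "rval s (RConst k) = of_int k"
| "rval s (RRead x e) = rmem s x (ival s e)"
| "rval s (RAdd e f) = rval s e + rval s f"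
| "rval s (RSub e f) = rval s e - rval s f"
| "rval s (RMul e f) = rval s e * rval s f"
| "rval s (RDiv e f) = rval s e / rval s f"

primrec tval :: "ram_state \<Rightarrow> test \<Rightarrow> bool" where
  "tval s (ILess e f) \<longleftrightarrow> ival s e < ival s f"
| "tval s (RLess e f) \<longleftrightarrow> rval s e < rval s f"
| "tval s (TNot b) \<longleftrightarrow> \<not> tval s b"
| "tval s (TAnd b c) \<longleftrightarrow> tval s b \<and> tval s c"

primrec icost :: "iexp \<Rightarrow> nat" where
  "icost (IConst k) = 1"
| "icost (IRead x e) = 1 + icost e"
| "icost (IAdd e f) = 1 + icost e + icost f"
| "icost (ISub e f) = 1 + icost e + icost f"

primrec rcost :: "rexp \<Rightarrow> nat" where
  "rcost (RConst k) = 1"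
| "rcost (RRead x e) = 1 + icost e"
| "rcost (RAdd e f) = 1 + rcost e + rcost f"
| "rcost (RSub e f) = 1 + rcost e + rcost f"
| "rcost (RMul e f) = 1 + rcost e + rcost f"
| "rcost (RDiv e f) = 1 + rcost e + rcost f"

primrec tcost :: "test \<Rightarrow> nat" where
  "tcost (ILess e f) = 1 + icost e + icost f"
| "tcost (RLess e f) = 1 + rcost e + rcost f"
| "tcost (TNot b) = 1 + tcost b"
| "tcost (TAnd b c) = 1 + tcost b + tcost c"

definition iwrite :: "nat \<Rightarrow> nat \<Rightarrow> nat \<Rightarrow> ram_state \<Rightarrow> ram_state" where
  "iwrite x i v s = s\<lparr>imem := (imem s)(x := (imem s x)(i := v))\<rparr>"

definition rwrite :: "nat \<Rightarrow> nat \<Rightarrow> real \<Rightarrow> ram_state \<Rightarrow> ram_state" where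
  "rwrite x i v s = s\<lparr>rmem := (rmem s)(x := (rmem s x)(i := v))\<rparr>"

text \<open>\<open>exec c s t s'\<close>: started in \<open>s\<close>, the program \<open>c\<close> halts in \<open>s'\<close> after exactly \<open>t\<close> steps.\<close>

inductive exec :: "com \<Rightarrow> ram_state \<Rightarrow> nat \<Rightarrow> ram_state \<Rightarrow> bool" where
  Skip: "exec Skip s 1 s"
| IWrite: "exec (IWrite x e f) s (1 + icost e + icost f) (iwrite x (ival s e) (ival s f) s)"
| RWrite: "exec (RWrite x e f) s (1 + icost e + rcost f) (rwrite x (ival s e) (rval s f) s)"
| Seq: "exec c s t s' \<Longrightarrow> exec d s' u s'' \<Longrightarrow> exec (Seq c d) s (t + u) s''"
| CondT: "tval s b \<Longrightarrow> exec c s t s' \<Longrightarrow> exec (Cond b c d) s (1 + tcost b + t) s'"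
| CondF: "\<not> tval s b \<Longrightarrow> exec d s t s' \<Longrightarrow> exec (Cond b c d) s (1 + tcost b + t) s'"
| WhileF: "\<not> tval s b \<Longrightarrow> exec (While b c) s (1 + tcost b) s"
| WhileT: "tval s b \<Longrightarrow> exec c s t s' \<Longrightarrow> exec (While b c) s' u s'' \<Longrightarrow>
    exec (While b c) s (1 + tcost b + t + u) s''"

inductive_cases SkipE: "exec Skip s t s'"
  and IWriteE: "exec (IWrite x e f) s t s'"
  and RWriteE: "exec (RWrite x e f) s t s'"
  and SeqE: "exec (Seq c d) s t s'"
  and CondE: "exec (Cond b c d) s t s'"
  and WhileE: "exec (While b c) s t s'"

text \<open>Programs are deterministic, so the existence of a halting run describes the only behaviour.\<close>

lemma exec_deterministic:
  "exec c s t s' \<Longrightarrow> exec c s u s'' \<Longrightarrow> t = u \<and> s' = s''"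
proof (induction arbitrary: u s'' rule: exec.induct)
  case (Skip s)
  then show ?case by - (erule SkipE, simp)
next
  case (IWrite x e f s)
  then show ?case by - (erule IWriteE, simp)
next
  case (RWrite x e f s)
  then show ?case by - (erule RWriteE, simp)
next
  case (Seq c s t s' d v s1)
  from Seq.prems obtain t2 s2 v2 where "exec c s t2 s2" "exec d s2 v2 s''" "u = t2 + v2"
    by (rule SeqE)
  with Seq.IH(1)[of t2 s2] Seq.IH(2)[of v2 s''] show ?case by simp
next
  case (CondT s b c t s' d)
  from CondT.prems CondT.hyps(1) obtain t2 where "exec c s t2 s''" "u = 1 + tcost b + t2"
    by - (erule CondE, simp_all)
  with CondT.IH[of t2 s''] show ?case by simp
next
  case (CondF s b d t s' c)
  from CondF.prems CondF.hyps(1) obtain t2 where "exec d s t2 s''" "u = 1 + tcost b + t2"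
    by - (erule CondE, simp_all)
  with CondF.IH[of t2 s''] show ?case by simp
next
  case (WhileF s b c)
  from WhileF.prems show ?case by (rule WhileE) (use WhileF.hyps in simp_all)
next
  case (WhileT s b c t s' v s1)
  from WhileT.prems show ?case
  proof (rule WhileE)
    fix t2 s2 v2
    assume "exec c s t2 s2" "exec (While b c) s2 v2 s''" "u = Suc (tcost b + t2 + v2)"
    with WhileT.IH(1)[of t2 s2] WhileT.IH(2)[of v2 s''] show ?thesis by simp
  qed (use WhileT.hyps in simp)
qed


section \<open>Separation on the real RAM\<close>

text \<open>
  The input occupies index cell \<open>0[0]\<close> (the dimension \<open>n\<close>), the real arrays \<open>0\<close> to \<open>3\<close>
  (\<open>a\<close>, lower bounds, upper bounds, \<open>yhat\<close>) and the real cells \<open>4[0]\<close> (the threshold), \<open>4[1]\<close> (\<open>what\<close>);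
  the remaining memory is zero.
\<close>

definition input_state ::
    "nat \<Rightarrow> rvec \<Rightarrow> rvec \<Rightarrow> rvec \<Rightarrow> real \<Rightarrow> rvec \<Rightarrow> real \<Rightarrow> ram_state" where
  "input_state n a yl yu lam yhat what =
     \<lparr>imem = (\<lambda>_ _. 0)(0 := (\<lambda>_. 0)(0 := n)),
      rmem = (\<lambda>_ _. 0)(0 := Poly_Mapping.lookup a,
                       1 := Poly_Mapping.lookup yl,
                       2 := Poly_Mapping.lookup yu,
                       3 := Poly_Mapping.lookup yhat,
                       4 := (\<lambda>_. 0)(0 := lam, 1 := what))\<rparr>"

text \<open>
  Index cell \<open>1[0]\<close> holds the verdict, zero meaning membership; otherwise the
  inequality is in real array \<open>5\<close> (\<open>\<alpha>\<close>) and the real cells \<open>6[0]\<close> (\<open>\<beta>\<close>) and \<open>6[1]\<close> (\<open>\<gamma>\<close>).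
\<close>

definition output_of :: "ram_state \<Rightarrow> answer" where
  "output_of s = (if imem s 1 0 = 0 then Member else Cut (rmem s 5) (rmem s 6 0) (rmem s 6 1))"

end

theory Submission
  imports Defs
begin

text \<open>
  The soft-thresholding operator is odd, so it suffices to treat the upper boundary of the hull, once for
  \<open>a\<close> and once for \<open>-a\<close>. Move the box to the unit cube so that \<open>a\<^sup>T y = L + \<Sum>i. C i * x i\<close> with \<open>C \<ge> 0\<close>. Since
  \<open>T t = max (t - \<lambda>) (min (t + \<lambda>) 0)\<close> is a maximum of two concave functions, the boundary over \<open>x\<close> is the
  maximum over \<open>\<theta>\<close> in \<open>[0, 1]\<close> of the smaller one of \<open>L + (\<Sum>i. C i * x i) + \<lambda> - 2 * \<lambda> * \<theta>\<close> and the concave function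
  \<open>(L - \<lambda>) * \<theta> + (\<Sum>i. C i * min (x i) \<theta>)\<close>, where \<open>\<theta>\<close> is the weight of the first of the two pieces. The latter
  function is maximal at a weighted quantile of the breakpoints \<open>x i\<close>, and linear programming duality at that point
  yields a violated inequality if there is one.

  The quantile is found by prune and search. A pivot splitting off a constant fraction comes
  from a sample that is repeatedly sorted in blocks and thinned to every fourth element while the block size doubles:
  sample size times block size halves in each round, so that even insertion sort takes linear time in total.
\<close>

section \<open>Reasoning about programs\<close>

text \<open>For fixed \<theta> a hull point over x is \<theta> x1 + (1 - \<theta>) x2, with x1 on
  the piece t - \<lambda> and x2 on min (t + \<lambda>) 0. Put z = \<theta> x1. If x2 is on the
  linear branch, the height is L + C x + \<lambda> - 2 \<lambda> \<theta> whatever z is; if x2 is on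
  the zero branch, it is (L - \<lambda>) \<theta> + C z. So z should be as large as z \<le> x and z
  \<le> \<theta> allow, which explains the minima min (x i) \<theta>; the remaining condition x - z
  \<le> 1 - \<theta> follows from x \<le> 1.

  The boundary itself is never computed. Since the height w to be tested is given, the decreasing
  one of the two functions only says that \<theta> is at most some cap \<theta>0. It remains to
  maximise a concave piecewise linear function over [0, \<theta>0], and for this its maximiser is
  cut off at \<theta>0. Everything except finding the maximiser is a constant number of passes over
  the data.

  Indices can be neither multiplied nor divided by the program. The sample therefore has 16 * 8 ^ q
  elements: a round of thinning divides the number of blocks by exactly eight, and nothing is ever
  rounded.\<close>

primrec iwrites :: "com \<Rightarrow> nat set" where
  "iwrites Skip = {}"
| "iwrites (IWrite x e f) = {x}"
| "iwrites (RWrite x e f) = {}"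
| "iwrites (Seq c d) = iwrites c \<union> iwrites d"
| "iwrites (Cond b c d) = iwrites c \<union> iwrites d"
| "iwrites (While b c) = iwrites c"

primrec rwrites :: "com \<Rightarrow> nat set" where
  "rwrites Skip = {}"
| "rwrites (IWrite x e f) = {}"
| "rwrites (RWrite x e f) = {x}"
| "rwrites (Seq c d) = rwrites c \<union> rwrites d"
| "rwrites (Cond b c d) = rwrites c \<union> rwrites d"
| "rwrites (While b c) = rwrites c"

definition unchanged :: "com \<Rightarrow> ram_state \<Rightarrow> ram_state \<Rightarrow> bool" where
  "unchanged c s s' \<longleftrightarrow>
     (\<forall>x. x \<notin> iwrites c \<longrightarrow> imem s' x = imem s x) \<and> (\<forall>x. x \<notin> rwrites c \<longrightarrow> rmem s' x = rmem s x)"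

lemma unchanged_imem: "unchanged c s s' \<Longrightarrow> x \<notin> iwrites c \<Longrightarrow> imem s' x = imem s x"
  and unchanged_rmem: "unchanged c s s' \<Longrightarrow> x \<notin> rwrites c \<Longrightarrow> rmem s' x = rmem s x"
  by (simp_all add: unchanged_def)

lemmas unchanged_mem = unchanged_imem unchanged_rmem

lemma imem_iwrite [simp]: "imem (iwrite x i v s) y = (if y = x then (imem s x)(i := v) else imem s y)"
  and rmem_iwrite [simp]: "rmem (iwrite x i v s) = rmem s"
  and imem_rwrite [simp]: "imem (rwrite x i r s) = imem s"
  and rmem_rwrite [simp]: "rmem (rwrite x i r s) y = (if y = x then (rmem s x)(i := r) else rmem s y)"
  by (simp_all add: iwrite_def rwrite_def)

lemma exec_unchanged: "exec c s t s' \<Longrightarrow> unchanged c s s'"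
  by (induction rule: exec.induct) (auto simp: unchanged_def)

lemma unchanged_refl [simp]: "unchanged c s s"
  by (simp add: unchanged_def)

lemma unchanged_trans: "unchanged c s s' \<Longrightarrow> unchanged c s' s'' \<Longrightarrow> unchanged c s s''"
  by (simp add: unchanged_def)

definition runs :: "com \<Rightarrow> ram_state \<Rightarrow> nat \<Rightarrow> (ram_state \<Rightarrow> bool) \<Rightarrow> bool" where
  "runs c s k Q \<longleftrightarrow> (\<exists>t s'. exec c s t s' \<and> t \<le> k \<and> Q s')"

lemma runs_weaken:
  assumes "runs c s k R" "k \<le> k'" "\<And>s'. R s' \<Longrightarrow> unchanged c s s' \<Longrightarrow> Q s'"
  shows "runs c s k' Q"
  using assms exec_unchanged unfolding runs_def by (meson le_trans)

text \<open>The second program may use whatever the first leaves \<open>unchanged\<close>, which is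
  read off the syntax. Specifications therefore need to mention only the cells that a program
  computes.\<close>

lemma runs_Seq:
  assumes "runs c s k R" "\<And>s'. R s' \<Longrightarrow> unchanged c s s' \<Longrightarrow> runs d s' l Q" "k + l \<le> m"
  shows "runs (Seq c d) s m Q"
proof -
  obtain t s' where c: "exec c s t s'" "t \<le> k" "R s'"
    using assms(1) by (auto simp: runs_def)
  obtain u s'' where d: "exec d s' u s''" "u \<le> l" "Q s''"
    using assms(2)[OF c(3) exec_unchanged[OF c(1)]] by (auto simp: runs_def)
  show ?thesis
    unfolding runs_def using exec.Seq[OF c(1) d(1)] c(2) d(2,3) assms(3)
    by (intro exI[of _ "t + u"] exI[of _ s'']) simp
qed

lemma runs_Cond:
  assumes "tval s b \<Longrightarrow> runs c s k Q" "\<not> tval s b \<Longrightarrow> runs d s k Q" "1 + tcost b + k \<le> m"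
  shows "runs (Cond b c d) s m Q"
proof (cases "tval s b")
  case True
  then obtain t s' where "exec c s t s'" "t \<le> k" "Q s'"
    using assms(1) by (auto simp: runs_def)
  with True show ?thesis
    unfolding runs_def using exec.CondT[of s b c t s' d] assms(3)
    by (intro exI[of _ "1 + tcost b + t"] exI[of _ s']) simp
next
  case False
  then obtain t s' where "exec d s t s'" "t \<le> k" "Q s'"
    using assms(2) by (auto simp: runs_def)
  with False show ?thesis
    unfolding runs_def using exec.CondF[of s b d t s' c] assms(3)
    by (intro exI[of _ "1 + tcost b + t"] exI[of _ s']) simp
qed

text \<open>\<open>\<phi>\<close> is a potential: each round pays for its test, its body and the
  potential that remains. As every test costs something, the potential strictly decreases, so
  termination needs no separate measure, and the costs of shrinking rounds never have to be
  summed.\<close>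

lemma runs_While:
  fixes \<phi> :: "ram_state \<Rightarrow> nat"
  assumes init: "I s"
    and step: "\<And>s'. I s' \<Longrightarrow> unchanged (While b c) s s' \<Longrightarrow> tval s' b \<Longrightarrow>
      \<exists>k. runs c s' k (\<lambda>s''. I s'' \<and> 1 + tcost b + k + \<phi> s'' \<le> \<phi> s')"
    and exit: "\<And>s'. I s' \<Longrightarrow> unchanged (While b c) s s' \<Longrightarrow> \<not> tval s' b \<Longrightarrow> 1 + tcost b \<le> \<phi> s' \<and> Q s'"
    and "\<phi> s \<le> k"
  shows "runs (While b c) s k Q"
proof -
  have "I s' \<Longrightarrow> unchanged (While b c) s s' \<Longrightarrow> runs (While b c) s' (\<phi> s') Q" for s'
  proof (induction "\<phi> s'" arbitrary: s' rule: less_induct)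
    case less
    show ?case
    proof (cases "tval s' b")
      case False
      then have "exec (While b c) s' (1 + tcost b) s'"
        by (rule exec.WhileF)
      then show ?thesis
        using exit[OF less.prems False] by (auto simp: runs_def)
    next
      case True
      obtain k where "runs c s' k (\<lambda>s''. I s'' \<and> 1 + tcost b + k + \<phi> s'' \<le> \<phi> s')"
        using step[OF less.prems True] by blast
      then obtain t s'' where c: "exec c s' t s''" "t \<le> k" "I s''" "1 + tcost b + k + \<phi> s'' \<le> \<phi> s'"
        by (auto simp: runs_def)
      have "unchanged (While b c) s' s''"
        using exec_unchanged[OF c(1)] by (simp add: unchanged_def)
      then have "runs (While b c) s'' (\<phi> s'') Q"
        using less.hyps[of s''] c(3,4) unchanged_trans[OF less.prems(2)] by simp
      then obtain u r where r: "exec (While b c) s'' u r" "u \<le> \<phi> s''" "Q r"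
        by (auto simp: runs_def)
      show ?thesis
        unfolding runs_def using exec.WhileT[OF True c(1) r(1)] r c
        by (intro exI[of _ "1 + tcost b + t + u"] exI[of _ r]) simp
    qed
  qed
  then have "runs (While b c) s (\<phi> s) Q"
    using init by simp
  then show ?thesis
    using assms(4) by (rule runs_weaken)
qed

primrec straight_line :: "com \<Rightarrow> bool" where
  "straight_line Skip = True"
| "straight_line (IWrite x e f) = True"
| "straight_line (RWrite x e f) = True"
| "straight_line (Seq c d) = (straight_line c \<and> straight_line d)"
| "straight_line (Cond b c d) = (straight_line c \<and> straight_line d)"
| "straight_line (While b c) = False"

text \<open>On loop-free programs the final state is an explicit term, so such code is verified by
  rewriting. The \<open>While\<close> clauses of \<open>effect\<close> and \<open>max_cost\<close>
  are dummies that \<open>straight_line\<close> excludes.\<close>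

primrec effect :: "com \<Rightarrow> ram_state \<Rightarrow> ram_state" where
  "effect Skip s = s"
| "effect (IWrite x e f) s = iwrite x (ival s e) (ival s f) s"
| "effect (RWrite x e f) s = rwrite x (ival s e) (rval s f) s"
| "effect (Seq c d) s = effect d (effect c s)"
| "effect (Cond b c d) s = (if tval s b then effect c s else effect d s)"
| "effect (While b c) s = s"

primrec max_cost :: "com \<Rightarrow> nat" where
  "max_cost Skip = 1"
| "max_cost (IWrite x e f) = 1 + icost e + icost f"
| "max_cost (RWrite x e f) = 1 + icost e + rcost f"
| "max_cost (Seq c d) = max_cost c + max_cost d"
| "max_cost (Cond b c d) = 1 + tcost b + max (max_cost c) (max_cost d)"
| "max_cost (While b c) = 0"

lemma exec_straight_line: "straight_line c \<Longrightarrow> \<exists>t \<le> max_cost c. exec c s t (effect c s)"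
proof (induction c arbitrary: s)
  case (Seq c d)
  then obtain t u where "t \<le> max_cost c" "exec c s t (effect c s)"
    "u \<le> max_cost d" "exec d (effect c s) u (effect d (effect c s))"
    by (metis straight_line.simps(4))
  then show ?case
    by (intro exI[of _ "t + u"]) (auto intro: exec.Seq)
next
  case (Cond b c d)
  then obtain t u where tu: "t \<le> max_cost c" "exec c s t (effect c s)"
    "u \<le> max_cost d" "exec d s u (effect d s)"
    by (metis straight_line.simps(5))
  show ?case
  proof (cases "tval s b")
    case True
    with tu show ?thesis
      by (intro exI[of _ "1 + tcost b + t"]) (auto intro: exec.CondT[simplified])
  next
    case False
    with tu show ?thesis
      by (intro exI[of _ "1 + tcost b + u"]) (auto intro: exec.CondF[simplified])
  qed
qed (fastforce intro: exec.Skip[simplified] exec.IWrite[simplified] exec.RWrite[simplified])+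

lemma runs_straight_line:
  assumes "straight_line c" "max_cost c \<le> k" "Q (effect c s)"
  shows "runs c s k Q"
  using exec_straight_line[OF assms(1), of s] assms(2,3) unfolding runs_def by (meson le_trans)

lemma runs_Seq_straight:
  assumes "straight_line c" "runs d (effect c s) l Q" "max_cost c + l \<le> m"
  shows "runs (Seq c d) s m Q"
  by (rule runs_Seq[where R = "\<lambda>s'. s' = effect c s" and k = "max_cost c"])
    (use assms in \<open>auto intro: runs_straight_line\<close>)

abbreviation Then :: "com \<Rightarrow> com \<Rightarrow> com" (infixr ";;" 60) where
  "c ;; d \<equiv> Seq c d"

abbreviation (input) IVar :: "nat \<Rightarrow> iexp" where "IVar x \<equiv> IRead x (IConst 0)"
abbreviation (input) RVar :: "nat \<Rightarrow> rexp" where "RVar x \<equiv> RRead x (IConst 0)"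
abbreviation (input) ISet :: "nat \<Rightarrow> iexp \<Rightarrow> com" where "ISet x e \<equiv> IWrite x (IConst 0) e"
abbreviation (input) RSet :: "nat \<Rightarrow> rexp \<Rightarrow> com" where "RSet x e \<equiv> RWrite x (IConst 0) e"

definition For :: "nat \<Rightarrow> nat \<Rightarrow> com \<Rightarrow> com" where
  "For x y c = ISet x (IConst 0) ;; While (ILess (IVar x) (IVar y)) (c ;; ISet x (IAdd (IVar x) (IConst 1)))"

lemma iwrites_For [simp]: "iwrites (For x y c) = insert x (iwrites c)"
  and rwrites_For [simp]: "rwrites (For x y c) = rwrites c"
  by (auto simp: For_def)

text \<open>The overhead 12 per round is 6 steps for the test and 6 for the increment; the 9 are 3
  for the initialisation and 6 for the last test. The body has to establish the invariant for the
  state in which the counter is already increased, as the next test sees it.\<close>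

lemma runs_For:
  assumes "x \<noteq> y" "x \<notin> iwrites c" "y \<notin> iwrites c"
    and init: "I 0 (iwrite x 0 0 s)"
    and step: "\<And>i s'. i < imem s y 0 \<Longrightarrow> imem s' x 0 = i \<Longrightarrow> I i s' \<Longrightarrow> unchanged (For x y c) s s' \<Longrightarrow>
      runs c s' k (\<lambda>s''. I (Suc i) (iwrite x 0 (Suc i) s''))"
    and exit: "\<And>s'. I (imem s y 0) s' \<Longrightarrow> unchanged (For x y c) s s' \<Longrightarrow> Q s'"
    and K: "(k + 12) * imem s y 0 + 9 \<le> K"
  shows "runs (For x y c) s K Q"
  unfolding For_def
proof (rule runs_Seq[where k = 3 and R = "\<lambda>s'. s' = iwrite x 0 0 s"])
  show "runs (ISet x (IConst 0)) s 3 (\<lambda>s'. s' = iwrite x 0 0 s)"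
    by (rule runs_straight_line) simp_all
next
  let ?n = "imem s y 0"
  let ?s0 = "iwrite x 0 0 s"
  fix s' assume s': "s' = ?s0"
  show "runs (While (ILess (IVar x) (IVar y)) (c ;; ISet x (IAdd (IVar x) (IConst 1)))) s'
     ((k + 12) * ?n + 6) Q"
  proof (rule runs_While[where \<phi> = "\<lambda>s'. (k + 12) * (?n - imem s' x 0) + 6" and
       I = "\<lambda>s'. imem s' x 0 \<le> ?n \<and> I (imem s' x 0) s'"])
    show "imem s' x 0 \<le> ?n \<and> I (imem s' x 0) s'"
      using init by (simp add: s')
  next
    fix r
    assume I: "imem r x 0 \<le> ?n \<and> I (imem r x 0) r"
      and un: "unchanged (While (ILess (IVar x) (IVar y)) (c ;; ISet x (IAdd (IVar x) (IConst 1)))) s' r"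
    have un': "unchanged (For x y c) s r"
      using un by (auto simp: unchanged_def s')
    have n: "imem r y 0 = ?n"
      using unchanged_imem[OF un'] assms(1,3) by auto
    {
      assume "tval r (ILess (IVar x) (IVar y))"
      then have lt: "imem r x 0 < ?n"
        by (simp add: n)
      define i where "i = imem r x 0"
      have body: "runs c r k (\<lambda>s''. I (Suc i) (iwrite x 0 (Suc i) s''))"
        using step[OF lt _ conjunct2[OF I] un'] by (simp add: i_def)
      have "runs (c ;; ISet x (IAdd (IVar x) (IConst 1))) r (k + 6)
        (\<lambda>s''. (imem s'' x 0 \<le> ?n \<and> I (imem s'' x 0) s'') \<and>
           1 + tcost (ILess (IVar x) (IVar y)) + (k + 6) + ((k + 12) * (?n - imem s'' x 0) + 6)
             \<le> (k + 12) * (?n - imem r x 0) + 6)"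
      proof (rule runs_Seq[OF body, where l = 6])
        fix q assume q: "I (Suc i) (iwrite x 0 (Suc i) q)" "unchanged c r q"
        have x: "imem q x 0 = i"
          using unchanged_imem[OF q(2)] assms(2) by (simp add: i_def)
        have "?n - i = Suc (?n - Suc i)"
          using lt by (simp add: i_def)
        then show "runs (ISet x (IAdd (IVar x) (IConst 1))) q 6
          (\<lambda>s''. (imem s'' x 0 \<le> ?n \<and> I (imem s'' x 0) s'') \<and>
             1 + tcost (ILess (IVar x) (IVar y)) + (k + 6) + ((k + 12) * (?n - imem s'' x 0) + 6)
               \<le> (k + 12) * (?n - imem r x 0) + 6)"
          using lt q(1) by (intro runs_straight_line) (simp_all add: x i_def[symmetric])
      qed simp
      then show "\<exists>l. runs (c ;; ISet x (IAdd (IVar x) (IConst 1))) r l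
        (\<lambda>s''. (imem s'' x 0 \<le> ?n \<and> I (imem s'' x 0) s'') \<and>
           1 + tcost (ILess (IVar x) (IVar y)) + l + ((k + 12) * (?n - imem s'' x 0) + 6)
             \<le> (k + 12) * (?n - imem r x 0) + 6)"
        by blast
    next
      assume "\<not> tval r (ILess (IVar x) (IVar y))"
      then have "imem r x 0 = ?n"
        using I by (simp add: n)
      then show "1 + tcost (ILess (IVar x) (IVar y)) \<le> (k + 12) * (?n - imem r x 0) + 6 \<and> Q r"
        using exit[OF _ un'] I by simp
    }
  next
    show "(k + 12) * (?n - imem s' x 0) + 6 \<le> (k + 12) * ?n + 6"
      by (simp add: s')
  qed
qed (use K in simp)

section \<open>Linear-time selection\<close>

text \<open>Names beginning with \<open>v\<close> denote index arrays, names beginning with \<open>r\<close> real arrays; scalars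
  live in cell 0. \<open>rS\<close> is the sample, and \<open>vM\<close>, \<open>vG\<close>, \<open>vH\<close> are its size, its block size, and the rank of
  the pivot in a block. \<open>rX\<close> and \<open>rC\<close> hold the \<open>vA\<close> breakpoints and weights still to be searched, \<open>rX0\<close>
  and \<open>rC0\<close> all of them.\<close>

abbreviation (input) "vI \<equiv> 2 :: nat"
abbreviation (input) "vJ \<equiv> 3 :: nat"
abbreviation (input) "vB \<equiv> 4 :: nat"
abbreviation (input) "vM \<equiv> 5 :: nat"
abbreviation (input) "vG \<equiv> 6 :: nat"
abbreviation (input) "vH \<equiv> 7 :: nat"
abbreviation (input) "vK \<equiv> 8 :: nat"
abbreviation (input) "vT \<equiv> 9 :: nat"
abbreviation (input) "rS \<equiv> 9 :: nat"
abbreviation (input) "rTmp \<equiv> 14 :: nat"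

section \<open>Insertion sort inside the blocks of the sample\<close>

definition insert_com :: com where
  "insert_com =
     ISet vJ (IVar vI) ;;
     While (TAnd (ILess (IVar vB) (IVar vJ))
                 (RLess (RRead rS (IVar vJ)) (RRead rS (ISub (IVar vJ) (IConst 1)))))
       (RSet rTmp (RRead rS (IVar vJ)) ;;
        RWrite rS (IVar vJ) (RRead rS (ISub (IVar vJ) (IConst 1))) ;;
        ISet vJ (ISub (IVar vJ) (IConst 1)) ;;
        RWrite rS (IVar vJ) (RVar rTmp))"

lemma iwrites_insert [simp]: "iwrites insert_com = {vJ}"
  and rwrites_insert [simp]: "rwrites insert_com = {rS, rTmp}"
  by (auto simp: insert_com_def)

text \<open>That sorting permutes the sample is expressed by the preservation of sums of arbitrary
  functions; counting elements on either side of a pivot needs no more.\<close>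

lemma sum_swap:
  fixes f :: "real \<Rightarrow> nat"
  assumes "i < m" "j < m"
  shows "(\<Sum>k<m. f ((A(i := A j, j := A i)) k)) = (\<Sum>k<m. f (A k))"
proof -
  have "(\<Sum>k<m. f (A k)) = (\<Sum>k<m. ((\<lambda>k. f (A k)) \<circ> Transposition.transpose i j) k)"
    by (rule sum.permute) (use assms in \<open>simp add: permutes_swap_id\<close>)
  also have "\<dots> = (\<Sum>k<m. f ((A(i := A j, j := A i)) k))"
    by (rule sum.cong) (auto simp: Transposition.transpose_def)
  finally show ?thesis ..
qed

lemma runs_insert:
  fixes s :: ram_state
  defines "b \<equiv> imem s vB 0" and "i \<equiv> imem s vI 0" and "A \<equiv> rmem s rS"
  assumes bi: "b \<le> i" and sorted: "\<And>k l. b \<le> k \<Longrightarrow> k < l \<Longrightarrow> l < i \<Longrightarrow> A k \<le> A l"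
  shows "runs insert_com s (60 * (i - b) + 30) (\<lambda>s'.
    (\<forall>k. k < b \<or> i < k \<longrightarrow> rmem s' rS k = A k) \<and>
    (\<forall>k l. b \<le> k \<longrightarrow> k < l \<longrightarrow> l \<le> i \<longrightarrow> rmem s' rS k \<le> rmem s' rS l) \<and>
    (\<forall>(f :: real \<Rightarrow> nat) m. i < m \<longrightarrow> (\<Sum>k<m. f (rmem s' rS k)) = (\<Sum>k<m. f (A k))))"
    (is "runs _ _ _ ?Q")
  unfolding insert_com_def
proof (rule runs_Seq[where k = 10 and l = "60 * (i - b) + 20"
      and R = "\<lambda>s'. imem s' vJ 0 = i \<and> imem s' vB 0 = b \<and> rmem s' = rmem s"])
  show "runs (ISet vJ (IVar vI)) s 10 (\<lambda>s'. imem s' vJ 0 = i \<and> imem s' vB 0 = b \<and> rmem s' = rmem s)"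
    by (rule runs_straight_line) (simp_all add: b_def i_def)
next
  \<comment> \<open>The travelling element at \<open>vJ\<close> is already in order with all it has
    passed. Only pairs that have it as their right end may still be out of order.\<close>
  let ?I = "\<lambda>s'. imem s' vB 0 = b \<and> b \<le> imem s' vJ 0 \<and> imem s' vJ 0 \<le> i \<and>
    (\<forall>k. k < b \<or> i < k \<longrightarrow> rmem s' rS k = A k) \<and>
    (\<forall>k l. b \<le> k \<longrightarrow> k < l \<longrightarrow> l \<le> i \<longrightarrow> l \<noteq> imem s' vJ 0 \<longrightarrow> rmem s' rS k \<le> rmem s' rS l) \<and>
    (\<forall>(f :: real \<Rightarrow> nat) m. i < m \<longrightarrow> (\<Sum>k<m. f (rmem s' rS k)) = (\<Sum>k<m. f (A k)))"
  fix s' :: ram_state assume s': "imem s' vJ 0 = i \<and> imem s' vB 0 = b \<and> rmem s' = rmem s"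
  show "runs (While (TAnd (ILess (IVar vB) (IVar vJ))
                 (RLess (RRead rS (IVar vJ)) (RRead rS (ISub (IVar vJ) (IConst 1)))))
       (RSet rTmp (RRead rS (IVar vJ)) ;;
        RWrite rS (IVar vJ) (RRead rS (ISub (IVar vJ) (IConst 1))) ;;
        ISet vJ (ISub (IVar vJ) (IConst 1)) ;;
        RWrite rS (IVar vJ) (RVar rTmp))) s' (60 * (i - b) + 20) ?Q"
    (is "runs (While ?b ?c) _ _ _")
  proof (rule runs_While[where \<phi> = "\<lambda>s'. 60 * (imem s' vJ 0 - b) + 20" and I = ?I])
    show "?I s'"
      using s' bi sorted by (auto simp: A_def[symmetric])
  next
    fix r :: ram_state assume I: "?I r" and t: "tval r ?b"
    define j where "j = imem r vJ 0"
    define B where "B = rmem r rS"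
    have j: "b < j" "j \<le> i" "B j < B (j - 1)"
      using I t by (simp_all add: j_def B_def)
    have ord: "B k \<le> B l" if "b \<le> k" "k < l" "l \<le> i" "l \<noteq> j" for k l
      using I that by (simp add: j_def B_def)
    have sums: "(\<Sum>k<m. f (B k)) = (\<Sum>k<m. f (A k))" if "i < m" for f :: "real \<Rightarrow> nat" and m
      using I that by (simp add: B_def)
    define B' where "B' = B(j := B (j - 1), j - 1 := B j)"
    have eff: "rmem (effect ?c r) rS = B'" "imem (effect ?c r) vJ 0 = j - 1" "imem (effect ?c r) vB = imem r vB"
      by (simp_all add: B'_def B_def j_def fun_eq_iff)
    have "B' k \<le> B' l" if kl: "b \<le> k" "k < l" "l \<le> i" "l \<noteq> j - 1" for k l
    proof -
      consider "l = j" "k = j - 1" | "l = j" "k < j - 1" | "l \<noteq> j" "k = j" | "l \<noteq> j" "k = j - 1" | "l \<noteq> j" "k \<noteq> j" "k \<noteq> j - 1"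
        using kl by linarith
      then show ?thesis
        using kl j ord[of k "j - 1"] ord[of "j - 1" l] ord[of j l] ord[of k l]
        by cases (auto simp: B'_def)
    qed
    moreover have "(\<Sum>k<m. f (B' k)) = (\<Sum>k<m. f (A k))" if "i < m" for f :: "real \<Rightarrow> nat" and m
      using sum_swap[of j m "j - 1" f B] sums[of m f] j that by (simp add: B'_def)
    moreover have "B' k = A k" if "k < b \<or> i < k" for k
      using I j that by (auto simp: B'_def B_def)
    moreover have "b \<le> j - 1" "j - 1 \<le> i"
      using j by linarith+
    ultimately have I': "?I (effect ?c r)"
      using I unfolding eff by simp
    have "60 * (j - b) = 60 * (j - 1 - b) + 60"
      using j by simp
    then have cost: "1 + tcost ?b + 40 + (60 * (imem (effect ?c r) vJ 0 - b) + 20) \<le> 60 * (imem r vJ 0 - b) + 20"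
      unfolding eff by (simp add: j_def[symmetric])
    have "runs ?c r 40 (\<lambda>s''. ?I s'' \<and> 1 + tcost ?b + 40 + (60 * (imem s'' vJ 0 - b) + 20) \<le> 60 * (imem r vJ 0 - b) + 20)"
      by (rule runs_straight_line, simp, simp, rule conjI, rule I', rule cost)
    then show "\<exists>k. runs ?c r k (\<lambda>s''. ?I s'' \<and> 1 + tcost ?b + k + (60 * (imem s'' vJ 0 - b) + 20) \<le> 60 * (imem r vJ 0 - b) + 20)"
      by blast
  next
    fix r :: ram_state assume I: "?I r" and t: "\<not> tval r ?b"
    define j where "j = imem r vJ 0"
    define B where "B = rmem r rS"
    have j: "b \<le> j" "j \<le> i" "j = b \<or> B (j - 1) \<le> B j"
      using I t by (auto simp: j_def B_def)
    have ord: "B k \<le> B l" if "b \<le> k" "k < l" "l \<le> i" "l \<noteq> j" for k l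
      using I that by (simp add: j_def B_def)
    have "B k \<le> B l" if kl: "b \<le> k" "k < l" "l \<le> i" for k l
    proof -
      consider "l \<noteq> j" | "l = j" "k = j - 1" | "l = j" "k < j - 1"
        using kl by linarith
      then show ?thesis
      proof cases
        case 3
        have "B k \<le> B (j - 1)"
          by (rule ord) (use 3 kl j in linarith)+
        then show ?thesis
          using 3 j kl(1) by auto
      qed (use kl j ord[of k l] in auto)
    qed
    then show "1 + tcost ?b \<le> 60 * (imem r vJ 0 - b) + 20 \<and> ?Q r"
      using I by (simp add: B_def)
  next
    show "60 * (imem s' vJ 0 - b) + 20 \<le> 60 * (i - b) + 20"
      using s' by simp
  qed
qed simp

definition sort_blocks :: com where
  "sort_blocks =
     ISet vB (IConst 0) ;;
     For vI vM
       (Cond (ILess (IVar vI) (IAdd (IVar vB) (IVar vG))) Skip (ISet vB (IVar vI)) ;; insert_com)"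

lemma iwrites_sort_blocks [simp]: "iwrites sort_blocks = {vB, vI, vJ}"
  and rwrites_sort_blocks [simp]: "rwrites sort_blocks = {rS, rTmp}"
  by (auto simp: sort_blocks_def)

lemma multiple_gap: "g dvd (b::nat) \<Longrightarrow> g dvd c \<Longrightarrow> b < c \<Longrightarrow> b + g \<le> c"
  by (metis add.commute add_le_cancel_right dvd_diff_nat dvd_imp_le le_add_diff_inverse2 less_imp_le zero_less_diff)

lemma runs_sort_blocks:
  fixes s :: ram_state
  defines "M \<equiv> imem s vM 0" and "g \<equiv> imem s vG 0" and "A \<equiv> rmem s rS"
  assumes g: "0 < g"
  shows "runs sort_blocks s ((60 * g + 70) * M + 20) (\<lambda>s'.
    (\<forall>c k l. g dvd c \<longrightarrow> c \<le> k \<longrightarrow> k < l \<longrightarrow> l < c + g \<longrightarrow> l < M \<longrightarrow> rmem s' rS k \<le> rmem s' rS l) \<and>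
    (\<forall>f :: real \<Rightarrow> nat. (\<Sum>k<M. f (rmem s' rS k)) = (\<Sum>k<M. f (A k))))"
    (is "runs _ _ _ ?Q")
  unfolding sort_blocks_def
proof (rule runs_Seq[where k = 5 and l = "(60 * g + 70) * M + 10"
      and R = "\<lambda>s'. imem s' vB 0 = 0 \<and> rmem s' = rmem s \<and> imem s' vM = imem s vM \<and> imem s' vG = imem s vG"])
  show "runs (ISet vB (IConst 0)) s 5 (\<lambda>s'. imem s' vB 0 = 0 \<and> rmem s' = rmem s \<and> imem s' vM = imem s vM \<and> imem s' vG = imem s vG)"
    by (rule runs_straight_line) simp_all
next
  let ?c = "Cond (ILess (IVar vI) (IAdd (IVar vB) (IVar vG))) Skip (ISet vB (IVar vI)) ;; insert_com"
  let ?sb = "\<lambda>i B. \<forall>c k l. g dvd c \<longrightarrow> c \<le> k \<longrightarrow> k < l \<longrightarrow> l < c + g \<longrightarrow> l < i \<longrightarrow> (B k :: real) \<le> B l"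
  let ?I = "\<lambda>i s'. g dvd imem s' vB 0 \<and> imem s' vB 0 \<le> i \<and> i \<le> imem s' vB 0 + g \<and> ?sb i (rmem s' rS) \<and>
    (\<forall>f :: real \<Rightarrow> nat. (\<Sum>k<M. f (rmem s' rS k)) = (\<Sum>k<M. f (A k)))"
  fix s' :: ram_state assume s': "imem s' vB 0 = 0 \<and> rmem s' = rmem s \<and> imem s' vM = imem s vM \<and> imem s' vG = imem s vG"
  show "runs (For vI vM ?c) s' ((60 * g + 70) * M + 10) ?Q"
  proof (rule runs_For[where I = ?I and k = "60 * g + 58"])
    show "?I 0 (iwrite vI 0 0 s')"
      using s' by (simp add: A_def)
  next
    fix i and r :: ram_state
    assume i: "i < imem s' vM 0" "imem r vI 0 = i" and I: "?I i r" and un: "unchanged (For vI vM ?c) s' r"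
    have iM: "i < M" and G: "imem r vG 0 = g" "imem s' vG 0 = g"
      using i s' unchanged_imem[OF un, of vG] by (simp_all add: M_def g_def)
    define B where "B = rmem r rS"
    have sb: "B k \<le> B l" if "g dvd c" "c \<le> k" "k < l" "l < c + g" "l < i" for c k l
      using I that by (auto simp: B_def)
    show "runs ?c r (60 * g + 58) (\<lambda>s''. ?I (Suc i) (iwrite vI 0 (Suc i) s''))"
    proof (rule runs_Seq[where k = 20 and l = "60 * g + 38" and
          R = "\<lambda>q. g dvd imem q vB 0 \<and> imem q vB 0 \<le> i \<and> i < imem q vB 0 + g \<and> imem q vI 0 = i \<and> rmem q = rmem r"])
      show "runs (Cond (ILess (IVar vI) (IAdd (IVar vB) (IVar vG))) Skip (ISet vB (IVar vI))) r 20
        (\<lambda>q. g dvd imem q vB 0 \<and> imem q vB 0 \<le> i \<and> i < imem q vB 0 + g \<and> imem q vI 0 = i \<and> rmem q = rmem r)"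
      proof (rule runs_straight_line)
        \<comment> \<open>The invariant keeps i at most at the end of the current block. If the test
          fails, i is that end and hence again a multiple of g.\<close>
        have "g dvd i" if "\<not> i < imem r vB 0 + g"
          using that I by (metis dvd_add dvd_refl le_antisym not_less)
        then show "g dvd imem (effect (Cond (ILess (IVar vI) (IAdd (IVar vB) (IVar vG))) Skip (ISet vB (IVar vI))) r) vB 0 \<and>
          imem (effect (Cond (ILess (IVar vI) (IAdd (IVar vB) (IVar vG))) Skip (ISet vB (IVar vI))) r) vB 0 \<le> i \<and>
          i < imem (effect (Cond (ILess (IVar vI) (IAdd (IVar vB) (IVar vG))) Skip (ISet vB (IVar vI))) r) vB 0 + g \<and>
          imem (effect (Cond (ILess (IVar vI) (IAdd (IVar vB) (IVar vG))) Skip (ISet vB (IVar vI))) r) vI 0 = i \<and>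
          rmem (effect (Cond (ILess (IVar vI) (IAdd (IVar vB) (IVar vG))) Skip (ISet vB (IVar vI))) r) = rmem r"
          using I g i G by simp
      qed simp_all
    next
      fix q :: ram_state
      assume q: "g dvd imem q vB 0 \<and> imem q vB 0 \<le> i \<and> i < imem q vB 0 + g \<and> imem q vI 0 = i \<and> rmem q = rmem r"
      define b where "b = imem q vB 0"
      have b: "g dvd b" "b \<le> i" "i < b + g"
        using q by (simp_all add: b_def)
      have "B k \<le> B l" if "b \<le> k" "k < l" "l < i" for k l
        using sb[of b k l] b that by simp
      then show "runs insert_com q (60 * g + 38) (\<lambda>s''. ?I (Suc i) (iwrite vI 0 (Suc i) s''))"
      proof (intro runs_weaken[OF runs_insert])
        fix q' :: ram_state
        assume *: "(\<forall>k. k < imem q vB 0 \<or> imem q vI 0 < k \<longrightarrow> rmem q' rS k = rmem q rS k) \<and>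
          (\<forall>k l. imem q vB 0 \<le> k \<longrightarrow> k < l \<longrightarrow> l \<le> imem q vI 0 \<longrightarrow> rmem q' rS k \<le> rmem q' rS l) \<and>
          (\<forall>(f :: real \<Rightarrow> nat) m. imem q vI 0 < m \<longrightarrow> (\<Sum>k<m. f (rmem q' rS k)) = (\<Sum>k<m. f (rmem q rS k)))"
          and un: "unchanged insert_com q q'"
        define C where "C = rmem q' rS"
        have C: "C k = B k" if "k < b \<or> i < k" for k
          using * q that by (auto simp: C_def b_def B_def)
        have C': "C k \<le> C l" if "b \<le> k" "k < l" "l \<le> i" for k l
          using * q that by (simp add: C_def b_def B_def)
        have "(\<Sum>k<M. f (C k)) = (\<Sum>k<M. f (A k))" for f :: "real \<Rightarrow> nat"
          using * q iM I by (simp add: C_def b_def B_def)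
        moreover have "C k \<le> C l" if kl: "g dvd c" "c \<le> k" "k < l" "l < c + g" "l < Suc i" for c k l
        proof -
          \<comment> \<open>Blocks before the current one end at or before b, out of reach of the
            insertion; blocks after it start beyond i.\<close>
          consider "c < b" | "c = b" | "b < c"
            by linarith
          then show ?thesis
          proof cases
            case 1
            then have "c + g \<le> b"
              using multiple_gap b kl by blast
            then show ?thesis
              using kl b C[of k] C[of l] sb[of c k l] by simp
          next
            case 2
            then show ?thesis
              using kl C' by simp
          next
            case 3
            then have "b + g \<le> c"
              using multiple_gap b kl by blast
            then show ?thesis
              using kl b by simp
          qed
        qed
        moreover have "imem q' vB 0 = b"
          using unchanged_imem[OF un] by (simp add: b_def)
        ultimately show "?I (Suc i) (iwrite vI 0 (Suc i) q')"
          using b by (simp add: C_def)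
      next
        have "imem q vI 0 - imem q vB 0 \<le> g"
          using q by linarith
        then show "60 * (imem q vI 0 - imem q vB 0) + 30 \<le> 60 * g + 38"
          by simp
      qed (use q in \<open>simp_all add: b_def B_def\<close>)
    qed simp
  next
    fix r :: ram_state assume "?I (imem s' vM 0) r"
    then show "?Q r"
      using s' by (simp add: M_def)
  qed (use s' in \<open>simp_all add: M_def algebra_simps\<close>)
qed simp

section \<open>Thinning the sample, and its effect on ranks\<close>

definition thin_com :: com where
  "thin_com =
     (ISet vK (IConst 0) ;; ISet vT (IConst 3)) ;;
     While (ILess (IVar vT) (IVar vM))
       (RWrite rS (IVar vK) (RRead rS (IVar vT)) ;;
        ISet vK (IAdd (IVar vK) (IConst 1)) ;;
        ISet vT (IAdd (IVar vT) (IConst 4))) ;;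
     ISet vM (IVar vK)"

lemma iwrites_thin [simp]: "iwrites thin_com = {vK, vT, vM}"
  and rwrites_thin [simp]: "rwrites thin_com = {rS}"
  by (auto simp: thin_com_def)

lemma runs_thin:
  fixes s :: ram_state
  assumes M: "imem s vM 0 = 4 * q"
  shows "runs thin_com s (30 * q + 30) (\<lambda>s'. imem s' vM 0 = q \<and> (\<forall>k<q. rmem s' rS k = rmem s rS (4 * k + 3)))"
    (is "runs _ _ _ ?Q")
  unfolding thin_com_def
proof (rule runs_Seq_straight[where l = "30 * q + 20"], simp, rule runs_Seq[where k = "30 * q + 10" and l = 10
      and R = "\<lambda>s'. imem s' vK 0 = q \<and> (\<forall>k<q. rmem s' rS k = rmem s rS (4 * k + 3))"])
  let ?s = "effect (ISet vK (IConst 0) ;; ISet vT (IConst 3)) s"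
  \<comment> \<open>Thinning works in place: cell k receives cell 4 k + 3, so writing lags behind
    reading and the cells still to be read are original.\<close>
  let ?I = "\<lambda>s'. imem s' vK 0 \<le> q \<and> imem s' vT 0 = 4 * imem s' vK 0 + 3 \<and>
    (\<forall>k. rmem s' rS k = (if k < imem s' vK 0 then rmem s rS (4 * k + 3) else rmem s rS k))"
  let ?b = "ILess (IVar vT) (IVar vM)"
  let ?c = "RWrite rS (IVar vK) (RRead rS (IVar vT)) ;;
        ISet vK (IAdd (IVar vK) (IConst 1)) ;;
        ISet vT (IAdd (IVar vT) (IConst 4))"
  show "runs (While ?b ?c) ?s (30 * q + 10)
    (\<lambda>s'. imem s' vK 0 = q \<and> (\<forall>k<q. rmem s' rS k = rmem s rS (4 * k + 3)))"
  proof (rule runs_While[where \<phi> = "\<lambda>s'. 30 * (q - imem s' vK 0) + 10" and I = ?I])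
    fix r :: ram_state
    assume I: "?I r" and un: "unchanged (While ?b ?c) ?s r" and t: "tval r ?b"
    have M: "imem r vM 0 = 4 * q"
      using unchanged_imem[OF un, of vM] M by simp
    define k where "k = imem r vK 0"
    have k: "k < q" "imem r vT 0 = 4 * k + 3"
      using I t M by (simp_all add: k_def)
    have "30 * (q - k) = 30 * (q - Suc k) + 30"
      using k by simp
    then have "runs ?c r 20 (\<lambda>s''. ?I s'' \<and> 1 + tcost ?b + 20 + (30 * (q - imem s'' vK 0) + 10) \<le> 30 * (q - imem r vK 0) + 10)"
      using I k by (intro runs_straight_line) (auto simp: k_def[symmetric] less_Suc_eq)
    then show "\<exists>l. runs ?c r l (\<lambda>s''. ?I s'' \<and> 1 + tcost ?b + l + (30 * (q - imem s'' vK 0) + 10) \<le> 30 * (q - imem r vK 0) + 10)"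
      by blast
  next
    fix r :: ram_state
    assume I: "?I r" and un: "unchanged (While ?b ?c) ?s r" and t: "\<not> tval r ?b"
    have M: "imem r vM 0 = 4 * q"
      using unchanged_imem[OF un, of vM] M by simp
    show "1 + tcost ?b \<le> 30 * (q - imem r vK 0) + 10 \<and> imem r vK 0 = q \<and> (\<forall>k<q. rmem r rS k = rmem s rS (4 * k + 3))"
      using I t M by auto
  qed simp_all
next
  fix r :: ram_state
  assume "imem r vK 0 = q \<and> (\<forall>k<q. rmem r rS k = rmem s rS (4 * k + 3))"
  then show "runs (ISet vM (IVar vK)) r 10 ?Q"
    by (intro runs_straight_line) simp_all
qed simp_all

definition tally :: "(real \<Rightarrow> bool) \<Rightarrow> nat \<Rightarrow> (nat \<Rightarrow> real) \<Rightarrow> nat" where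
  "tally P m A = (\<Sum>k<m. if P (A k) then 1 else 0)"

lemma sum_groups_of_4:
  fixes f :: "nat \<Rightarrow> nat"
  shows "(\<Sum>i<4 * q. f i) = (\<Sum>k<q. f (4 * k) + f (4 * k + 1) + f (4 * k + 2) + f (4 * k + 3))"
proof (induction q)
  case (Suc q)
  have "4 * Suc q = Suc (Suc (Suc (Suc (4 * q))))"
    by simp
  then show ?case
    using Suc by (simp del: mult_Suc_right add: numeral_3_eq_3 numeral_2_eq_2)
qed simp

text \<open>The survivor of a group of four is its maximum, so if it is at most p, the whole group
  is. Counting from below loses nothing.\<close>

lemma tally_le_thin:
  assumes "\<And>k i. k < q \<Longrightarrow> i < 3 \<Longrightarrow> A (4 * k + i) \<le> A (4 * k + 3)"
  shows "4 * tally (\<lambda>x. x \<le> p) q (\<lambda>k. A (4 * k + 3)) \<le> tally (\<lambda>x. x \<le> p) (4 * q) A"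
  unfolding tally_def sum_groups_of_4 sum_distrib_left
proof (rule sum_mono)
  fix k assume "k \<in> {..<q}"
  then have "A (4 * k) \<le> A (4 * k + 3)" "A (4 * k + 1) \<le> A (4 * k + 3)" "A (4 * k + 2) \<le> A (4 * k + 3)"
    using assms[of k 0] assms[of k 1] assms[of k 2] by simp_all
  then show "4 * (if A (4 * k + 3) \<le> p then 1 else 0)
      \<le> (if A (4 * k) \<le> p then 1 else 0) + (if A (4 * k + 1) \<le> p then 1 else 0) +
        (if A (4 * k + 2) \<le> p then 1 else 0) + (if A (4 * k + 3) \<le> p then 1 else (0::nat))"
    by auto
qed

text \<open>From above, a survivor vouches for the next group instead, all of whose elements are at
  least as large because the block is sorted. Only the last group of the block is not vouched for by
  this shift, since the first has no predecessor; the miscount is one group, whence the 4.\<close>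

lemma tally_ge_thin_block:
  assumes "\<And>k l. k < l \<Longrightarrow> l < 4 * h \<Longrightarrow> A k \<le> A l"
  shows "4 * tally (\<lambda>x. p \<le> x) h (\<lambda>k. A (4 * k + 3)) \<le> tally (\<lambda>x. p \<le> x) (4 * h) A + 4"
proof (cases h)
  case (Suc h')
  let ?f = "\<lambda>x. if p \<le> x then 1 else (0::nat)"
  have "4 * (\<Sum>k<h'. ?f (A (4 * k + 3))) \<le>
    (\<Sum>k<h'. ?f (A (4 * Suc k)) + ?f (A (4 * Suc k + 1)) + ?f (A (4 * Suc k + 2)) + ?f (A (4 * Suc k + 3)))"
    unfolding sum_distrib_left
  proof (rule sum_mono)
    fix k assume "k \<in> {..<h'}"
    then have "A (4 * k + 3) \<le> A (4 * Suc k)" "A (4 * k + 3) \<le> A (4 * Suc k + 1)"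
      "A (4 * k + 3) \<le> A (4 * Suc k + 2)" "A (4 * k + 3) \<le> A (4 * Suc k + 3)"
      by (auto intro!: assms simp: Suc)
    then show "4 * ?f (A (4 * k + 3)) \<le>
      ?f (A (4 * Suc k)) + ?f (A (4 * Suc k + 1)) + ?f (A (4 * Suc k + 2)) + ?f (A (4 * Suc k + 3))"
      by auto
  qed
  also have "\<dots> \<le> (\<Sum>k<Suc h'. ?f (A (4 * k)) + ?f (A (4 * k + 1)) + ?f (A (4 * k + 2)) + ?f (A (4 * k + 3)))"
    unfolding sum.lessThan_Suc_shift by (rule le_add2)
  finally have "4 * (\<Sum>k<h'. ?f (A (4 * k + 3))) \<le>
    (\<Sum>k<Suc h'. ?f (A (4 * k)) + ?f (A (4 * k + 1)) + ?f (A (4 * k + 2)) + ?f (A (4 * k + 3)))" .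
  moreover have "4 * (\<Sum>k<Suc h'. ?f (A (4 * k + 3))) \<le> 4 * (\<Sum>k<h'. ?f (A (4 * k + 3))) + 4"
    by simp
  ultimately show ?thesis
    unfolding tally_def sum_groups_of_4 Suc by linarith
qed (simp add: tally_def)

lemma tally_add: "tally P (m + g) A = tally P m A + tally P g (\<lambda>k. A (m + k))"
  by (induction g) (simp_all add: tally_def)

lemma tally_blocks: "tally P (c * g) A = (\<Sum>b<c. tally P g (\<lambda>k. A (b * g + k)))"
proof (induction c)
  case (Suc c)
  have "tally P (Suc c * g) A = tally P (c * g + g) A"
    by (simp add: add.commute)
  then show ?case
    using Suc by (simp add: tally_add)
qed (simp add: tally_def)

lemma tally_ge_thin:
  assumes "\<And>b k l. b < c \<Longrightarrow> k < l \<Longrightarrow> l < 4 * h \<Longrightarrow> A (b * (4 * h) + k) \<le> A (b * (4 * h) + l)"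
  shows "4 * tally (\<lambda>x. p \<le> x) (c * h) (\<lambda>k. A (4 * k + 3)) \<le> tally (\<lambda>x. p \<le> x) (c * (4 * h)) A + 4 * c"
proof -
  have "4 * tally (\<lambda>x. p \<le> x) h (\<lambda>k. A (4 * (b * h + k) + 3)) \<le>
    tally (\<lambda>x. p \<le> x) (4 * h) (\<lambda>k. A (b * (4 * h) + k)) + 4" if "b < c" for b
    using tally_ge_thin_block[of h "\<lambda>k. A (b * (4 * h) + k)" p] assms[of b] that
    by (simp add: algebra_simps)
  then have "(\<Sum>b<c. 4 * tally (\<lambda>x. p \<le> x) h (\<lambda>k. A (4 * (b * h + k) + 3))) \<le>
    (\<Sum>b<c. tally (\<lambda>x. p \<le> x) (4 * h) (\<lambda>k. A (b * (4 * h) + k)) + 4)"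
    by (intro sum_mono) simp
  then show ?thesis
    unfolding tally_blocks by (simp add: sum.distrib sum_distrib_left)
qed

abbreviation (input) "vA \<equiv> 10 :: nat"
abbreviation (input) "rX \<equiv> 7 :: nat"
abbreviation (input) "rP \<equiv> 18 :: nat"

definition thinning_loop :: com where
  "thinning_loop =
     While (ILess (IVar vG) (IVar vM))
       (sort_blocks ;; thin_com ;; ISet vG (IAdd (IVar vG) (IVar vG)) ;; ISet vH (IAdd (IVar vH) (IVar vH)))"

lemma iwrites_thinning_loop [simp]: "iwrites thinning_loop = {vI, vJ, vB, vK, vT, vM, vG, vH}"
  and rwrites_thinning_loop [simp]: "rwrites thinning_loop = {rS, rTmp}"
  by (auto simp: thinning_loop_def)

text \<open>Thinning \<open>8 ^ q\<close> blocks loses at most four elements per block on the upper side, each standing for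
  \<open>4 ^ j\<close> of the \<open>N\<close> elements of \<open>X\<close>. As block sizes double, these losses form a geometric series bounded by \<open>N / 2\<close>.\<close>

definition thinned :: "nat \<Rightarrow> (nat \<Rightarrow> real) \<Rightarrow> ram_state \<Rightarrow> nat \<Rightarrow> nat \<Rightarrow> bool" where
  "thinned N X s j q \<longleftrightarrow>
     imem s vG 0 = 16 * 2 ^ j \<and> imem s vH 0 = 4 * 2 ^ j \<and> imem s vM 0 = 16 * 2 ^ j * 8 ^ q \<and>
     N = 16 * 2 ^ j * 8 ^ q * 4 ^ j \<and>
     (\<forall>p. 4 ^ j * tally (\<lambda>x. x \<le> p) (imem s vM 0) (rmem s rS) \<le> tally (\<lambda>x. x \<le> p) N X) \<and>
     (\<forall>p. real (4 ^ j * tally (\<lambda>x. p \<le> x) (imem s vM 0) (rmem s rS))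
        \<le> real (tally (\<lambda>x. p \<le> x) N X) + real N / 2 - real N / (2 * 2 ^ j))"

text \<open>The sample shrinks to a quarter while blocks double, so \<open>8 ^ Suc q\<close> blocks
  become \<open>8 ^ q\<close>, and each survivor stands for four times as many elements of X.
  Insertion sort costs about 60 M g; with blocks of at least 16 elements the terms linear in M are
  small against M g.\<close>

lemma runs_thinning_step:
  assumes th: "thinned N X s j (Suc q)"
  shows "runs (sort_blocks ;; thin_com ;; ISet vG (IAdd (IVar vG) (IVar vG)) ;; ISet vH (IAdd (IVar vH) (IVar vH)))
    s (80 * (imem s vM 0 * imem s vG 0)) (\<lambda>s'. thinned N X s' (Suc j) q)"
proof (rule runs_Seq[OF runs_sort_blocks])
  show "0 < imem s vG 0"
    using th by (simp add: thinned_def)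
next
  define g where "g = imem s vG 0"
  define M where "M = imem s vM 0"
  define h where "h = 4 * (2::nat) ^ j"
  define c where "c = (8::nat) ^ Suc q"
  have g: "g = 4 * h" and M: "M = c * (4 * h)" and N: "N = c * (4 * h) * 4 ^ j"
    using th by (simp_all add: thinned_def g_def h_def M_def c_def)
  have le: "4 ^ j * tally (\<lambda>x. x \<le> p) M (rmem s rS) \<le> tally (\<lambda>x. x \<le> p) N X" for p
    using th unfolding thinned_def M_def by blast
  have ge: "real (4 ^ j * tally (\<lambda>x. p \<le> x) M (rmem s rS))
        \<le> real (tally (\<lambda>x. p \<le> x) N X) + real N / 2 - real N / (2 * 2 ^ j)" for p
    using th unfolding thinned_def M_def by blast
  have "16 \<le> g" "8 * 16 \<le> M"
    using mult_le_mono[of 8 c 16 "4 * h"] by (simp_all add: g h_def M c_def)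
  then have "M * 16 \<le> M * g"
    by simp
  then have "112 * M \<le> 7 * (M * g)"
    by simp
  moreover have "(60 * g + 70) * M = 60 * (M * g) + 70 * M"
    by (simp add: algebra_simps)
  ultimately show "(60 * imem s vG 0 + 70) * imem s vM 0 + 20 + 9 * (M * g) \<le> 80 * (imem s vM 0 * imem s vG 0)"
    using \<open>8 * 16 \<le> M\<close> unfolding M_def[symmetric] g_def[symmetric] by linarith
  fix r :: ram_state
  assume r: "(\<forall>c k l. imem s vG 0 dvd c \<longrightarrow> c \<le> k \<longrightarrow> k < l \<longrightarrow> l < c + imem s vG 0 \<longrightarrow> l < imem s vM 0 \<longrightarrow> rmem r rS k \<le> rmem r rS l) \<and>
    (\<forall>f :: real \<Rightarrow> nat. (\<Sum>k<imem s vM 0. f (rmem r rS k)) = (\<Sum>k<imem s vM 0. f (rmem s rS k)))"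
    and un: "unchanged sort_blocks s r"
  define A where "A = rmem r rS"
  have cnt: "tally P M A = tally P M (rmem s rS)" for P
  proof -
    show ?thesis
      using conjunct2[OF r, THEN spec, of "\<lambda>x. if P x then 1 else 0"] by (simp add: tally_def A_def M_def)
  qed
  have sorted: "A (b * (4 * h) + k) \<le> A (b * (4 * h) + l)" if "b < c" "k < l" "l < 4 * h" for b k l
  proof -
    have "Suc b * (4 * h) \<le> c * (4 * h)"
      using that by (intro mult_le_mono1) simp
    then have "b * (4 * h) + l < M"
      using that by (simp add: M)
    then show ?thesis
      using conjunct1[OF r, THEN spec, THEN spec, THEN spec, of "b * (4 * h)" "b * (4 * h) + k" "b * (4 * h) + l"] that g by (simp add: A_def g_def M_def)
  qed
  have Mq: "imem r vM 0 = 4 * (c * h)"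
    using unchanged_imem[OF un, of vM] M by (simp add: M_def)
  show "runs (thin_com ;; ISet vG (IAdd (IVar vG) (IVar vG)) ;; ISet vH (IAdd (IVar vH) (IVar vH)))
    r (9 * (M * g)) (\<lambda>s'. thinned N X s' (Suc j) q)"
  proof (rule runs_Seq[OF runs_thin[OF Mq]])
    fix t :: ram_state
    assume t: "imem t vM 0 = c * h \<and> (\<forall>k<c * h. rmem t rS k = rmem r rS (4 * k + 3))" and un2: "unchanged thin_com r t"
    define B where "B = rmem t rS"
    have cntB: "tally P (c * h) B = tally P (c * h) (\<lambda>k. A (4 * k + 3))" for P
      using t by (simp add: tally_def A_def B_def)
    have thin_le: "4 * tally (\<lambda>x. x \<le> p) (c * h) (\<lambda>k. A (4 * k + 3)) \<le> tally (\<lambda>x. x \<le> p) (4 * (c * h)) A" for p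
    proof (rule tally_le_thin)
      fix k i assume ki: "k < c * h" "i < (3::nat)"
      have "h > 0"
        by (simp add: h_def)
      \<comment> \<open>Element k of the thinned sample is the survivor of group k mod h in block k
        div h, as a block of 4 h elements consists of h groups.\<close>
      have "A ((k div h) * (4 * h) + (4 * (k mod h) + i)) \<le> A ((k div h) * (4 * h) + (4 * (k mod h) + 3))"
        using ki \<open>h > 0\<close> less_mult_imp_div_less[of k c h] mod_less_divisor[of h k] by (intro sorted) linarith+
      moreover have "(k div h) * (4 * h) + (4 * (k mod h) + n) = 4 * k + n" for n
      proof -
        have "4 * k = 4 * (k div h * h + k mod h)"
          by simp
        then show ?thesis
          by (simp only: algebra_simps)
      qed
      ultimately show "A (4 * k + i) \<le> A (4 * k + 3)"
        by simp
    qed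
    have le1: "4 * tally (\<lambda>x. x \<le> p) (c * h) B \<le> tally (\<lambda>x. x \<le> p) M (rmem s rS)" for p
      using thin_le[of p] cnt[of "\<lambda>x. x \<le> p"] by (simp add: cntB M mult.left_commute)
    have thin_ge: "4 * tally (\<lambda>x. p \<le> x) (c * h) (\<lambda>k. A (4 * k + 3)) \<le> tally (\<lambda>x. p \<le> x) (c * (4 * h)) A + 4 * c" for p
      using sorted by (rule tally_ge_thin)
    have ge1: "4 * tally (\<lambda>x. p \<le> x) (c * h) B \<le> tally (\<lambda>x. p \<le> x) M (rmem s rS) + 4 * c" for p
      using thin_ge[of p] cnt[of "\<lambda>x. p \<le> x"] by (simp add: cntB M)
    have le2: "4 ^ Suc j * tally (\<lambda>x. x \<le> p) (c * h) B \<le> tally (\<lambda>x. x \<le> p) N X" for p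
    proof -
      have "4 ^ Suc j * tally (\<lambda>x. x \<le> p) (c * h) B = 4 ^ j * (4 * tally (\<lambda>x. x \<le> p) (c * h) B)"
        by simp
      also have "\<dots> \<le> 4 ^ j * tally (\<lambda>x. x \<le> p) M (rmem s rS)"
        using le1 by (intro mult_le_mono2)
      also note le
      finally show ?thesis .
    qed
    have ge2: "real (4 ^ Suc j * tally (\<lambda>x. p \<le> x) (c * h) B)
        \<le> real (tally (\<lambda>x. p \<le> x) N X) + real N / 2 - real N / (2 * 2 ^ Suc j)" for p
    proof -
      have "4 ^ Suc j * tally (\<lambda>x. p \<le> x) (c * h) B = 4 ^ j * (4 * tally (\<lambda>x. p \<le> x) (c * h) B)"
        by simp
      also have "\<dots> \<le> 4 ^ j * (tally (\<lambda>x. p \<le> x) M (rmem s rS) + 4 * c)"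
        using ge1 by (intro mult_le_mono2)
      finally have "real (4 ^ Suc j * tally (\<lambda>x. p \<le> x) (c * h) B) \<le>
        real (4 ^ j * (tally (\<lambda>x. p \<le> x) M (rmem s rS) + 4 * c))"
        by (rule of_nat_mono)
      also have "\<dots> = real (4 ^ j * tally (\<lambda>x. p \<le> x) M (rmem s rS)) + real (4 ^ j * (4 * c))"
        by (simp add: algebra_simps)
      also have "\<dots> \<le> real (tally (\<lambda>x. p \<le> x) N X) + real N / 2 - real N / (2 * 2 ^ j) + real (4 ^ j * (4 * c))"
        using ge[of p] by simp
      \<comment> \<open>The loss of 4 elements in each of c blocks, each weighted by
        \<open>4 ^ j\<close>, is exactly the step from N / (2 * 2 ^ j) to N / (2 * 2 ^ Suc j) in the
        invariant.\<close>
      also have "real (4 ^ j * (4 * c)) = real N / (2 * 2 ^ Suc j)"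
        by (simp add: N h_def)
      also have "real N / (2 * 2 ^ j) = real N / (2 * 2 ^ Suc j) + real N / (2 * 2 ^ Suc j)"
        by simp
      finally show ?thesis
        by simp
    qed
    let ?fin = "effect (ISet vG (IAdd (IVar vG) (IVar vG)) ;; ISet vH (IAdd (IVar vH) (IVar vH))) t"
    have GH: "imem t vG = imem s vG" "imem t vH = imem s vH"
      using unchanged_imem[OF un, of vG] unchanged_imem[OF un, of vH]
        unchanged_imem[OF un2, of vG] unchanged_imem[OF un2, of vH] by simp_all
    have "c * h = 16 * 2 ^ Suc j * 8 ^ q" "N = 16 * 2 ^ Suc j * 8 ^ q * 4 ^ Suc j"
      by (simp_all add: N c_def h_def)
    moreover have "imem ?fin vG 0 = 16 * 2 ^ Suc j" "imem ?fin vH 0 = 4 * 2 ^ Suc j" "imem ?fin vM 0 = c * h" "rmem ?fin rS = B"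
      using th t by (simp_all add: GH thinned_def B_def)
    ultimately have "thinned N X ?fin (Suc j) q"
      using le2 ge2 unfolding thinned_def by simp
    then show "runs (ISet vG (IAdd (IVar vG) (IVar vG)) ;; ISet vH (IAdd (IVar vH) (IVar vH))) t 20 (\<lambda>s'. thinned N X s' (Suc j) q)"
      by (intro runs_straight_line) simp_all
  next
    have "8 \<le> c" "4 \<le> h"
      by (simp_all add: c_def h_def)
    then have "8 * 4 \<le> c * h" "c * h * 4 \<le> c * h * h"
      by (intro mult_le_mono; simp)+
    moreover have "9 * (M * g) = 144 * (c * h * h)"
      by (simp add: M g)
    ultimately show "30 * (c * h) + 30 + 20 \<le> 9 * (M * g)"
      by linarith
  qed
qed

text \<open>With P = M * g a round costs 80 P and leaves P / 2. Since 80 P + 170 P / 2 = 165 P, the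
  potential 170 P has 5 P to spare for the test.\<close>

lemma runs_thinning_loop:
  assumes "thinned N X s j q"
  shows "runs thinning_loop s (170 * (imem s vM 0 * imem s vG 0) + 20) (\<lambda>s'. \<exists>j'. thinned N X s' j' 0)"
  unfolding thinning_loop_def
proof (rule runs_While[where I = "\<lambda>s'. \<exists>j q. thinned N X s' j q" and
    \<phi> = "\<lambda>s'. 170 * (imem s' vM 0 * imem s' vG 0) + 20"])
  let ?b = "ILess (IVar vG) (IVar vM)"
  let ?c = "sort_blocks ;; thin_com ;; ISet vG (IAdd (IVar vG) (IVar vG)) ;; ISet vH (IAdd (IVar vH) (IVar vH))"
  fix r :: ram_state
  assume "\<exists>j q. thinned N X r j q" and t: "tval r ?b"
  then obtain j q where th: "thinned N X r j q"
    by blast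
  obtain q' where q: "q = Suc q'"
    using t th by (cases q) (simp_all add: thinned_def)
  let ?P = "80 * (imem r vM 0 * imem r vG 0)"
  have "runs ?c r ?P (\<lambda>s''. (\<exists>j q. thinned N X s'' j q) \<and>
    1 + tcost ?b + ?P + (170 * (imem s'' vM 0 * imem s'' vG 0) + 20) \<le> 170 * (imem r vM 0 * imem r vG 0) + 20)"
  proof (rule runs_weaken[OF runs_thinning_step])
    show "thinned N X r j (Suc q')"
      using th q by simp
  next
    fix s' :: ram_state
    assume s': "thinned N X s' (Suc j) q'"
    have eq: "imem r vM 0 * imem r vG 0 = 2 * (imem s' vM 0 * imem s' vG 0)"
      using th s' by (simp add: thinned_def q algebra_simps)
    have "(1::nat) \<le> 2 ^ j" "(1::nat) \<le> 2 ^ j * 8 ^ q'"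
      by simp_all
    then have "1 * 1 \<le> (2::nat) ^ j * (2 ^ j * 8 ^ q')"
      by (rule mult_le_mono)
    moreover have "imem r vM 0 * imem r vG 0 = 2048 * (2 ^ j * (2 ^ j * 8 ^ q'))"
      using th by (simp add: thinned_def q algebra_simps)
    ultimately have "2048 \<le> imem r vM 0 * imem r vG 0"
      by simp
    then show "(\<exists>j q. thinned N X s' j q) \<and>
      1 + tcost ?b + ?P + (170 * (imem s' vM 0 * imem s' vG 0) + 20) \<le> 170 * (imem r vM 0 * imem r vG 0) + 20"
      using s' unfolding eq by auto
  qed simp
  then show "\<exists>k. runs ?c r k (\<lambda>s''. (\<exists>j q. thinned N X s'' j q) \<and>
    1 + tcost ?b + k + (170 * (imem s'' vM 0 * imem s'' vG 0) + 20) \<le> 170 * (imem r vM 0 * imem r vG 0) + 20)"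
    by blast
next
  fix r :: ram_state
  assume "\<exists>j q. thinned N X r j q" and t: "\<not> tval r (ILess (IVar vG) (IVar vM))"
  then obtain j q where th: "thinned N X r j q"
    by blast
  have "q = 0"
  proof (cases q)
    case (Suc q')
    have "Suc 0 < 8 * 8 ^ q'"
      by (rule less_le_trans[of _ "8 * 1"]) simp_all
    then show ?thesis
      using t th by (simp add: thinned_def Suc)
  qed
  then show "1 + tcost (ILess (IVar vG) (IVar vM)) \<le> 170 * (imem r vM 0 * imem r vG 0) + 20 \<and> (\<exists>j. thinned N X r j 0)"
    using th by auto
qed (use assms in auto)

section \<open>Pivots from the thinned sample\<close>

definition pivot_com :: com where
  "pivot_com =
     Cond (ILess (IVar vA) (IConst 16))
       (RSet rP (RRead rX (IConst 0)))
       ((ISet vM (IConst 16) ;;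
         While (ILess (IAdd (IAdd (IAdd (IVar vM) (IVar vM)) (IAdd (IVar vM) (IVar vM)))
                            (IAdd (IAdd (IVar vM) (IVar vM)) (IAdd (IVar vM) (IVar vM))))
                      (IAdd (IVar vA) (IConst 1)))
           (ISet vM (IAdd (IAdd (IAdd (IVar vM) (IVar vM)) (IAdd (IVar vM) (IVar vM)))
                          (IAdd (IAdd (IVar vM) (IVar vM)) (IAdd (IVar vM) (IVar vM)))))) ;;
        For vI vM (RWrite rS (IVar vI) (RRead rX (IVar vI))) ;;
        (ISet vG (IConst 16) ;; ISet vH (IConst 4)) ;;
        thinning_loop ;;
        sort_blocks ;;
        RSet rP (RRead rS (IVar vH)))"

lemma iwrites_pivot [simp]: "iwrites pivot_com = {vI, vJ, vB, vK, vT, vM, vG, vH}"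
  and rwrites_pivot [simp]: "rwrites pivot_com = {rS, rTmp, rP}"
  by (auto simp: pivot_com_def)

lemma tally_mono: "m \<le> m' \<Longrightarrow> tally P m A \<le> tally P m' A"
  unfolding tally_def by (rule sum_mono2) auto

lemma tally_ge_card:
  assumes "\<And>k. k \<in> K \<Longrightarrow> k < m \<and> P (A k)"
  shows "card K \<le> tally P m A"
proof -
  have "card K \<le> card {k \<in> {..<m}. P (A k)}"
    using assms by (intro card_mono) auto
  then show ?thesis
    by (simp add: tally_def sum.If_cases Int_def)
qed

text \<open>This is why the pivot has rank h among the 4 h elements of the last block and not the
  middle rank. Up to ties, h of them are below and 3 h above, each standing for \<open>4 ^ j\<close>
  elements of X: N / 4 below and 3 N / 4 above. The upper count may be overstated by N / 2, so a
  quarter remains on either side.\<close>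

lemma thinned_pivot:
  assumes th: "thinned N X s j 0"
    and sorted: "\<And>k l. k < l \<Longrightarrow> l < 16 * 2 ^ j \<Longrightarrow> A k \<le> A l"
    and cnt: "\<And>P. tally P (16 * 2 ^ j) A = tally P (16 * 2 ^ j) (rmem s rS)"
  shows "N \<le> 4 * tally (\<lambda>x. x \<le> A (4 * 2 ^ j)) N X" "N \<le> 4 * tally (\<lambda>x. A (4 * 2 ^ j) \<le> x) N X"
proof -
  define h where "h = 4 * (2::nat) ^ j"
  have N: "N = 4 * h * 4 ^ j"
    using th by (simp add: thinned_def h_def)
  have sorted: "A k \<le> A l" if "k \<le> l" "l < 4 * h" for k l
    using sorted[of k l] that by (cases "k = l") (simp_all add: h_def)
  have "h > 0"
    by (simp add: h_def)
  have "card {..<h} \<le> tally (\<lambda>x. x \<le> A h) (4 * h) A"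
    by (rule tally_ge_card) (use sorted \<open>h > 0\<close> in auto)
  then have "4 ^ j * h \<le> 4 ^ j * tally (\<lambda>x. x \<le> A h) (4 * h) A"
    by simp
  also have "tally (\<lambda>x. x \<le> A h) (4 * h) A = tally (\<lambda>x. x \<le> A h) (imem s vM 0) (rmem s rS)"
    using cnt th by (simp add: h_def thinned_def)
  also have "4 ^ j * \<dots> \<le> tally (\<lambda>x. x \<le> A h) N X"
    using th unfolding thinned_def by blast
  finally show "N \<le> 4 * tally (\<lambda>x. x \<le> A (4 * 2 ^ j)) N X"
    by (simp add: N h_def[symmetric] mult.commute)
  have "card {h..<4 * h} \<le> tally (\<lambda>x. A h \<le> x) (4 * h) A"
    by (rule tally_ge_card) (use sorted \<open>h > 0\<close> in auto)
  then have "real (4 ^ j * (3 * h)) \<le> real (4 ^ j * tally (\<lambda>x. A h \<le> x) (4 * h) A)"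
    by simp
  also have "tally (\<lambda>x. A h \<le> x) (4 * h) A = tally (\<lambda>x. A h \<le> x) (imem s vM 0) (rmem s rS)"
    using cnt th by (simp add: h_def thinned_def)
  also have "real (4 ^ j * \<dots>) \<le> real (tally (\<lambda>x. A h \<le> x) N X) + real N / 2 - real N / (2 * 2 ^ j)"
    using th unfolding thinned_def by blast
  also have "\<dots> \<le> real (tally (\<lambda>x. A h \<le> x) N X) + real N / 2"
    by simp
  finally have "real (N + 2 * N) \<le> real (4 * tally (\<lambda>x. A h \<le> x) N X + 2 * N)"
    by (simp add: N)
  then show "N \<le> 4 * tally (\<lambda>x. A (4 * 2 ^ j) \<le> x) N X"
    unfolding h_def of_nat_le_iff by linarith
qed

text \<open>The sample is a prefix of N elements, N being the largest 16 * 8 ^ q up to m. Hence m <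
  8 N, and a quarter of N exceeds m / 32. With fewer than 16 elements any of them will do, as it
  counts itself on both sides.\<close>

lemma runs_pivot:
  fixes s :: ram_state
  defines "m \<equiv> imem s vA 0" and "X \<equiv> rmem s rX"
  assumes m: "0 < m"
  shows "runs pivot_com s (4200 * m) (\<lambda>s'.
    m \<le> 32 * tally (\<lambda>x. x \<le> rmem s' rP 0) m X \<and> m \<le> 32 * tally (\<lambda>x. rmem s' rP 0 \<le> x) m X)"
    (is "runs _ _ _ ?Q")
  unfolding pivot_com_def
proof (rule runs_Cond[where k = "4190 * m"])
  assume "tval s (ILess (IVar vA) (IConst 16))"
  then have "m < 16"
    by (simp add: m_def)
  have "card {0::nat} \<le> tally (\<lambda>x. x \<le> X 0) m X" "card {0::nat} \<le> tally (\<lambda>x. X 0 \<le> x) m X"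
    by (rule tally_ge_card; use m in simp)+
  then show "runs (RSet rP (RRead rX (IConst 0))) s (4190 * m) ?Q"
    using m \<open>m < 16\<close> by (intro runs_straight_line) (simp_all add: X_def[symmetric])
next
  assume "\<not> tval s (ILess (IVar vA) (IConst 16))"
  then have m16: "16 \<le> m"
    by (simp add: m_def)
  \<comment> \<open>Eight times \<open>vM\<close>, by additions only. Comparing it with m + 1 turns
    the strict test into \<le> m.\<close>
  let ?M8 = "IAdd (IAdd (IAdd (IVar vM) (IVar vM)) (IAdd (IVar vM) (IVar vM)))
     (IAdd (IAdd (IVar vM) (IVar vM)) (IAdd (IVar vM) (IVar vM)))"
  let ?size = "ISet vM (IConst 16) ;; While (ILess ?M8 (IAdd (IVar vA) (IConst 1))) (ISet vM ?M8)"
  let ?copy = "For vI vM (RWrite rS (IVar vI) (RRead rX (IVar vI)))"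
  let ?init = "ISet vG (IConst 16) ;; ISet vH (IConst 4)"
  let ?R = "\<lambda>s'. \<exists>q. imem s' vM 0 = 16 * 8 ^ q \<and> imem s' vM 0 \<le> m \<and> m < 8 * imem s' vM 0"
  have "runs ?size s (100 * m + 110) ?R"
  proof (rule runs_Seq_straight[where l = "100 * m + 100"], simp, rule runs_While[where I = "\<lambda>s'. \<exists>q. imem s' vM 0 = 16 * 8 ^ q \<and> imem s' vM 0 \<le> m" and
      \<phi> = "\<lambda>s'. 100 * (m - imem s' vM 0) + 100"])
    show "\<exists>q. imem (effect (ISet vM (IConst 16)) s) vM 0 = 16 * 8 ^ q \<and> imem (effect (ISet vM (IConst 16)) s) vM 0 \<le> m"
      using m16 by (intro exI[of _ 0]) simp
  next
    fix r :: ram_state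
    assume I: "\<exists>q. imem r vM 0 = 16 * 8 ^ q \<and> imem r vM 0 \<le> m"
      and un: "unchanged (While (ILess ?M8 (IAdd (IVar vA) (IConst 1))) (ISet vM ?M8)) (effect (ISet vM (IConst 16)) s) r"
    have vA: "imem r vA 0 = m"
      using unchanged_imem[OF un, of vA] by (simp add: m_def)
    obtain q where q: "imem r vM 0 = 16 * 8 ^ q" "imem r vM 0 \<le> m"
      using I by blast
    {
      assume "tval r (ILess ?M8 (IAdd (IVar vA) (IConst 1)))"
      then have le: "8 * imem r vM 0 \<le> m"
        by (simp add: vA)
      have "(1::nat) \<le> imem r vM 0"
        by (simp add: q)
      then have dec: "100 * (m - 8 * imem r vM 0) + 100 \<le> 100 * (m - imem r vM 0)"
        using le by linarith
      have "runs (ISet vM ?M8) r 40 (\<lambda>s''. (\<exists>q. imem s'' vM 0 = 16 * 8 ^ q \<and> imem s'' vM 0 \<le> m) \<and>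
          1 + tcost (ILess ?M8 (IAdd (IVar vA) (IConst 1))) + 40 + (100 * (m - imem s'' vM 0) + 100)
            \<le> 100 * (m - imem r vM 0) + 100)"
        using le dec by (intro runs_straight_line conjI exI[of _ "Suc q"]) (simp_all add: q)
      then show "\<exists>k. runs (ISet vM ?M8) r k (\<lambda>s''. (\<exists>q. imem s'' vM 0 = 16 * 8 ^ q \<and> imem s'' vM 0 \<le> m) \<and>
          1 + tcost (ILess ?M8 (IAdd (IVar vA) (IConst 1))) + k + (100 * (m - imem s'' vM 0) + 100)
            \<le> 100 * (m - imem r vM 0) + 100)"
        by blast
    next
      assume "\<not> tval r (ILess ?M8 (IAdd (IVar vA) (IConst 1)))"
      then show "1 + tcost (ILess ?M8 (IAdd (IVar vA) (IConst 1))) \<le> 100 * (m - imem r vM 0) + 100 \<and> ?R r"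
        using I by (auto simp: vA)
    }
  qed simp_all
  then show "runs (?size ;; ?copy ;; ?init ;; thinning_loop ;; sort_blocks ;; RSet rP (RRead rS (IVar vH))) s (4190 * m) ?Q"
  proof (rule runs_Seq)
    fix s1 :: ram_state
    assume "?R s1" and un1: "unchanged ?size s s1"
    then obtain q where q: "imem s1 vM 0 = 16 * 8 ^ q"
      by blast
    define N where "N = imem s1 vM 0"
    have N: "N \<le> m" "m < 8 * N"
      using \<open>?R s1\<close> by (auto simp: N_def)
    have X1: "rmem s1 rX = X"
      using unchanged_rmem[OF un1, of rX] by (simp add: X_def)
    have copy: "runs ?copy s1 (30 * N + 9) (\<lambda>s'. \<forall>k<N. rmem s' rS k = X k)"
    proof (rule runs_For[where I = "\<lambda>i s'. \<forall>k<i. rmem s' rS k = X k" and k = 10])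
      fix i and r :: ram_state
      assume i: "i < imem s1 vM 0" "imem r vI 0 = i" and I: "\<forall>k<i. rmem r rS k = X k"
        and un: "unchanged ?copy s1 r"
      have "rmem r rX = X"
        using unchanged_rmem[OF un, of rX] by (simp add: X1)
      then show "runs (RWrite rS (IVar vI) (RRead rX (IVar vI))) r 10
        (\<lambda>s''. \<forall>k<Suc i. rmem (iwrite vI 0 (Suc i) s'') rS k = X k)"
        using i I by (intro runs_straight_line) (auto simp: less_Suc_eq)
    qed (auto simp: N_def)
    show "runs (?copy ;; ?init ;; thinning_loop ;; sort_blocks ;; RSet rP (RRead rS (IVar vH))) s1 (4000 * m) ?Q"
    proof (rule runs_Seq[OF copy])
      fix s2 :: ram_state
      assume s2: "\<forall>k<N. rmem s2 rS k = X k" and un2: "unchanged ?copy s1 s2"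
      have vM2: "imem s2 vM 0 = 16 * 8 ^ q"
        using unchanged_imem[OF un2, of vM] q by simp
      have "tally P N (rmem s2 rS) = tally P N X" for P
        using s2 by (simp add: tally_def)
      moreover have N': "N = 16 * 8 ^ q"
        by (simp add: N_def q)
      ultimately have th: "thinned N X (effect ?init s2) 0 q"
        by (simp add: thinned_def vM2)
      show "runs (?init ;; thinning_loop ;; sort_blocks ;; RSet rP (RRead rS (IVar vH))) s2 (3960 * N) ?Q"
      proof (rule runs_Seq_straight, simp, rule runs_Seq[OF runs_thinning_loop[OF th]])
        fix s3 :: ram_state
        assume "\<exists>j'. thinned N X s3 j' 0"
        then obtain j where th3: "thinned N X s3 j 0"
          by blast
        define g where "g = (16::nat) * 2 ^ j"
        have vG: "imem s3 vG 0 = g" "imem s3 vM 0 = g" "imem s3 vH 0 = 4 * 2 ^ j"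
          using th3 by (simp_all add: thinned_def g_def)
        \<comment> \<open>At the end N = 16 * 8 ^ j, while the one block left has g = 16 * 2 ^ j
          elements, of the order of the cube root of N. Sorting it by insertion is therefore well
          within linear time.\<close>
        have "g * 2 ^ j \<le> N"
        proof -
          have "g * 2 ^ j \<le> g * 4 ^ j"
            by (intro mult_le_mono2 power_mono) simp_all
          also have "\<dots> = N"
            using th3 by (simp add: thinned_def g_def)
          finally show ?thesis .
        qed
        then have gg: "g * g \<le> 16 * N"
          by (simp add: g_def)
        have gN: "g \<le> N" "16 \<le> N"
          using th3 by (simp_all add: thinned_def g_def)
        show "runs (sort_blocks ;; RSet rP (RRead rS (IVar vH))) s3 (1100 * N) ?Q"
        proof (rule runs_Seq[OF runs_sort_blocks])
          fix s4 :: ram_state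
          assume s4: "(\<forall>c k l. imem s3 vG 0 dvd c \<longrightarrow> c \<le> k \<longrightarrow> k < l \<longrightarrow> l < c + imem s3 vG 0 \<longrightarrow> l < imem s3 vM 0 \<longrightarrow> rmem s4 rS k \<le> rmem s4 rS l) \<and>
            (\<forall>f :: real \<Rightarrow> nat. (\<Sum>k<imem s3 vM 0. f (rmem s4 rS k)) = (\<Sum>k<imem s3 vM 0. f (rmem s3 rS k)))"
            and un4: "unchanged sort_blocks s3 s4"
          define p where "p = rmem s4 rS (4 * 2 ^ j)"
          have sorted: "rmem s4 rS k \<le> rmem s4 rS l" if "k < l" "l < 16 * 2 ^ j" for k l
            using conjunct1[OF s4, THEN spec, THEN spec, THEN spec, of 0 k l] that by (simp add: vG g_def)
          have cnt: "tally P (16 * 2 ^ j) (rmem s4 rS) = tally P (16 * 2 ^ j) (rmem s3 rS)" for P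
            using conjunct2[OF s4, THEN spec, of "\<lambda>x. if P x then 1 else 0"] by (simp add: tally_def vG g_def)
          have "N \<le> 4 * tally (\<lambda>x. x \<le> p) N X" "N \<le> 4 * tally (\<lambda>x. p \<le> x) N X"
            unfolding p_def by (rule thinned_pivot[OF th3 sorted cnt]; assumption)+
          then have "m \<le> 32 * tally (\<lambda>x. x \<le> p) m X" "m \<le> 32 * tally (\<lambda>x. p \<le> x) m X"
            using tally_mono[OF N(1), of "\<lambda>x. x \<le> p" X] tally_mono[OF N(1), of "\<lambda>x. p \<le> x" X] N(2) by linarith+
          moreover have "imem s4 vH 0 = 4 * 2 ^ j"
            using unchanged_imem[OF un4, of vH] vG by simp
          ultimately show "runs (RSet rP (RRead rS (IVar vH))) s4 10 ?Q"
            by (intro runs_straight_line) (simp_all add: p_def[symmetric])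
        next
          have "(60 * g + 70) * g = 60 * (g * g) + 70 * g"
            by (simp add: algebra_simps)
          then show "(60 * imem s3 vG 0 + 70) * imem s3 vM 0 + 20 + 10 \<le> 1100 * N"
            using gg gN unfolding vG by linarith
        qed (simp add: vG g_def)
      next
        show "170 * (imem (effect ?init s2) vM 0 * imem (effect ?init s2) vG 0) + 20 + 1100 * N \<le> 3900 * N"
          by (simp add: vM2 N')
      next
        show "max_cost ?init + 3900 * N \<le> 3960 * N"
          by (simp add: N')
      qed
    next
      have "1 \<le> N"
        by (simp add: N_def q)
      then show "30 * N + 9 + 3960 * N \<le> 4000 * m"
        using N by linarith
    qed
  next
    show "100 * m + 110 + 4000 * m \<le> 4190 * m"
      using m16 by linarith
  qed
qed (use m in simp_all)

section \<open>Weighted quantiles by prune and search\<close>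

abbreviation (input) "vF \<equiv> 11 :: nat"
abbreviation (input) "rC \<equiv> 8 :: nat"
abbreviation (input) "rD \<equiv> 17 :: nat"
abbreviation (input) "rHi \<equiv> 20 :: nat"
abbreviation (input) "rLo \<equiv> 21 :: nat"
abbreviation (input) "rTau \<equiv> 22 :: nat"

text \<open>\<open>tail_gt\<close> and \<open>tail_ge\<close> are the right and the left derivative
  at \<tau> of the sum of all C k * min (X k) \<tau>. An inner maximiser of the concave function is
  thus a \<tau> whose two tails enclose \<lambda> - L, which is the quantile to be found.\<close>

definition tail_gt :: "nat \<Rightarrow> (nat \<Rightarrow> real) \<Rightarrow> (nat \<Rightarrow> real) \<Rightarrow> real \<Rightarrow> real" where
  "tail_gt m X C \<tau> = (\<Sum>k<m. if \<tau> < X k then C k else 0)"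

definition tail_ge :: "nat \<Rightarrow> (nat \<Rightarrow> real) \<Rightarrow> (nat \<Rightarrow> real) \<Rightarrow> real \<Rightarrow> real" where
  "tail_ge m X C \<tau> = (\<Sum>k<m. if \<tau> \<le> X k then C k else 0)"

definition filter_com :: "int \<Rightarrow> com" where
  "filter_com sg =
     ISet vJ (IConst 0) ;;
     For vI vA
       (Cond (RLess (RConst 0) (RMul (RConst sg) (RSub (RRead rX (IVar vI)) (RVar rP))))
         (RWrite rX (IVar vJ) (RRead rX (IVar vI)) ;;
          RWrite rC (IVar vJ) (RRead rC (IVar vI)) ;;
          ISet vJ (IAdd (IVar vJ) (IConst 1)))
         Skip) ;;
     ISet vA (IVar vJ)"

lemma iwrites_filter [simp]: "iwrites (filter_com sg) = {vI, vJ, vA}"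
  and rwrites_filter [simp]: "rwrites (filter_com sg) = {rX, rC}"
  by (auto simp: filter_com_def)

text \<open>Compaction is in place, as \<open>vJ\<close> never overtakes \<open>vI\<close>. The kept
  pairs are described through sums of arbitrary functions; suitable choices yield their number,
  their weight and their tails.\<close>

lemma runs_filter:
  fixes s :: ram_state and sg :: int
  defines "m \<equiv> imem s vA 0" and "X \<equiv> rmem s rX" and "C \<equiv> rmem s rC"
    and "P \<equiv> \<lambda>x. 0 < of_int sg * (x - rmem s rP 0)"
  shows "runs (filter_com sg) s (60 * m + 30) (\<lambda>s'.
    (\<forall>k<imem s' vA 0. \<exists>l<m. rmem s' rX k = X l \<and> P (X l)) \<and>
    (\<forall>f :: real \<Rightarrow> real \<Rightarrow> real. (\<Sum>k<imem s' vA 0. f (rmem s' rX k) (rmem s' rC k))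
       = (\<Sum>k<m. if P (X k) then f (X k) (C k) else 0)))"
    (is "runs _ _ _ ?Q")
  unfolding filter_com_def
proof (rule runs_Seq_straight[where l = "60 * m + 25"], simp, rule runs_Seq[where k = "60 * m + 9" and l = 10])
  let ?s = "effect (ISet vJ (IConst 0)) s"
  let ?I = "\<lambda>i s'. imem s' vJ 0 \<le> i \<and> (\<forall>k\<ge>i. rmem s' rX k = X k \<and> rmem s' rC k = C k) \<and>
    (\<forall>k<imem s' vJ 0. \<exists>l<m. rmem s' rX k = X l \<and> P (X l)) \<and>
    (\<forall>f :: real \<Rightarrow> real \<Rightarrow> real. (\<Sum>k<imem s' vJ 0. f (rmem s' rX k) (rmem s' rC k))
       = (\<Sum>k<i. if P (X k) then f (X k) (C k) else 0))"
  let ?c = "Cond (RLess (RConst 0) (RMul (RConst sg) (RSub (RRead rX (IVar vI)) (RVar rP))))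
         (RWrite rX (IVar vJ) (RRead rX (IVar vI)) ;;
          RWrite rC (IVar vJ) (RRead rC (IVar vI)) ;;
          ISet vJ (IAdd (IVar vJ) (IConst 1)))
         Skip"
  have sums: "(\<Sum>k<j. (f :: real \<Rightarrow> real \<Rightarrow> real) ((A(j := x)) k) ((B(j := y)) k)) = (\<Sum>k<j. f (A k) (B k))" for f A B and j :: nat and x y
    by (rule sum.cong) auto
  show "runs (For vI vA ?c) ?s (60 * m + 9) (?I m)"
  proof (rule runs_For[where I = ?I and k = 48])
    fix i and r :: ram_state
    assume i: "i < imem ?s vA 0" "imem r vI 0 = i" and I: "?I i r" and un: "unchanged (For vI vA ?c) ?s r"
    have im: "i < m"
      using i by (simp add: m_def)
    have p: "rmem r rP 0 = rmem s rP 0"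
      using unchanged_rmem[OF un, of rP] by simp
    have Xi: "rmem r rX i = X i" "rmem r rC i = C i"
      using I by simp_all
    show "runs ?c r 48 (\<lambda>s''. ?I (Suc i) (iwrite vI 0 (Suc i) s''))"
    proof (rule runs_straight_line)
      define q where "q = effect ?c r"
      show "?I (Suc i) (iwrite vI 0 (Suc i) (effect ?c r))"
        unfolding q_def[symmetric]
      proof (cases "P (X i)")
        case True
        then have eff: "imem q vJ 0 = Suc (imem r vJ 0)"
          "rmem q rX = (rmem r rX)(imem r vJ 0 := X i)"
          "rmem q rC = (rmem r rC)(imem r vJ 0 := C i)"
          using i Xi p by (simp_all add: q_def P_def)
        show "?I (Suc i) (iwrite vI 0 (Suc i) q)"
          using I True im by (auto simp: eff sums less_Suc_eq)
      next
        case False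
        then have eff: "q = r"
          using i Xi p by (simp add: q_def P_def)
        show "?I (Suc i) (iwrite vI 0 (Suc i) q)"
          using I False unfolding eff by auto
      qed
    qed simp_all
  qed (auto simp: m_def X_def C_def)
  fix r :: ram_state
  assume "?I m r"
  then show "runs (ISet vA (IVar vJ)) r 10 ?Q"
    by (intro runs_straight_line) simp_all
qed simp_all

definition tails_com :: com where
  "tails_com =
     (RSet rHi (RConst 0) ;; RSet rLo (RConst 0)) ;;
     For vI vA
       (Cond (RLess (RVar rP) (RRead rX (IVar vI)))
         (RSet rHi (RAdd (RVar rHi) (RRead rC (IVar vI))) ;; RSet rLo (RAdd (RVar rLo) (RRead rC (IVar vI))))
         (Cond (RLess (RRead rX (IVar vI)) (RVar rP)) Skip
           (RSet rLo (RAdd (RVar rLo) (RRead rC (IVar vI))))))"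

lemma iwrites_tails [simp]: "iwrites tails_com = {vI}"
  and rwrites_tails [simp]: "rwrites tails_com = {rHi, rLo}"
  by (auto simp: tails_com_def)

lemma runs_tails:
  fixes s :: ram_state
  defines "m \<equiv> imem s vA 0" and "X \<equiv> rmem s rX" and "C \<equiv> rmem s rC" and "p \<equiv> rmem s rP 0"
  shows "runs tails_com s (60 * m + 30) (\<lambda>s'. rmem s' rHi 0 = tail_gt m X C p \<and> rmem s' rLo 0 = tail_ge m X C p)"
  unfolding tails_com_def
proof (rule runs_Seq_straight[where l = "60 * m + 9"], simp)
  let ?s = "effect (RSet rHi (RConst 0) ;; RSet rLo (RConst 0)) s"
  let ?I = "\<lambda>i s'. rmem s' rHi 0 = tail_gt i X C p \<and> rmem s' rLo 0 = tail_ge i X C p"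
  let ?c = "Cond (RLess (RVar rP) (RRead rX (IVar vI)))
         (RSet rHi (RAdd (RVar rHi) (RRead rC (IVar vI))) ;; RSet rLo (RAdd (RVar rLo) (RRead rC (IVar vI))))
         (Cond (RLess (RRead rX (IVar vI)) (RVar rP)) Skip
           (RSet rLo (RAdd (RVar rLo) (RRead rC (IVar vI)))))"
  show "runs (For vI vA ?c) ?s (60 * m + 9) (?I m)"
  proof (rule runs_For[where I = ?I and k = 48])
    fix i and r :: ram_state
    assume i: "i < imem ?s vA 0" "imem r vI 0 = i" and I: "?I i r" and un: "unchanged (For vI vA ?c) ?s r"
    have "rmem r rP 0 = p" "rmem r rX = X" "rmem r rC = C"
      using unchanged_rmem[OF un, of rP] unchanged_rmem[OF un, of rX] unchanged_rmem[OF un, of rC]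
      by (simp_all add: p_def X_def C_def)
    then show "runs ?c r 48 (\<lambda>s''. ?I (Suc i) (iwrite vI 0 (Suc i) s''))"
      using I i by (intro runs_straight_line) (auto simp: tail_gt_def tail_ge_def)
  qed (auto simp: m_def tail_gt_def tail_ge_def)
qed simp

text \<open>Invariant of the search. D is what the remaining breakpoints have to supply: both tails
  differ from the original ones by as much as D differs from D0, but only inside the range of the
  remaining breakpoints, where every pivot lies. The strict bounds on D keep the list
  nonempty.\<close>

definition active :: "nat \<Rightarrow> (nat \<Rightarrow> real) \<Rightarrow> (nat \<Rightarrow> real) \<Rightarrow> real \<Rightarrow>
    nat \<Rightarrow> (nat \<Rightarrow> real) \<Rightarrow> (nat \<Rightarrow> real) \<Rightarrow> real \<Rightarrow> bool" where
  "active n X0 C0 D0 m X C D \<longleftrightarrow> 0 < D \<and> D < (\<Sum>k<m. C k) \<and>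
     (\<forall>\<tau>. (\<exists>k<m. X k \<le> \<tau>) \<longrightarrow> (\<exists>k<m. \<tau> \<le> X k) \<longrightarrow>
        tail_gt m X C \<tau> - D = tail_gt n X0 C0 \<tau> - D0 \<and> tail_ge m X C \<tau> - D = tail_ge n X0 C0 \<tau> - D0)"

lemma active_refl: "0 < D \<Longrightarrow> D < (\<Sum>k<n. C k) \<Longrightarrow> active n X C D n X C D"
  by (simp add: active_def)

text \<open>The discarded breakpoints lie below the new range and so occur in no tail that still
  matters.\<close>

lemma active_above:
  assumes act: "active n X0 C0 D0 m X C D" and low: "\<exists>k<m. X k \<le> p" and D: "D < tail_gt m X C p"
    and mem: "\<forall>k<m'. \<exists>l<m. X' k = X l \<and> p < X l"
    and sums: "\<And>f :: real \<Rightarrow> real \<Rightarrow> real. (\<Sum>k<m'. f (X' k) (C' k)) = (\<Sum>k<m. if p < X k then f (X k) (C k) else 0)"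
  shows "active n X0 C0 D0 m' X' C' D"
proof -
  have "tail_gt m' X' C' \<tau> - D = tail_gt n X0 C0 \<tau> - D0 \<and> tail_ge m' X' C' \<tau> - D = tail_ge n X0 C0 \<tau> - D0"
    if \<tau>: "\<exists>k<m'. X' k \<le> \<tau>" "\<exists>k<m'. \<tau> \<le> X' k" for \<tau>
  proof -
    have p: "p < \<tau>"
      using \<tau>(1) mem by force
    have "\<exists>k<m. X k \<le> \<tau>" "\<exists>k<m. \<tau> \<le> X k"
      using low p \<tau>(2) mem by fastforce+
    then have "tail_gt m X C \<tau> - D = tail_gt n X0 C0 \<tau> - D0 \<and> tail_ge m X C \<tau> - D = tail_ge n X0 C0 \<tau> - D0"
      using act by (simp add: active_def)
    moreover have "tail_gt m' X' C' \<tau> = tail_gt m X C \<tau>"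
      using sums[of "\<lambda>x c. if \<tau> < x then c else 0"] p unfolding tail_gt_def by (auto intro: sum.cong)
    moreover have "tail_ge m' X' C' \<tau> = tail_ge m X C \<tau>"
      using sums[of "\<lambda>x c. if \<tau> \<le> x then c else 0"] p unfolding tail_ge_def by (auto intro: sum.cong)
    ultimately show ?thesis
      by simp
  qed
  moreover have "D < (\<Sum>k<m'. C' k)"
    using sums[of "\<lambda>x c. c"] D by (simp add: tail_gt_def)
  ultimately show ?thesis
    using act by (simp add: active_def)
qed

text \<open>Here the discarded breakpoints, those from p upwards, belong to every tail that still
  matters. Their weight is therefore taken off D.\<close>

lemma active_below:
  assumes act: "active n X0 C0 D0 m X C D" and high: "\<exists>k<m. p \<le> X k" and D: "tail_ge m X C p < D"
    and mem: "\<forall>k<m'. \<exists>l<m. X' k = X l \<and> X l < p"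
    and sums: "\<And>f :: real \<Rightarrow> real \<Rightarrow> real. (\<Sum>k<m'. f (X' k) (C' k)) = (\<Sum>k<m. if X k < p then f (X k) (C k) else 0)"
  shows "active n X0 C0 D0 m' X' C' (D - tail_ge m X C p)"
proof -
  have split: "(\<Sum>k<m. if X k < p then f (X k) (C k) else 0) + tail_ge m X C p =
    (\<Sum>k<m. if X k < p then f (X k) (C k) else C k)" for f :: "real \<Rightarrow> real \<Rightarrow> real"
    unfolding tail_ge_def sum.distrib[symmetric] by (rule sum.cong) auto
  have "tail_gt m' X' C' \<tau> - (D - tail_ge m X C p) = tail_gt n X0 C0 \<tau> - D0 \<and>
    tail_ge m' X' C' \<tau> - (D - tail_ge m X C p) = tail_ge n X0 C0 \<tau> - D0"
    if \<tau>: "\<exists>k<m'. X' k \<le> \<tau>" "\<exists>k<m'. \<tau> \<le> X' k" for \<tau>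
  proof -
    have p: "\<tau> < p"
      using \<tau>(2) mem by force
    have "\<exists>k<m. X k \<le> \<tau>" "\<exists>k<m. \<tau> \<le> X k"
      using high p \<tau>(1) mem by fastforce+
    then have "tail_gt m X C \<tau> - D = tail_gt n X0 C0 \<tau> - D0 \<and> tail_ge m X C \<tau> - D = tail_ge n X0 C0 \<tau> - D0"
      using act by (simp add: active_def)
    moreover have "tail_gt m' X' C' \<tau> + tail_ge m X C p = tail_gt m X C \<tau>"
      using sums[of "\<lambda>x c. if \<tau> < x then c else 0"] split[of "\<lambda>x c. if \<tau> < x then c else 0"] p
      unfolding tail_gt_def by (auto intro: sum.cong)
    moreover have "tail_ge m' X' C' \<tau> + tail_ge m X C p = tail_ge m X C \<tau>"
      using sums[of "\<lambda>x c. if \<tau> \<le> x then c else 0"] split[of "\<lambda>x c. if \<tau> \<le> x then c else 0"] p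
      unfolding tail_ge_def[of m' X' C' \<tau>] tail_ge_def[of m X C \<tau>] by (auto intro: sum.cong)
    ultimately show ?thesis
      by simp
  qed
  moreover have "(\<Sum>k<m'. C' k) + tail_ge m X C p = (\<Sum>k<m. C k)"
    using sums[of "\<lambda>x c. c"] split[of "\<lambda>x c. c"] by simp
  ultimately show ?thesis
    using act D by (auto simp: active_def)
qed

definition prune_com :: com where
  "prune_com =
     pivot_com ;; tails_com ;;
     Cond (RLess (RVar rD) (RVar rHi))
       (filter_com 1)
       (Cond (RLess (RVar rLo) (RVar rD))
         (RSet rD (RSub (RVar rD) (RVar rLo)) ;; filter_com (-1))
         (RSet rTau (RVar rP) ;; ISet vF (IConst 1)))"

definition select_com :: com where
  "select_com = ISet vF (IConst 0) ;; While (ILess (IVar vF) (IConst 1)) prune_com"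

lemma writes_prune [simp]: "iwrites prune_com = {vI, vJ, vB, vK, vT, vM, vG, vH, vA, vF}"
   "rwrites prune_com = {rS, rTmp, rP, rHi, rLo, rX, rC, rD, rTau}"
  by (auto simp: prune_com_def)

lemma writes_select [simp]: "iwrites select_com = {vI, vJ, vB, vK, vT, vM, vG, vH, vA, vF}"
   "rwrites select_com = {rS, rTmp, rP, rHi, rLo, rX, rC, rD, rTau}"
  by (auto simp: select_com_def)

lemma tally_pos: "0 < tally P m A \<Longrightarrow> \<exists>k<m. P (A k)"
  by (rule ccontr) (simp add: tally_def)

lemma kept_card:
  assumes sums: "\<And>f :: real \<Rightarrow> real \<Rightarrow> real. (\<Sum>k<m'. f (X' k) (C' k)) = (\<Sum>k<m. if P (X k) then f (X k) (C k) else 0)"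
    and "\<And>x. Q x \<longleftrightarrow> \<not> P x"
  shows "m' + tally Q m X = m"
proof -
  have "real m' + real (tally Q m X) = (\<Sum>k<m. (if P (X k) then 1 else 0) + (if Q (X k) then 1 else 0))"
    using sums[of "\<lambda>_ _. 1"] by (simp add: tally_def sum.distrib if_distrib[of real] cong: if_cong)
  also have "\<dots> = (\<Sum>k<m. 1)"
    by (rule sum.cong) (use assms(2) in auto)
  finally show ?thesis
    by simp
qed

text \<open>If the right tail at the pivot exceeds D, the quantile is larger than the pivot; if the
  left tail falls short of D, it is smaller; otherwise the pivot is the quantile. Elements equal to
  the pivot are discarded on either side, so at least m / 32 elements go.\<close>

lemma runs_prune:
  fixes s :: ram_state
  defines "m \<equiv> imem s vA 0"
  assumes act: "active n X0 C0 D0 m (rmem s rX) (rmem s rC) (rmem s rD 0)" and vF: "imem s vF 0 = 0"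
  shows "runs prune_com s (4500 * m) (\<lambda>s'.
    (imem s' vF 0 = 0 \<and> active n X0 C0 D0 (imem s' vA 0) (rmem s' rX) (rmem s' rC) (rmem s' rD 0) \<and>
       32 * imem s' vA 0 + m \<le> 32 * m) \<or>
    (imem s' vF 0 = 1 \<and> tail_gt n X0 C0 (rmem s' rTau 0) \<le> D0 \<and> D0 \<le> tail_ge n X0 C0 (rmem s' rTau 0)))"
    (is "runs _ _ _ ?Q")
  unfolding prune_com_def
proof (rule runs_Seq[OF runs_pivot])
  have "0 < m"
    using act by (cases "m = 0") (auto simp: active_def)
  then show "0 < imem s vA 0"
    by (simp add: m_def)
  show "4200 * imem s vA 0 + 300 * m \<le> 4500 * m"
    by (simp add: m_def)
  define X where "X = rmem s rX"
  define C where "C = rmem s rC"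
  define D where "D = rmem s rD 0"
  fix s1 :: ram_state
  assume s1: "imem s vA 0 \<le> 32 * tally (\<lambda>x. x \<le> rmem s1 rP 0) (imem s vA 0) (rmem s rX) \<and>
     imem s vA 0 \<le> 32 * tally (\<lambda>x. rmem s1 rP 0 \<le> x) (imem s vA 0) (rmem s rX)"
    and un1: "unchanged pivot_com s s1"
  define p where "p = rmem s1 rP 0"
  have p: "m \<le> 32 * tally (\<lambda>x. x \<le> p) m X" "m \<le> 32 * tally (\<lambda>x. p \<le> x) m X"
    using s1 by (simp_all add: p_def m_def X_def)
  then have lowhigh: "\<exists>k<m. X k \<le> p" "\<exists>k<m. p \<le> X k"
    using tally_pos[of "\<lambda>x. x \<le> p" m X] tally_pos[of "\<lambda>x. p \<le> x" m X] \<open>0 < m\<close> by auto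
  have e1: "imem s1 vA = imem s vA" "rmem s1 rX = X" "rmem s1 rC = C" "rmem s1 rD = rmem s rD" "imem s1 vF = imem s vF"
    using unchanged_mem[OF un1] by (simp_all add: X_def C_def)
  show "runs (tails_com ;;
     Cond (RLess (RVar rD) (RVar rHi))
       (filter_com 1)
       (Cond (RLess (RVar rLo) (RVar rD))
         (RSet rD (RSub (RVar rD) (RVar rLo)) ;; filter_com (-1))
         (RSet rTau (RVar rP) ;; ISet vF (IConst 1)))) s1 (300 * m) ?Q"
  proof (rule runs_Seq[OF runs_tails])
    show "60 * imem s1 vA 0 + 30 + (60 * m + 100) \<le> 300 * m"
      using \<open>0 < m\<close> by (simp add: e1 m_def)
    fix s2 :: ram_state
    assume s2: "rmem s2 rHi 0 = tail_gt (imem s1 vA 0) (rmem s1 rX) (rmem s1 rC) (rmem s1 rP 0) \<and>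
       rmem s2 rLo 0 = tail_ge (imem s1 vA 0) (rmem s1 rX) (rmem s1 rC) (rmem s1 rP 0)"
      and un2: "unchanged tails_com s1 s2"
    have e2: "imem s2 vA 0 = m" "rmem s2 rX = X" "rmem s2 rC = C" "rmem s2 rD 0 = D" "rmem s2 rP 0 = p" "imem s2 vF 0 = 0"
      "rmem s2 rHi 0 = tail_gt m X C p" "rmem s2 rLo 0 = tail_ge m X C p"
      using unchanged_mem[OF un2] vF s2 by (simp_all add: e1 m_def D_def p_def)
    have act: "active n X0 C0 D0 m X C D"
      using act by (simp add: X_def C_def D_def)
    show "runs (Cond (RLess (RVar rD) (RVar rHi))
       (filter_com 1)
       (Cond (RLess (RVar rLo) (RVar rD))
         (RSet rD (RSub (RVar rD) (RVar rLo)) ;; filter_com (-1))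
         (RSet rTau (RVar rP) ;; ISet vF (IConst 1)))) s2 (60 * m + 100) ?Q"
    proof (rule runs_Cond[where k = "60 * m + 90"])
      assume "tval s2 (RLess (RVar rD) (RVar rHi))"
      then have D: "D < tail_gt m X C p"
        by (simp add: e2)
      show "runs (filter_com 1) s2 (60 * m + 90) ?Q"
      proof (rule runs_weaken[OF runs_filter])
        fix s3 :: ram_state
        assume "(\<forall>k<imem s3 vA 0. \<exists>l<imem s2 vA 0. rmem s3 rX k = rmem s2 rX l \<and> 0 < real_of_int 1 * (rmem s2 rX l - rmem s2 rP 0)) \<and>
          (\<forall>f :: real \<Rightarrow> real \<Rightarrow> real. (\<Sum>k<imem s3 vA 0. f (rmem s3 rX k) (rmem s3 rC k))
            = (\<Sum>k<imem s2 vA 0. if 0 < real_of_int 1 * (rmem s2 rX k - rmem s2 rP 0) then f (rmem s2 rX k) (rmem s2 rC k) else 0))"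
          and un3: "unchanged (filter_com 1) s2 s3"
        then have mem: "\<forall>k<imem s3 vA 0. \<exists>l<m. rmem s3 rX k = X l \<and> p < X l"
          and sums: "(\<Sum>k<imem s3 vA 0. f (rmem s3 rX k) (rmem s3 rC k)) = (\<Sum>k<m. if p < X k then f (X k) (C k) else 0)"
          for f :: "real \<Rightarrow> real \<Rightarrow> real"
          unfolding e2 by simp_all
        have e3: "rmem s3 rD 0 = D" "imem s3 vF 0 = 0"
          using unchanged_mem[OF un3] by (simp_all add: e2)
        have "imem s3 vA 0 + tally (\<lambda>x. x \<le> p) m X = m"
          using sums by (rule kept_card) auto
        then show "?Q s3"
          using active_above[OF act lowhigh(1) D mem sums] p e3 by auto
      qed (simp add: e2)
    next
      assume "\<not> tval s2 (RLess (RVar rD) (RVar rHi))"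
      then have D1: "tail_gt m X C p \<le> D"
        by (simp add: e2)
      show "runs (Cond (RLess (RVar rLo) (RVar rD))
         (RSet rD (RSub (RVar rD) (RVar rLo)) ;; filter_com (-1))
         (RSet rTau (RVar rP) ;; ISet vF (IConst 1))) s2 (60 * m + 90) ?Q"
      proof (rule runs_Cond[where k = "60 * m + 80"])
        assume "tval s2 (RLess (RVar rLo) (RVar rD))"
        then have D: "tail_ge m X C p < D"
          by (simp add: e2)
        let ?s = "effect (RSet rD (RSub (RVar rD) (RVar rLo))) s2"
        have e: "imem ?s vA 0 = m" "rmem ?s rX = X" "rmem ?s rC = C" "rmem ?s rD 0 = D - tail_ge m X C p"
          "rmem ?s rP 0 = p" "imem ?s vF 0 = 0"
          by (simp_all add: e2)
        show "runs (RSet rD (RSub (RVar rD) (RVar rLo)) ;; filter_com (-1)) s2 (60 * m + 80) ?Q"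
        proof (rule runs_Seq_straight, simp, rule runs_weaken[OF runs_filter])
          fix s3 :: ram_state
          assume "(\<forall>k<imem s3 vA 0. \<exists>l<imem ?s vA 0. rmem s3 rX k = rmem ?s rX l \<and> 0 < real_of_int (-1) * (rmem ?s rX l - rmem ?s rP 0)) \<and>
            (\<forall>f :: real \<Rightarrow> real \<Rightarrow> real. (\<Sum>k<imem s3 vA 0. f (rmem s3 rX k) (rmem s3 rC k))
              = (\<Sum>k<imem ?s vA 0. if 0 < real_of_int (-1) * (rmem ?s rX k - rmem ?s rP 0) then f (rmem ?s rX k) (rmem ?s rC k) else 0))"
            and un3: "unchanged (filter_com (-1)) ?s s3"
          then have mem: "\<forall>k<imem s3 vA 0. \<exists>l<m. rmem s3 rX k = X l \<and> X l < p"
            and sums: "(\<Sum>k<imem s3 vA 0. f (rmem s3 rX k) (rmem s3 rC k)) = (\<Sum>k<m. if X k < p then f (X k) (C k) else 0)"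
            for f :: "real \<Rightarrow> real \<Rightarrow> real"
            unfolding e by simp_all
          have e3: "rmem s3 rD 0 = D - tail_ge m X C p" "imem s3 vF 0 = 0"
            using unchanged_imem[OF un3, of vF] unchanged_rmem[OF un3, of rD] e(4,6) by simp_all
          have "imem s3 vA 0 + tally (\<lambda>x. p \<le> x) m X = m"
            using sums by (rule kept_card) auto
          then show "?Q s3"
            using active_below[OF act lowhigh(2) D mem sums] p e3 by auto
        next
          show "60 * imem ?s vA 0 + 30 \<le> 60 * m + 60"
            unfolding e by simp
        qed simp
      next
        assume "\<not> tval s2 (RLess (RVar rLo) (RVar rD))"
        then have D2: "D \<le> tail_ge m X C p"
          by (simp add: e2)
        have "tail_gt m X C p - D = tail_gt n X0 C0 p - D0" "tail_ge m X C p - D = tail_ge n X0 C0 p - D0"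
          using act lowhigh by (auto simp: active_def)
        then show "runs (RSet rTau (RVar rP) ;; ISet vF (IConst 1)) s2 (60 * m + 80) ?Q"
          using D1 D2 by (intro runs_straight_line) (simp_all add: e2)
      qed simp
    qed simp
  qed
qed

lemma runs_select:
  fixes s :: ram_state
  defines "n \<equiv> imem s vA 0" and "X \<equiv> rmem s rX" and "C \<equiv> rmem s rC" and "D \<equiv> rmem s rD 0"
  assumes "0 < D" "D < (\<Sum>k<n. C k)"
  shows "runs select_com s (144200 * n + 40) (\<lambda>s'. tail_gt n X C (rmem s' rTau 0) \<le> D \<and> D \<le> tail_ge n X C (rmem s' rTau 0))"
    (is "runs _ _ _ ?Q")
  unfolding select_com_def
proof (rule runs_Seq_straight[where l = "144200 * n + 20"], simp)
  let ?s = "effect (ISet vF (IConst 0)) s"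
  let ?I = "\<lambda>s'. (imem s' vF 0 = 0 \<and> active n X C D (imem s' vA 0) (rmem s' rX) (rmem s' rC) (rmem s' rD 0)) \<or>
    (imem s' vF 0 = 1 \<and> ?Q s')"
  \<comment> \<open>A round on m breakpoints costs 4500 m. It discards at least m / 32 of them,
    which releases 144200 m / 32 > 4506 m, and the surplus pays for the test.\<close>
  let ?\<phi> = "\<lambda>s'. if imem s' vF 0 = 0 then 144200 * imem s' vA 0 + 20 else 20"
  let ?b = "ILess (IVar vF) (IConst 1)"
  show "runs (While ?b prune_com) ?s (144200 * n + 20) ?Q"
  proof (rule runs_While[where I = ?I and \<phi> = ?\<phi>])
    show "?I ?s"
      using active_refl[OF assms(5,6)] by (simp add: n_def X_def C_def D_def)
  next
    fix r :: ram_state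
    assume I: "?I r" and t: "tval r ?b"
    define m where "m = imem r vA 0"
    have r: "imem r vF 0 = 0" "active n X C D m (rmem r rX) (rmem r rC) (rmem r rD 0)"
      using I t by (simp_all add: m_def)
    have "0 < m"
      using r(2) by (cases "m = 0") (auto simp: active_def)
    have "runs prune_com r (4500 * m) (\<lambda>s''. ?I s'' \<and> 1 + tcost ?b + 4500 * m + ?\<phi> s'' \<le> ?\<phi> r)"
    proof (rule runs_weaken[OF runs_prune])
      show "active n X C D (imem r vA 0) (rmem r rX) (rmem r rC) (rmem r rD 0)" "imem r vF 0 = 0"
        using r by (simp_all add: m_def)
      show "4500 * imem r vA 0 \<le> 4500 * m"
        by (simp add: m_def)
      fix s' :: ram_state
      assume "(imem s' vF 0 = 0 \<and> active n X C D (imem s' vA 0) (rmem s' rX) (rmem s' rC) (rmem s' rD 0) \<and>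
           32 * imem s' vA 0 + imem r vA 0 \<le> 32 * imem r vA 0) \<or>
         (imem s' vF 0 = 1 \<and> tail_gt n X C (rmem s' rTau 0) \<le> D \<and> D \<le> tail_ge n X C (rmem s' rTau 0))"
      then show "?I s' \<and> 1 + tcost ?b + 4500 * m + ?\<phi> s' \<le> ?\<phi> r"
        using r(1) \<open>0 < m\<close> unfolding m_def by auto
    qed
    then show "\<exists>k. runs prune_com r k (\<lambda>s''. ?I s'' \<and> 1 + tcost ?b + k + ?\<phi> s'' \<le> ?\<phi> r)"
      by blast
  next
    fix r :: ram_state
    assume "?I r" and t: "\<not> tval r ?b"
    then show "1 + tcost ?b \<le> ?\<phi> r \<and> ?Q r"
      by auto
  qed (simp add: n_def)
qed simp

section \<open>Soft thresholding over a box\<close>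

lemma soft_threshold_eq: "0 < lam \<Longrightarrow> soft_threshold lam t = max (t - lam) (min (t + lam) 0)"
  by (auto simp: soft_threshold_def)

lemma soft_threshold_sign: "0 < lam \<Longrightarrow> sg = 1 \<or> sg = -1 \<Longrightarrow> soft_threshold lam (sg * t) = sg * soft_threshold lam t"
  by (auto simp: soft_threshold_def)

section \<open>The upper boundary over the unit cube and its dual multipliers\<close>

definition env :: "nat \<Rightarrow> real \<Rightarrow> real \<Rightarrow> (nat \<Rightarrow> real) \<Rightarrow> (nat \<Rightarrow> real) \<Rightarrow> real \<Rightarrow> real" where
  "env n lam L C X \<theta> = (L - lam) * \<theta> + (\<Sum>i<n. C i * min (X i) \<theta>)"

text \<open>An affine bound on the maximum has to bound both pieces. The piece min (t + \<lambda>) 0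
  is at most \<mu> (t + \<lambda>), a mixture of its two arguments. In t - \<lambda>, taken with
  weight 1 - \<mu>, the fraction 1 - r i of each term is estimated by x i \<le> 1; this exceeds the
  same bound by at most (1 - \<mu>) S - 2 \<lambda> \<mu>, where S is the bracket in the assumption.
  So \<open>ex\<close> has to cover the two slacks, 0 and this one.\<close>

lemma cut_valid:
  assumes lam: "0 < lam" and \<mu>: "0 \<le> \<mu>" "\<mu> \<le> 1"
    and C: "\<And>i. i < n \<Longrightarrow> 0 \<le> C i" and r: "\<And>i. i < n \<Longrightarrow> 0 \<le> r i \<and> r i \<le> 1"
    and x: "\<And>i. i < n \<Longrightarrow> 0 \<le> x i \<and> x i \<le> 1"
    and ex: "0 \<le> ex" "(1 - \<mu>) * (L - lam + (\<Sum>i<n. (1 - r i) * C i)) - 2 * lam * \<mu> \<le> ex"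
  shows "soft_threshold lam (L + (\<Sum>i<n. C i * x i))
    \<le> \<mu> * (L + (\<Sum>i<n. C i * x i) + lam) + (1 - \<mu>) * (\<Sum>i<n. r i * (C i * x i)) + ex"
proof -
  let ?t = "L + (\<Sum>i<n. C i * x i)"
  let ?R = "\<Sum>i<n. r i * (C i * x i)"
  have "min (?t + lam) 0 \<le> \<mu> * (?t + lam)"
  proof (cases "?t + lam \<le> 0")
    case True
    have "1 * (?t + lam) \<le> \<mu> * (?t + lam)"
      by (rule mult_right_mono_neg) (use \<mu> True in auto)
    then show ?thesis
      using True by simp
  next
    case False
    then show ?thesis
      using \<mu> by simp
  qed
  moreover have "0 \<le> (1 - \<mu>) * ?R"
    using \<mu> C r x by (intro mult_nonneg_nonneg sum_nonneg) auto
  ultimately have 1: "min (?t + lam) 0 \<le> \<mu> * (?t + lam) + (1 - \<mu>) * ?R + ex"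
    using ex by linarith
  have "(\<Sum>i<n. C i * x i) \<le> (\<Sum>i<n. r i * (C i * x i) + (1 - r i) * C i)"
  proof (rule sum_mono)
    fix i assume "i \<in> {..<n}"
    then have "0 \<le> (1 - r i) * C i * (1 - x i)"
      using C r x by (intro mult_nonneg_nonneg) auto
    then show "C i * x i \<le> r i * (C i * x i) + (1 - r i) * C i"
      by (simp add: algebra_simps)
  qed
  then have "?t - lam \<le> ?R + (L - lam + (\<Sum>i<n. (1 - r i) * C i))"
    by (simp add: sum.distrib)
  then have "(1 - \<mu>) * (?t - lam) \<le> (1 - \<mu>) * (?R + (L - lam + (\<Sum>i<n. (1 - r i) * C i)))"
    using \<mu> by (intro mult_left_mono) auto
  then have 2: "?t - lam \<le> \<mu> * (?t + lam) + (1 - \<mu>) * ?R + ex"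
    using ex by (simp add: algebra_simps)
  show ?thesis
    unfolding soft_threshold_eq[OF lam] using 1 2 by simp
qed

text \<open>With r this weight, min (X i) \<theta> = r X i + (1 - r) \<theta>, and at a tie X i =
  \<theta> this holds for every r. So 1 - r is a supergradient in \<theta>, and for \<rho> in [0, 1]
  the tie is resolved by choosing one of them.\<close>

definition split_weight :: "(nat \<Rightarrow> real) \<Rightarrow> real \<Rightarrow> real \<Rightarrow> nat \<Rightarrow> real" where
  "split_weight X \<theta> \<rho> i = (if X i < \<theta> then 1 else if \<theta> < X i then 0 else 1 - \<rho>)"

lemma tail_ge_split: "tail_gt n X C \<theta> + (\<Sum>i<n. if X i = \<theta> then C i else 0) = tail_ge n X C \<theta>"
  unfolding tail_gt_def tail_ge_def sum.distrib[symmetric] by (rule sum.cong) auto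

lemma split_weight_slope:
  "(\<Sum>i<n. (1 - split_weight X \<theta> \<rho> i) * C i) = tail_gt n X C \<theta> + \<rho> * (tail_ge n X C \<theta> - tail_gt n X C \<theta>)"
proof -
  have "(\<Sum>i<n. (1 - split_weight X \<theta> \<rho> i) * C i) = tail_gt n X C \<theta> + \<rho> * (\<Sum>i<n. if X i = \<theta> then C i else 0)"
    unfolding tail_gt_def sum_distrib_left sum.distrib[symmetric] by (rule sum.cong) (auto simp: split_weight_def)
  then show ?thesis
    using tail_ge_split[of n X C \<theta>] by (metis add_diff_cancel_left')
qed

text \<open>For \<rho> in [0, 1] and nonnegative C this reads the value off a supporting line at
  \<theta>: the bracket is its slope, and the first sum is its value at 0.\<close>

lemma env_split:
  "env n lam L C X \<theta> = (\<Sum>i<n. split_weight X \<theta> \<rho> i * (C i * X i)) +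
     \<theta> * (L - lam + (\<Sum>i<n. (1 - split_weight X \<theta> \<rho> i) * C i))"
proof -
  have "(\<Sum>i<n. C i * min (X i) \<theta>) =
    (\<Sum>i<n. split_weight X \<theta> \<rho> i * (C i * X i)) + \<theta> * (\<Sum>i<n. (1 - split_weight X \<theta> \<rho> i) * C i)"
    unfolding sum_distrib_left sum.distrib[symmetric]
    by (rule sum.cong) (auto simp: split_weight_def algebra_simps)
  then show ?thesis
    by (simp add: env_def algebra_simps)
qed

text \<open>The dual multipliers: \<open>\<rho>\<close> distributes the ties so that the slope \<open>S\<close> vanishes if possible, and
  \<open>\<mu>\<close> is chosen such that the two terms in the slack of \<open>cut_valid\<close> cancel.\<close>

definition tie_weight :: "real \<Rightarrow> real \<Rightarrow> real" where
  "tie_weight hi lo = (if hi < 0 then if 0 < lo then (0 - hi) / (lo - hi) else 1 else 0)"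

definition mix_weight :: "real \<Rightarrow> real \<Rightarrow> real \<Rightarrow> real" where
  "mix_weight lam \<theta>0 S = (if 0 < S then if \<theta>0 < 1 then S / (S + 2 * lam) else 0 else 0)"

text \<open>The multiplier of \<theta> \<le> 1, nonzero only if this bound is what stops the
  ascent.\<close>

definition excess :: "real \<Rightarrow> real \<Rightarrow> real" where
  "excess \<theta>0 S = (if 0 < S then if \<theta>0 < 1 then 0 else S else 0)"

text \<open>\<open>hi\<close> and \<open>lo\<close> are the optimality conditions on [0, \<theta>0]:
  the right derivative may be positive only at \<theta>0, the left one negative only at 0. Hence the
  slope S is zero, or negative with \<theta> = 0, or positive with \<theta> = \<theta>0. In the
  first two cases \<theta> S = 0, and the bound at X equals the maximum, which is below w. In the
  third, the constraint that stops the ascent carries the multiplier.\<close>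

lemma cut_multipliers:
  fixes lam L w :: real
  assumes lam: "0 < lam" and C: "\<And>i. i < n \<Longrightarrow> 0 \<le> C i"
    and \<theta>0: "0 \<le> \<theta>0" "\<theta>0 = min 1 ((L + (\<Sum>i<n. C i * X i) + lam - w) / (2 * lam))"
    and hi: "tail_gt n X C \<theta> \<le> lam - L \<or> \<theta> = \<theta>0" and lo: "lam - L \<le> tail_ge n X C \<theta> \<or> \<theta> = 0"
    and w: "env n lam L C X \<theta> < w"
  defines "h \<equiv> L - lam + tail_gt n X C \<theta>" and "l \<equiv> L - lam + tail_ge n X C \<theta>"
  defines "\<rho> \<equiv> tie_weight h l"
  defines "S \<equiv> h + \<rho> * (l - h)"
  defines "\<mu> \<equiv> mix_weight lam \<theta>0 S" and "ex \<equiv> excess \<theta>0 S"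
  shows "0 \<le> \<rho>" "\<rho> \<le> 1" "0 \<le> \<mu>" "\<mu> \<le> 1" "0 \<le> ex"
    "(1 - \<mu>) * (L - lam + (\<Sum>i<n. (1 - split_weight X \<theta> \<rho> i) * C i)) - 2 * lam * \<mu> \<le> ex"
    "\<mu> * (L + (\<Sum>i<n. C i * X i) + lam) + (1 - \<mu>) * (\<Sum>i<n. split_weight X \<theta> \<rho> i * (C i * X i)) + ex < w"
proof -
  have hl: "h \<le> l"
    unfolding h_def l_def tail_gt_def tail_ge_def by (intro add_left_mono sum_mono) (use C in auto)
  show \<rho>: "0 \<le> \<rho>" "\<rho> \<le> 1"
    by (auto simp: \<rho>_def tie_weight_def divide_simps)
  have S: "L - lam + (\<Sum>i<n. (1 - split_weight X \<theta> \<rho> i) * C i) = S"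
    unfolding split_weight_slope by (simp add: S_def h_def l_def algebra_simps)
  let ?R = "\<Sum>i<n. split_weight X \<theta> \<rho> i * (C i * X i)"
  let ?V = "\<Sum>i<n. C i * X i"
  have R: "?R + \<theta> * S < w"
    using w unfolding env_split[of n lam L C X \<theta> \<rho>] S .
  have S_cases: "S = 0 \<or> (S < 0 \<and> l < 0) \<or> (0 < S \<and> 0 < h)"
  proof -
    consider "0 \<le> h" | "h < 0" "l \<le> 0" | "h < 0" "0 < l"
      by linarith
    then show ?thesis
      by cases (auto simp: S_def \<rho>_def tie_weight_def field_simps)
  qed
  consider "S \<le> 0" | "0 < S" "\<theta>0 < 1" | "0 < S" "1 \<le> \<theta>0"
    by linarith
  then have "0 \<le> \<mu> \<and> \<mu> \<le> 1 \<and> 0 \<le> ex \<and> (1 - \<mu>) * S - 2 * lam * \<mu> \<le> ex \<and>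
    \<mu> * (L + ?V + lam) + (1 - \<mu>) * ?R + ex < w"
  proof cases
    case 1
    then have "S = 0 \<or> \<theta> = 0"
      using S_cases lo by (auto simp: l_def)
    then show ?thesis
      using 1 R by (auto simp: \<mu>_def ex_def mix_weight_def excess_def)
  next
    case 2
    have \<theta>: "\<theta> = \<theta>0"
      using S_cases hi 2 by (auto simp: h_def)
    have \<mu>: "\<mu> = S / (S + 2 * lam)" and ex: "ex = 0"
      using 2 by (simp_all add: \<mu>_def ex_def mix_weight_def excess_def)
    have \<mu>1: "0 \<le> \<mu>" "\<mu> < 1"
      using 2 lam by (simp_all add: \<mu>)
    have zero: "(1 - \<mu>) * S - 2 * lam * \<mu> = 0"
      using 2 lam by (simp add: \<mu> divide_simps)
    \<comment> \<open>At the cap the decreasing function has the value w. The bound is thus a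
      mixture of w and of the value of \<open>env\<close>, which is smaller than w and has the
      positive weight 1 - \<mu>.\<close>
    have "\<theta> = (L + ?V + lam - w) / (2 * lam)"
      using \<theta>0(2) 2 \<theta> by (simp add: min_def split: if_splits)
    then have A: "L + ?V + lam = w + 2 * lam * \<theta>"
      using lam by (simp add: field_simps)
    have "\<mu> * (L + ?V + lam) + (1 - \<mu>) * ?R = \<mu> * w + (1 - \<mu>) * (?R + \<theta> * S) - \<theta> * ((1 - \<mu>) * S - 2 * lam * \<mu>)"
      unfolding A by (simp add: algebra_simps)
    also have "\<dots> = \<mu> * w + (1 - \<mu>) * (?R + \<theta> * S)"
      unfolding zero by simp
    also have "\<dots> < \<mu> * w + (1 - \<mu>) * w"
      using R \<mu>1 by simp
    also have "\<dots> = w"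
      by (simp add: algebra_simps)
    finally show ?thesis
      using \<mu>1 zero ex by simp
  next
    case 3
    then have "\<theta> = 1"
      using S_cases hi \<theta>0(2) by (auto simp: h_def min_def split: if_splits)
    then show ?thesis
      using 3 R by (auto simp: \<mu>_def ex_def mix_weight_def excess_def)
  qed
  then show "0 \<le> \<mu>" "\<mu> \<le> 1" "0 \<le> ex"
    "(1 - \<mu>) * (L - lam + (\<Sum>i<n. (1 - split_weight X \<theta> \<rho> i) * C i)) - 2 * lam * \<mu> \<le> ex"
    "\<mu> * (L + ?V + lam) + (1 - \<mu>) * ?R + ex < w"
    unfolding S by blast+
qed

lemma tail_gt_le_sum: "(\<And>i. i < n \<Longrightarrow> 0 \<le> C i) \<Longrightarrow> tail_gt n X C \<tau> \<le> (\<Sum>i<n. C i)"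
  unfolding tail_gt_def by (rule sum_mono) auto

lemma tail_ge_nonneg: "(\<And>i. i < n \<Longrightarrow> 0 \<le> C i) \<Longrightarrow> 0 \<le> tail_ge n X C \<tau>"
  unfolding tail_ge_def by (rule sum_nonneg) auto

lemma tail_ge_antimono: "(\<And>i. i < n \<Longrightarrow> 0 \<le> C i) \<Longrightarrow> \<sigma> \<le> \<tau> \<Longrightarrow> tail_ge n X C \<tau> \<le> tail_ge n X C \<sigma>"
  unfolding tail_ge_def by (rule sum_mono) auto

text \<open>A concave function ascends up to its maximiser \<tau>, so cutting \<tau> off at
  \<theta>0 yields a maximiser on [0, \<theta>0]. The first two disjuncts are the monotone cases,
  where an end of [0, 1] is taken without searching.\<close>

lemma clamped_quantile:
  assumes C: "\<And>i. i < n \<Longrightarrow> 0 \<le> C i" and X: "\<And>i. i < n \<Longrightarrow> 0 \<le> X i" and \<theta>0: "0 \<le> \<theta>0" "\<theta>0 \<le> 1"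
    and \<tau>: "(D \<le> 0 \<and> \<tau> = 1) \<or> ((\<Sum>i<n. C i) \<le> D \<and> \<tau> = 0) \<or>
      (D < (\<Sum>i<n. C i) \<and> tail_gt n X C \<tau> \<le> D \<and> D \<le> tail_ge n X C \<tau>)"
  defines "\<theta> \<equiv> if \<theta>0 < \<tau> then \<theta>0 else \<tau>"
  shows "0 \<le> \<theta>" "\<theta> \<le> \<theta>0" "tail_gt n X C \<theta> \<le> D \<or> \<theta> = \<theta>0" "D \<le> tail_ge n X C \<theta> \<or> \<theta> = 0"
proof -
  have "0 \<le> \<tau>"
    using \<tau>
  proof (elim disjE)
    assume *: "D < (\<Sum>i<n. C i) \<and> tail_gt n X C \<tau> \<le> D \<and> D \<le> tail_ge n X C \<tau>"
    show ?thesis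
    proof (rule ccontr)
      assume "\<not> 0 \<le> \<tau>"
      then have "tail_gt n X C \<tau> = (\<Sum>i<n. C i)"
        unfolding tail_gt_def using X by (intro sum.cong) force+
      then show False
        using * by simp
    qed
  qed auto
  then show "0 \<le> \<theta>" "\<theta> \<le> \<theta>0"
    using \<theta>0 by (auto simp: \<theta>_def)
  show "tail_gt n X C \<theta> \<le> D \<or> \<theta> = \<theta>0"
    using \<tau> \<theta>0 tail_gt_le_sum[of n C X \<theta>, OF C] by (auto simp: \<theta>_def)
  show "D \<le> tail_ge n X C \<theta> \<or> \<theta> = 0"
    using \<tau> \<theta>0 tail_ge_nonneg[of n C X \<theta>, OF C] tail_ge_antimono[of n C \<theta>0 \<tau> X, OF C] by (auto simp: \<theta>_def)
qed

section \<open>Hulls of finitely supported vectors, and the way back to the box\<close>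

lemma lookup_scaleR: "Poly_Mapping.lookup (r *\<^sub>R (x :: rvec)) i = r * Poly_Mapping.lookup x i"
proof -
  have "finite {i. r * Poly_Mapping.lookup x i \<noteq> 0}"
    by (rule finite_subset[of _ "{i. Poly_Mapping.lookup x i \<noteq> 0}"]) auto
  then show ?thesis
    by (simp add: scaleR_poly_mapping_def)
qed

lemma dot_combination: "dot n \<alpha> (u *\<^sub>R x + v *\<^sub>R y) = u * dot n \<alpha> x + v * dot n \<alpha> y"
  by (simp add: dot_def lookup_add lookup_scaleR sum.distrib sum_distrib_left algebra_simps)

lemma halfspace_hull:
  assumes "\<And>y w. (y, w) \<in> S \<Longrightarrow> dot n \<alpha> y + \<beta> * w \<le> \<gamma>" and "(y, w) \<in> convex hull S"
  shows "dot n \<alpha> y + \<beta> * w \<le> \<gamma>"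
proof -
  let ?H = "{(y, w). dot n \<alpha> y + \<beta> * w \<le> \<gamma>}"
  have "convex ?H"
  proof (rule convexI)
    fix p q :: "rvec \<times> real" and u v :: real
    assume *: "p \<in> ?H" "q \<in> ?H" "0 \<le> u" "0 \<le> v" "u + v = 1"
    have "u * (dot n \<alpha> (fst p) + \<beta> * snd p) + v * (dot n \<alpha> (fst q) + \<beta> * snd q) \<le> u * \<gamma> + v * \<gamma>"
      using * by (intro add_mono mult_left_mono) auto
    also have "\<dots> = \<gamma>"
      using *(5) by (simp add: distrib_right[symmetric])
    finally show "u *\<^sub>R p + v *\<^sub>R q \<in> ?H"
      by (simp add: case_prod_beta dot_combination algebra_simps)
  qed
  moreover have "S \<subseteq> ?H"
    using assms(1) by auto
  ultimately show ?thesis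
    using assms(2) hull_minimal[of S ?H convex] by auto
qed

definition vec :: "nat \<Rightarrow> (nat \<Rightarrow> real) \<Rightarrow> rvec" where
  "vec n g = Abs_poly_mapping (\<lambda>i. if i < n then g i else 0)"

lemma lookup_vec: "Poly_Mapping.lookup (vec n g) i = (if i < n then g i else 0)"
proof -
  have "finite {i. (if i < n then g i else 0) \<noteq> 0}"
    by (rule finite_subset[of _ "{..<n}"]) auto
  then show ?thesis
    by (simp add: vec_def)
qed

lemma Rn_lookup: "y \<in> Rn n \<Longrightarrow> \<not> i < n \<Longrightarrow> Poly_Mapping.lookup y i = 0"
  by (auto simp: Rn_def in_keys_iff)

text \<open>\<open>e\<close> collects the ends of the box at which \<open>\<Sum>i. a i * y i\<close> is smallest, \<open>f\<close> the opposite ends.\<close>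

definition oriented :: "nat \<Rightarrow> (nat \<Rightarrow> real) \<Rightarrow> (nat \<Rightarrow> real) \<Rightarrow> (nat \<Rightarrow> real) \<Rightarrow> (nat \<Rightarrow> real) \<Rightarrow> (nat \<Rightarrow> real) \<Rightarrow> bool" where
  "oriented n a l u e f \<longleftrightarrow>
     (\<forall>i<n. ((e i = l i \<and> f i = u i) \<or> (e i = u i \<and> f i = l i)) \<and> 0 \<le> a i * (f i - e i))"

lemma oriented_coordinates:
  assumes "oriented n a (Poly_Mapping.lookup yl) (Poly_Mapping.lookup yu) e f" "y \<in> vec_box n yl yu" "i < n"
  defines "x \<equiv> (Poly_Mapping.lookup y i - e i) / (f i - e i)"
  shows "0 \<le> x" "x \<le> 1" "Poly_Mapping.lookup y i = e i + x * (f i - e i)"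
proof -
  have "(e i = Poly_Mapping.lookup yl i \<and> f i = Poly_Mapping.lookup yu i) \<or>
      (e i = Poly_Mapping.lookup yu i \<and> f i = Poly_Mapping.lookup yl i)"
    and "Poly_Mapping.lookup yl i \<le> Poly_Mapping.lookup y i" "Poly_Mapping.lookup y i \<le> Poly_Mapping.lookup yu i"
    using assms(1-3) by (simp_all add: oriented_def vec_box_def vec_le_def)
  \<comment> \<open>If e i = f i, division by zero makes the coordinate 0, and y i = e i is still
    recovered.\<close>
  then have "0 \<le> x \<and> x \<le> 1 \<and> Poly_Mapping.lookup y i = e i + x * (f i - e i)"
    unfolding x_def by (elim disjE) (auto simp: divide_simps)
  then show "0 \<le> x" "x \<le> 1" "Poly_Mapping.lookup y i = e i + x * (f i - e i)"
    by blast+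
qed

lemma oriented_dot:
  fixes y :: rvec
  assumes "\<And>i. i < n \<Longrightarrow> Poly_Mapping.lookup y i = e i + x i * (f i - e i)"
  shows "(\<Sum>i<n. a i * Poly_Mapping.lookup y i) = (\<Sum>i<n. a i * e i) + (\<Sum>i<n. a i * (f i - e i) * x i)"
  unfolding sum.distrib[symmetric] by (rule sum.cong) (simp_all add: assms distrib_left mult_ac)

lemma oriented_vec_box:
  assumes "oriented n a (Poly_Mapping.lookup yl) (Poly_Mapping.lookup yu) e f" "vec_le n yl yu"
    and "\<And>i. i < n \<Longrightarrow> 0 \<le> x i \<and> x i \<le> 1"
  shows "vec n (\<lambda>i. e i + x i * (f i - e i)) \<in> vec_box n yl yu"
proof -
  have "Poly_Mapping.lookup yl i \<le> e i + x i * (f i - e i) \<and> e i + x i * (f i - e i) \<le> Poly_Mapping.lookup yu i" if "i < n" for i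
  proof -
    let ?l = "Poly_Mapping.lookup yl i" and ?u = "Poly_Mapping.lookup yu i"
    have x: "0 \<le> x i" "x i \<le> 1" and lu: "?l \<le> ?u"
      using assms that by (auto simp: vec_le_def)
    have "0 \<le> x i * (?u - ?l)" "x i * (?u - ?l) \<le> 1 * (?u - ?l)"
      by (rule mult_nonneg_nonneg mult_right_mono; use x lu in simp)+
    moreover have "x i * (?l - ?u) = - (x i * (?u - ?l))"
      by (simp add: algebra_simps)
    moreover have "(e i = ?l \<and> f i = ?u) \<or> (e i = ?u \<and> f i = ?l)"
      using assms(1) that by (simp add: oriented_def)
    ultimately show ?thesis
      by (elim disjE conjE) simp_all
  qed
  then show ?thesis
    by (auto simp: vec_box_def vec_le_def lookup_vec Rn_def in_keys_iff split: if_splits)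
qed

text \<open>The point above \<open>y\<close> is the convex combination with weights \<open>\<theta>\<close> and \<open>1 - \<theta>\<close> of the points with
  coordinates \<open>min (x i) \<theta> / \<theta>\<close> and \<open>(x i - min (x i) \<theta>) / (1 - \<theta>)\<close>. For \<open>\<theta> = 0\<close> and \<open>\<theta> = 1\<close> division by
  zero turns the one of weight zero into the vertex \<open>e\<close>.\<close>

lemma hull_point_above:
  fixes sg :: real
  assumes sg: "sg = 1 \<or> sg = -1" and lam: "0 < lam"
    and ori: "oriented n a' (Poly_Mapping.lookup yl) (Poly_Mapping.lookup yu) e f" and box: "vec_le n yl yu"
    and a': "a' = (\<lambda>i. sg * Poly_Mapping.lookup a i)"
    and y: "y \<in> vec_box n yl yu" and \<theta>: "0 \<le> \<theta>" "\<theta> \<le> 1"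
  defines "x \<equiv> (\<lambda>i. (Poly_Mapping.lookup y i - e i) / (f i - e i))"
  defines "C \<equiv> (\<lambda>i. a' i * (f i - e i))" and "L \<equiv> (\<Sum>i<n. a' i * e i)"
  assumes w: "w \<le> env n lam L C x \<theta>" "w \<le> L + (\<Sum>i<n. C i * x i) + lam - 2 * lam * \<theta>"
  shows "\<exists>v. (y, v) \<in> convex hull (Phi n a yl yu lam) \<and> w \<le> sg * v"
proof -
  have x: "0 \<le> x i" "x i \<le> 1" "Poly_Mapping.lookup y i = e i + x i * (f i - e i)" if "i < n" for i
    using oriented_coordinates[OF ori y that] by (simp_all add: x_def)
  define x1 where "x1 i = min (x i) \<theta> / \<theta>" for i
  define x2 where "x2 i = (x i - min (x i) \<theta>) / (1 - \<theta>)" for i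
  have x1: "0 \<le> x1 i \<and> x1 i \<le> 1" if "i < n" for i
    using x[OF that] \<theta> by (auto simp: x1_def divide_simps)
  have x2: "0 \<le> x2 i \<and> x2 i \<le> 1" if "i < n" for i
    using x[OF that] \<theta> by (auto simp: x2_def divide_simps)
  have \<theta>x1: "\<theta> * x1 i = min (x i) \<theta>" and \<theta>x2: "(1 - \<theta>) * x2 i = x i - min (x i) \<theta>" if "i < n" for i
    using x[OF that] \<theta> by (auto simp: x1_def x2_def)
  define y1 where "y1 = vec n (\<lambda>i. e i + x1 i * (f i - e i))"
  define y2 where "y2 = vec n (\<lambda>i. e i + x2 i * (f i - e i))"
  define T1 where "T1 = L + (\<Sum>i<n. C i * x1 i)"
  define T2 where "T2 = L + (\<Sum>i<n. C i * x2 i)"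
  define Tf where "Tf z = soft_threshold lam (dot n (Poly_Mapping.lookup a) z)" for z
  have "(y1, Tf y1) \<in> Phi n a yl yu lam" "(y2, Tf y2) \<in> Phi n a yl yu lam"
    unfolding Phi_def y1_def y2_def Tf_def using oriented_vec_box[OF ori box] x1 x2 by auto
  then have "\<theta> *\<^sub>R (y1, Tf y1) + (1 - \<theta>) *\<^sub>R (y2, Tf y2) \<in> convex hull (Phi n a yl yu lam)"
    using \<theta> by (intro convexD[OF convex_convex_hull] hull_inc) auto
  moreover have "\<theta> *\<^sub>R y1 + (1 - \<theta>) *\<^sub>R y2 = y"
  proof (rule poly_mapping_eqI)
    fix i
    show "Poly_Mapping.lookup (\<theta> *\<^sub>R y1 + (1 - \<theta>) *\<^sub>R y2) i = Poly_Mapping.lookup y i"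
    proof (cases "i < n")
      case True
      have "\<theta> * (e i + x1 i * (f i - e i)) + (1 - \<theta>) * (e i + x2 i * (f i - e i)) =
        e i + (\<theta> * x1 i + (1 - \<theta>) * x2 i) * (f i - e i)"
        by (simp add: algebra_simps)
      also have "\<theta> * x1 i + (1 - \<theta>) * x2 i = x i"
        by (simp add: \<theta>x1[OF True] \<theta>x2[OF True])
      finally show ?thesis
        using True x(3) by (simp add: y1_def y2_def lookup_add lookup_scaleR lookup_vec)
    next
      case False
      moreover have "y \<in> Rn n"
        using y by (simp add: vec_box_def)
      ultimately show ?thesis
        by (simp add: y1_def y2_def lookup_add lookup_scaleR lookup_vec Rn_lookup)
    qed
  qed
  ultimately have hull: "(y, \<theta> * Tf y1 + (1 - \<theta>) * Tf y2) \<in> convex hull (Phi n a yl yu lam)"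
    by simp
  have dot: "sg * dot n (Poly_Mapping.lookup a) z = (\<Sum>i<n. a' i * Poly_Mapping.lookup z i)" for z
    by (simp add: dot_def a' sum_distrib_left mult.assoc)
  \<comment> \<open>The maximum is estimated from below by one piece at each point: t - \<lambda> at
    the first and min (t + \<lambda>) 0 at the second.\<close>
  have "sg * Tf y1 = soft_threshold lam T1"
    unfolding Tf_def soft_threshold_sign[OF lam sg, symmetric] dot T1_def L_def C_def
    by (subst oriented_dot[where e = e and f = f and x = x1]) (simp_all add: y1_def lookup_vec)
  then have s1: "T1 - lam \<le> sg * Tf y1"
    by (simp add: soft_threshold_eq[OF lam])
  have "sg * Tf y2 = soft_threshold lam T2"
    unfolding Tf_def soft_threshold_sign[OF lam sg, symmetric] dot T2_def L_def C_def
    by (subst oriented_dot[where e = e and f = f and x = x2]) (simp_all add: y2_def lookup_vec)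
  then have s2: "min (T2 + lam) 0 \<le> sg * Tf y2"
    by (simp add: soft_threshold_eq[OF lam])
  have "\<theta> * T1 = \<theta> * L + (\<Sum>i<n. C i * (\<theta> * x1 i))"
    by (simp add: T1_def distrib_left sum_distrib_left mult.left_commute)
  also have "(\<Sum>i<n. C i * (\<theta> * x1 i)) = (\<Sum>i<n. C i * min (x i) \<theta>)"
    by (rule sum.cong) (simp_all add: \<theta>x1)
  finally have T1: "\<theta> * (T1 - lam) = env n lam L C x \<theta>"
    by (simp add: env_def algebra_simps)
  have "(1 - \<theta>) * T2 = (1 - \<theta>) * L + (\<Sum>i<n. C i * ((1 - \<theta>) * x2 i))"
    by (simp add: T2_def distrib_left sum_distrib_left mult.left_commute)
  also have "(\<Sum>i<n. C i * ((1 - \<theta>) * x2 i)) = (\<Sum>i<n. C i * x i - C i * min (x i) \<theta>)"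
    by (rule sum.cong) (simp_all add: \<theta>x2 right_diff_distrib)
  finally have T2: "(1 - \<theta>) * (T2 + lam) = L + (\<Sum>i<n. C i * x i) + lam - 2 * lam * \<theta> - env n lam L C x \<theta>"
    by (simp add: env_def sum_subtractf algebra_simps)
  \<comment> \<open>The two assumed bounds on w correspond to the two arguments of this
    minimum.\<close>
  have "w \<le> env n lam L C x \<theta> + min ((1 - \<theta>) * (T2 + lam)) 0"
    using w unfolding T2 by simp
  also have "min ((1 - \<theta>) * (T2 + lam)) 0 = (1 - \<theta>) * min (T2 + lam) 0"
    using \<theta> by (simp add: min_mult_distrib_left)
  also have "env n lam L C x \<theta> + \<dots> \<le> \<theta> * (sg * Tf y1) + (1 - \<theta>) * (sg * Tf y2)"
    unfolding T1[symmetric] using s1 s2 \<theta> by (intro add_mono mult_left_mono) auto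
  also have "\<dots> = sg * (\<theta> * Tf y1 + (1 - \<theta>) * Tf y2)"
    by (simp add: algebra_simps)
  finally show ?thesis
    using hull by blast
qed

text \<open>Joins the results for the two signs: a hull point above and one below on the same
  vertical line.\<close>

lemma hull_between:
  assumes "(y, v1) \<in> convex hull S" "(y, v2) \<in> convex hull S" "v1 \<le> w" "w \<le> v2"
  shows "(y :: rvec, w :: real) \<in> convex hull S"
proof (cases "v1 = v2")
  case False
  define t where "t = (w - v1) / (v2 - v1)"
  have t: "0 \<le> t" "t \<le> 1" "w = (1 - t) * v1 + t * v2"
  proof -
    have "t * (v2 - v1) = w - v1"
      using False by (simp add: t_def)
    then show "w = (1 - t) * v1 + t * v2"
      by (simp add: algebra_simps)
  qed (use assms(3,4) False in \<open>auto simp: t_def divide_simps\<close>)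
  have "(1 - t) *\<^sub>R (y, v1) + t *\<^sub>R (y, v2) \<in> convex hull S"
    using t assms(1,2) by (intro convexD[OF convex_convex_hull]) auto
  also have "(1 - t) *\<^sub>R (y, v1) + t *\<^sub>R (y, v2) = (y, w)"
    using t(3) by (simp add: scaleR_left_distrib[symmetric])
  finally show ?thesis .
qed (use assms in auto)

lemma oriented_cut_separates:
  fixes sg :: real
  assumes sg: "sg = 1 \<or> sg = -1" and lam: "0 < lam"
    and ori: "oriented n a' (Poly_Mapping.lookup yl) (Poly_Mapping.lookup yu) e f"
    and a': "a' = (\<lambda>i. sg * Poly_Mapping.lookup a i)"
    and y: "y \<in> vec_box n yl yu"
    and \<mu>: "0 \<le> \<mu>" "\<mu> \<le> 1" and r: "\<And>i. i < n \<Longrightarrow> 0 \<le> r i \<and> r i \<le> 1"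
  defines "x \<equiv> (\<lambda>i. (Poly_Mapping.lookup y i - e i) / (f i - e i))"
  defines "C \<equiv> (\<lambda>i. a' i * (f i - e i))" and "L \<equiv> (\<Sum>i<n. a' i * e i)"
  assumes ex: "0 \<le> ex" "(1 - \<mu>) * (L - lam + (\<Sum>i<n. (1 - r i) * C i)) - 2 * lam * \<mu> \<le> ex"
    and viol: "\<mu> * (L + (\<Sum>i<n. C i * x i) + lam) + (1 - \<mu>) * (\<Sum>i<n. r i * (C i * x i)) + ex < sg * w"
    and \<alpha>: "\<And>i. i < n \<Longrightarrow> \<alpha> i = - ((\<mu> + (1 - \<mu>) * r i) * a' i)"
    and \<gamma>: "\<gamma> = \<mu> * lam + ex - (1 - \<mu>) * (\<Sum>i<n. r i * (a' i * e i))"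
  shows "separates n (convex hull (Phi n a yl yu lam)) y w (Cut \<alpha> sg \<gamma>)"
proof -
  have dot: "sg * dot n (Poly_Mapping.lookup a) z = (\<Sum>i<n. a' i * Poly_Mapping.lookup z i)" for z
    by (simp add: dot_def a' sum_distrib_left mult.assoc)
  \<comment> \<open>The cut is \<open>cut_valid\<close> in the original coordinates: \<gamma> minus
    the linear part in z is the bound given there, so the inequality says that sg * v does not
    exceed it.\<close>
  have cut: "dot n \<alpha> z = \<gamma> - (\<mu> * (L + (\<Sum>i<n. C i * xz i) + lam) + (1 - \<mu>) * (\<Sum>i<n. r i * (C i * xz i)) + ex)"
    if "\<And>i. i < n \<Longrightarrow> Poly_Mapping.lookup z i = e i + xz i * (f i - e i)" for z xz
  proof -
    have "dot n \<alpha> z = (\<Sum>i<n. - (\<mu> * (a' i * e i)) - \<mu> * (C i * xz i) - (1 - \<mu>) * (r i * (a' i * e i)) - (1 - \<mu>) * (r i * (C i * xz i)))"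
      unfolding dot_def by (rule sum.cong) (simp_all add: that \<alpha> C_def algebra_simps)
    also have "\<dots> = - (\<mu> * (\<Sum>i<n. a' i * e i)) - \<mu> * (\<Sum>i<n. C i * xz i)
      - (1 - \<mu>) * (\<Sum>i<n. r i * (a' i * e i)) - (1 - \<mu>) * (\<Sum>i<n. r i * (C i * xz i))"
      by (simp only: sum_subtractf sum_negf sum_distrib_left)
    finally show ?thesis
      unfolding \<gamma> L_def by (simp only: algebra_simps)
  qed
  have "dot n \<alpha> z + sg * v \<le> \<gamma>" if "(z, v) \<in> Phi n a yl yu lam" for z v
  proof -
    have z: "z \<in> vec_box n yl yu" and v: "v = soft_threshold lam (dot n (Poly_Mapping.lookup a) z)"
      using that by (simp_all add: Phi_def)
    define xz where "xz i = (Poly_Mapping.lookup z i - e i) / (f i - e i)" for i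
    have xz: "0 \<le> xz i" "xz i \<le> 1" "Poly_Mapping.lookup z i = e i + xz i * (f i - e i)" if "i < n" for i
      using oriented_coordinates[OF ori z that] by (simp_all add: xz_def)
    have "sg * v = soft_threshold lam (L + (\<Sum>i<n. C i * xz i))"
      unfolding v soft_threshold_sign[OF lam sg, symmetric] dot L_def C_def
      by (subst oriented_dot[where e = e and f = f and x = xz]) (use xz(3) in simp_all)
    also have "\<dots> \<le> \<mu> * (L + (\<Sum>i<n. C i * xz i) + lam) + (1 - \<mu>) * (\<Sum>i<n. r i * (C i * xz i)) + ex"
      by (rule cut_valid) (use lam \<mu> r xz ex ori in \<open>auto simp: C_def oriented_def\<close>)
    finally show ?thesis
      using cut[of z xz] xz(3) by simp
  qed
  then have "\<forall>(z, v)\<in>convex hull (Phi n a yl yu lam). dot n \<alpha> z + sg * v \<le> \<gamma>"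
    using halfspace_hull by blast
  moreover have "\<gamma> < dot n \<alpha> y + sg * w"
    using cut[of y x] oriented_coordinates(3)[OF ori y] viol by (simp add: x_def)
  ultimately show ?thesis
    by simp
qed

section \<open>The separation program\<close>

abbreviation (input) "vN \<equiv> 0 :: nat"
abbreviation (input) "vVerdict \<equiv> 1 :: nat"
abbreviation (input) "rIn \<equiv> 4 :: nat"
abbreviation (input) "rE \<equiv> 10 :: nat"
abbreviation (input) "rF \<equiv> 11 :: nat"
abbreviation (input) "rX0 \<equiv> 12 :: nat"
abbreviation (input) "rC0 \<equiv> 13 :: nat"
abbreviation (input) "rL \<equiv> 15 :: nat"
abbreviation (input) "rV \<equiv> 16 :: nat"
abbreviation (input) "rCsum \<equiv> 19 :: nat"
abbreviation (input) "rBound \<equiv> 23 :: nat"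
abbreviation (input) "rSum \<equiv> 24 :: nat"
abbreviation (input) "rRho \<equiv> 25 :: nat"
abbreviation (input) "rMu \<equiv> 26 :: nat"
abbreviation (input) "rEx \<equiv> 27 :: nat"
abbreviation (input) "rSlope \<equiv> 28 :: nat"

abbreviation (input) "lam_exp \<equiv> RRead rIn (IConst 0)"
abbreviation (input) "w_exp sg \<equiv> RMul (RConst sg) (RRead rIn (IConst 1))"
abbreviation (input) "a_exp sg \<equiv> RMul (RConst sg) (RRead 0 (IVar vI))"

definition ends_com :: "int \<Rightarrow> com" where
  "ends_com sg = For vI vN
     (Cond (RLess (a_exp sg) (RConst 0))
       (RWrite rE (IVar vI) (RRead 2 (IVar vI)) ;; RWrite rF (IVar vI) (RRead 1 (IVar vI)))
       (RWrite rE (IVar vI) (RRead 1 (IVar vI)) ;; RWrite rF (IVar vI) (RRead 2 (IVar vI))))"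

definition coords_com :: "int \<Rightarrow> com" where
  "coords_com sg =
     (RSet rL (RConst 0) ;; RSet rV (RConst 0) ;; RSet rCsum (RConst 0) ;; ISet vA (IVar vN)) ;;
     For vI vN
       (RWrite rC0 (IVar vI) (RMul (a_exp sg) (RSub (RRead rF (IVar vI)) (RRead rE (IVar vI)))) ;;
        RWrite rX0 (IVar vI) (RDiv (RSub (RRead 3 (IVar vI)) (RRead rE (IVar vI)))
                                   (RSub (RRead rF (IVar vI)) (RRead rE (IVar vI)))) ;;
        RWrite rC (IVar vI) (RRead rC0 (IVar vI)) ;;
        RWrite rX (IVar vI) (RRead rX0 (IVar vI)) ;;
        RSet rL (RAdd (RVar rL) (RMul (a_exp sg) (RRead rE (IVar vI)))) ;;
        RSet rV (RAdd (RVar rV) (RMul (RRead rC0 (IVar vI)) (RRead rX0 (IVar vI)))) ;;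
        RSet rCsum (RAdd (RVar rCsum) (RRead rC0 (IVar vI))))"

definition quantile_com :: com where
  "quantile_com =
     RSet rD (RSub lam_exp (RVar rL)) ;;
     Cond (RLess (RConst 0) (RVar rD))
       (Cond (RLess (RVar rD) (RVar rCsum)) select_com (RSet rTau (RConst 0)))
       (RSet rTau (RConst 1))"

text \<open>The search may have overwritten its working copies. They are restored, and
  \<open>rP\<close> is set to the clamped \<theta>, so that \<open>tails_com\<close> can serve again
  to compute both derivatives there.\<close>

definition evaluate_com :: com where
  "evaluate_com =
     (Cond (RLess (RVar rBound) (RVar rTau)) (RSet rTau (RVar rBound)) Skip ;;
      RSet rSum (RConst 0) ;; RSet rP (RVar rTau) ;; ISet vA (IVar vN)) ;;
     For vI vN
       (RWrite rC (IVar vI) (RRead rC0 (IVar vI)) ;;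
        RWrite rX (IVar vI) (RRead rX0 (IVar vI)) ;;
        Cond (RLess (RRead rX0 (IVar vI)) (RVar rTau))
          (RSet rSum (RAdd (RVar rSum) (RMul (RRead rC0 (IVar vI)) (RRead rX0 (IVar vI)))))
          (RSet rSum (RAdd (RVar rSum) (RMul (RRead rC0 (IVar vI)) (RVar rTau))))) ;;
     tails_com"

definition multipliers_com :: com where
  "multipliers_com =
     RSet rHi (RAdd (RSub (RVar rL) lam_exp) (RVar rHi)) ;;
     RSet rLo (RAdd (RSub (RVar rL) lam_exp) (RVar rLo)) ;;
     Cond (RLess (RVar rHi) (RConst 0))
       (Cond (RLess (RConst 0) (RVar rLo))
         (RSet rRho (RDiv (RSub (RConst 0) (RVar rHi)) (RSub (RVar rLo) (RVar rHi))))
         (RSet rRho (RConst 1)))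
       (RSet rRho (RConst 0)) ;;
     RSet rSlope (RAdd (RVar rHi) (RMul (RVar rRho) (RSub (RVar rLo) (RVar rHi)))) ;;
     Cond (RLess (RConst 0) (RVar rSlope))
       (Cond (RLess (RVar rBound) (RConst 1))
         (RSet rMu (RDiv (RVar rSlope) (RAdd (RVar rSlope) (RMul (RConst 2) lam_exp))) ;; RSet rEx (RConst 0))
         (RSet rMu (RConst 0) ;; RSet rEx (RVar rSlope)))
       (RSet rMu (RConst 0) ;; RSet rEx (RConst 0)) ;;
     ISet vVerdict (IConst 1)"

definition emit_com :: "int \<Rightarrow> com" where
  "emit_com sg =
     RSet rSum (RConst 0) ;;
     For vI vN
       (Cond (RLess (RRead rX0 (IVar vI)) (RVar rTau)) (RSet rTmp (RConst 1))
         (Cond (RLess (RVar rTau) (RRead rX0 (IVar vI))) (RSet rTmp (RConst 0))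
           (RSet rTmp (RSub (RConst 1) (RVar rRho)))) ;;
        RWrite 5 (IVar vI) (RSub (RConst 0)
          (RMul (RAdd (RVar rMu) (RMul (RSub (RConst 1) (RVar rMu)) (RVar rTmp))) (a_exp sg))) ;;
        RSet rSum (RAdd (RVar rSum) (RMul (RVar rTmp) (RMul (a_exp sg) (RRead rE (IVar vI)))))) ;;
     (RSet 6 (RConst sg) ;;
      RWrite 6 (IConst 1) (RSub (RAdd (RMul (RVar rMu) lam_exp) (RVar rEx))
        (RMul (RSub (RConst 1) (RVar rMu)) (RVar rSum))))"

text \<open>\<open>rBound\<close> first holds L + V + \<lambda> - sg * w. If this is negative, even
  \<theta> = 0 is excluded, and the inequality sg * w \<le> t + \<lambda> separates, which is the
  general cut with \<mu> = 1. Otherwise \<open>rBound\<close> is scaled and clipped to become the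
  cap \<theta>0.\<close>

definition side_com :: "int \<Rightarrow> com" where
  "side_com sg =
     ends_com sg ;;
     coords_com sg ;;
     RSet rBound (RSub (RAdd (RAdd (RVar rL) (RVar rV)) lam_exp) (w_exp sg)) ;;
     Cond (RLess (RVar rBound) (RConst 0))
       (RSet rMu (RConst 1) ;; RSet rEx (RConst 0) ;; RSet rRho (RConst 0) ;; ISet vVerdict (IConst 1))
       (RSet rBound (RDiv (RVar rBound) (RMul (RConst 2) lam_exp)) ;;
        Cond (RLess (RConst 1) (RVar rBound)) (RSet rBound (RConst 1)) Skip ;;
        quantile_com ;;
        evaluate_com ;;
        Cond (RLess (RAdd (RMul (RSub (RVar rL) lam_exp) (RVar rTau)) (RVar rSum)) (w_exp sg))
          multipliers_com Skip) ;;
     Cond (ILess (IConst 0) (IVar vVerdict)) (emit_com sg) Skip"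

lemma writes_ends [simp]: "iwrites (ends_com sg) = {vI}" "rwrites (ends_com sg) = {rE, rF}"
  by (auto simp: ends_com_def)

lemma writes_coords [simp]:
  "iwrites (coords_com sg) = {vI, vA}" "rwrites (coords_com sg) = {rL, rV, rCsum, rC0, rX0, rC, rX}"
  by (auto simp: coords_com_def)

lemma writes_quantile [simp]:
  "iwrites quantile_com = {vI, vJ, vB, vK, vT, vM, vG, vH, vA, vF}"
  "rwrites quantile_com = {rS, rTmp, rP, rHi, rLo, rX, rC, rD, rTau}"
  by (auto simp: quantile_com_def)

lemma writes_evaluate [simp]:
  "iwrites evaluate_com = {vI, vA}" "rwrites evaluate_com = {rTau, rSum, rP, rC, rX, rHi, rLo}"
  by (auto simp: evaluate_com_def)

lemma writes_multipliers [simp]: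
  "iwrites multipliers_com = {vVerdict}" "rwrites multipliers_com = {rHi, rLo, rRho, rSlope, rMu, rEx}"
  by (auto simp: multipliers_com_def)

lemma writes_emit [simp]: "iwrites (emit_com sg) = {vI}" "rwrites (emit_com sg) = {rSum, rTmp, 5, 6}"
  by (auto simp: emit_com_def)

section \<open>Correctness for one sign\<close>

lemma tail_cong:
  assumes "\<forall>k<n. C k = C' k \<and> X k = X' k"
  shows "tail_gt n X C \<tau> = tail_gt n X' C' \<tau>" "tail_ge n X C \<tau> = tail_ge n X' C' \<tau>"
  unfolding tail_gt_def tail_ge_def by (rule sum.cong; use assms in simp)+

text \<open>\<open>sg\<close> is an integer because it also occurs as a literal in the program. For
  -1 the upper boundary belonging to -a is the lower one belonging to a, turned upside down.\<close>

locale box_side =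
  fixes n :: nat and a yl yu y :: rvec and lam w :: real and sg :: int
  assumes sg: "sg = 1 \<or> sg = -1" and lam: "0 < lam" and box: "vec_le n yl yu" and y: "y \<in> vec_box n yl yu"
begin

definition a' :: "nat \<Rightarrow> real" where "a' i = of_int sg * Poly_Mapping.lookup a i"
definition e :: "nat \<Rightarrow> real" where "e i = (if a' i < 0 then Poly_Mapping.lookup yu i else Poly_Mapping.lookup yl i)"
definition f :: "nat \<Rightarrow> real" where "f i = (if a' i < 0 then Poly_Mapping.lookup yl i else Poly_Mapping.lookup yu i)"
definition C :: "nat \<Rightarrow> real" where "C i = a' i * (f i - e i)"
definition x :: "nat \<Rightarrow> real" where "x i = (Poly_Mapping.lookup y i - e i) / (f i - e i)"
definition L :: real where "L = (\<Sum>i<n. a' i * e i)"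
definition V :: real where "V = (\<Sum>i<n. C i * x i)"

lemma oriented: "oriented n a' (Poly_Mapping.lookup yl) (Poly_Mapping.lookup yu) e f"
  using box by (auto simp: oriented_def vec_le_def e_def f_def mult_nonneg_nonneg mult_nonpos_nonpos)

lemma C_nonneg: "i < n \<Longrightarrow> 0 \<le> C i"
  using oriented by (simp add: oriented_def C_def)

lemma x_bounds: "i < n \<Longrightarrow> 0 \<le> x i" "i < n \<Longrightarrow> x i \<le> 1"
  using oriented_coordinates[OF oriented y] by (simp_all add: x_def)

definition input :: "ram_state \<Rightarrow> bool" where
  "input s \<longleftrightarrow> imem s vN 0 = n \<and> rmem s 0 = Poly_Mapping.lookup a \<and> rmem s 1 = Poly_Mapping.lookup yl \<and>
     rmem s 2 = Poly_Mapping.lookup yu \<and> rmem s 3 = Poly_Mapping.lookup y \<and> rmem s rIn 0 = lam \<and> rmem s rIn 1 = w"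

lemma input_unchanged:
  "input s \<Longrightarrow> unchanged c s s' \<Longrightarrow> vN \<notin> iwrites c \<Longrightarrow> rwrites c \<inter> {0, 1, 2, 3, rIn} = {} \<Longrightarrow> input s'"
  unfolding input_def unchanged_def by auto

definition prepared :: "ram_state \<Rightarrow> bool" where
  "prepared s \<longleftrightarrow> input s \<and> (\<forall>k<n. rmem s rE k = e k \<and> rmem s rC0 k = C k \<and> rmem s rX0 k = x k) \<and>
     rmem s rL 0 = L \<and> rmem s rV 0 = V \<and> rmem s rCsum 0 = (\<Sum>i<n. C i)"

lemma prepared_unchanged:
  assumes "prepared s" "unchanged c s s'" "vN \<notin> iwrites c"
    "rwrites c \<inter> {0, 1, 2, 3, rIn, rE, rC0, rX0, rL, rV, rCsum} = {}"
  shows "prepared s'"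
proof -
  have "input s'"
    using assms by (intro input_unchanged[of s c s']) (auto simp: prepared_def)
  then show ?thesis
    using assms unfolding prepared_def unchanged_def by auto
qed

lemma runs_ends:
  assumes "input s"
  shows "runs (ends_com sg) s (60 * n + 9) (\<lambda>s'. input s' \<and> (\<forall>k<n. rmem s' rE k = e k \<and> rmem s' rF k = f k))"
proof -
  have "runs (ends_com sg) s (60 * n + 9) (\<lambda>s'. \<forall>k<n. rmem s' rE k = e k \<and> rmem s' rF k = f k)"
    unfolding ends_com_def
  proof (rule runs_For[where k = 48 and I = "\<lambda>i s'. \<forall>k<i. rmem s' rE k = e k \<and> rmem s' rF k = f k"], goal_cases)
    case (5 i r)
    have "input r"
      using input_unchanged[OF assms 5(4)] by simp
    with 5 show ?case
      by (intro runs_straight_line) (auto simp: input_def e_def f_def a'_def less_Suc_eq)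
  qed (use assms in \<open>auto simp: input_def\<close>)
  then show ?thesis
    by (rule runs_weaken) (use input_unchanged[OF assms] in auto)
qed

lemma runs_coords:
  assumes s: "input s" and ends: "\<forall>k<n. rmem s rE k = e k \<and> rmem s rF k = f k"
  shows "runs (coords_com sg) s (120 * n + 40) (\<lambda>s'. prepared s' \<and> imem s' vA 0 = n \<and>
    (\<forall>k<n. rmem s' rC k = C k \<and> rmem s' rX k = x k))"
proof -
  let ?J = "\<lambda>i s'. (\<forall>k<i. rmem s' rC0 k = C k \<and> rmem s' rX0 k = x k \<and> rmem s' rC k = C k \<and> rmem s' rX k = x k) \<and>
    rmem s' rL 0 = (\<Sum>k<i. a' k * e k) \<and> rmem s' rV 0 = (\<Sum>k<i. C k * x k) \<and> rmem s' rCsum 0 = (\<Sum>k<i. C k) \<and>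
    imem s' vA 0 = n"
  let ?init = "RSet rL (RConst 0) ;; RSet rV (RConst 0) ;; RSet rCsum (RConst 0) ;; ISet vA (IVar vN)"
  have "runs (coords_com sg) s (120 * n + 40) (?J n)"
    unfolding coords_com_def
  proof (rule runs_Seq_straight[where l = "120 * n + 9"], simp, rule runs_For[where k = 108 and I = ?J], goal_cases)
    case (5 i r)
    have un: "unchanged (coords_com sg) s r"
      using 5(4) by (auto simp: unchanged_def coords_com_def)
    have r: "input r" "rmem r rE = rmem s rE" "rmem r rF = rmem s rF"
      using input_unchanged[OF s un] unchanged_mem[OF un] by simp_all
    have i: "i < n"
      using 5(1) s by (simp add: input_def)
    show ?case
      by (intro runs_straight_line)
        (use 5(2,3) r i ends in \<open>auto simp: input_def C_def x_def a'_def less_Suc_eq\<close>)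
  qed (use s in \<open>auto simp: input_def\<close>)
  then show ?thesis
  proof (rule runs_weaken)
    fix s' :: ram_state
    assume J: "?J n s'" and un: "unchanged (coords_com sg) s s'"
    show "prepared s' \<and> imem s' vA 0 = n \<and> (\<forall>k<n. rmem s' rC k = C k \<and> rmem s' rX k = x k)"
      using J input_unchanged[OF s un] unchanged_rmem[OF un, of rE] ends by (simp add: prepared_def L_def V_def)
  qed simp
qed

lemma runs_quantile:
  assumes s: "prepared s" and copies: "imem s vA 0 = n" "\<forall>k<n. rmem s rC k = C k \<and> rmem s rX k = x k"
  shows "runs quantile_com s (144200 * n + 80) (\<lambda>s'.
    let \<tau> = rmem s' rTau 0; D = lam - L in (D \<le> 0 \<and> \<tau> = 1) \<or> ((\<Sum>i<n. C i) \<le> D \<and> \<tau> = 0) \<or>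
      (D < (\<Sum>i<n. C i) \<and> tail_gt n x C \<tau> \<le> D \<and> D \<le> tail_ge n x C \<tau>))" (is "runs _ _ _ ?Q")
  unfolding quantile_com_def
proof (rule runs_Seq_straight[where l = "144200 * n + 70"], simp, rule runs_Cond)
  let ?s = "effect (RSet rD (RSub lam_exp (RVar rL))) s"
  have D: "rmem ?s rD 0 = lam - L" "rmem ?s rCsum 0 = (\<Sum>i<n. C i)"
    using s by (simp_all add: prepared_def input_def)
  show "runs (Cond (RLess (RVar rD) (RVar rCsum)) select_com (RSet rTau (RConst 0))) ?s (144200 * n + 55) ?Q"
    if "tval ?s (RLess (RConst 0) (RVar rD))"
  proof (rule runs_Cond)
    assume "tval ?s (RLess (RVar rD) (RVar rCsum))"
    then have D2: "0 < lam - L" "lam - L < (\<Sum>i<n. C i)"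
      using that D by simp_all
    have vA: "imem ?s vA 0 = n"
      using copies by simp
    have sums: "(\<Sum>i<n. rmem ?s rC i) = (\<Sum>i<n. C i)" "tail_gt n (rmem ?s rX) (rmem ?s rC) \<tau> = tail_gt n x C \<tau>"
      "tail_ge n (rmem ?s rX) (rmem ?s rC) \<tau> = tail_ge n x C \<tau>" for \<tau>
      using copies(2) by (simp_all add: tail_cong)
    show "runs select_com ?s (144200 * n + 45) ?Q"
      by (rule runs_weaken[OF runs_select[of ?s, unfolded vA D sums, OF D2]]) (use D2 in \<open>simp_all add: Let_def\<close>)
  next
    assume "\<not> tval ?s (RLess (RVar rD) (RVar rCsum))"
    then show "runs (RSet rTau (RConst 0)) ?s (144200 * n + 45) ?Q"
      using D by (intro runs_straight_line) (simp_all add: Let_def)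
  qed simp
  show "runs (RSet rTau (RConst 1)) ?s (144200 * n + 55) ?Q" if "\<not> tval ?s (RLess (RConst 0) (RVar rD))"
    using that D by (intro runs_straight_line) (simp_all add: Let_def)
qed simp_all

lemma runs_evaluate:
  assumes s: "prepared s"
  defines "\<theta> \<equiv> if rmem s rBound 0 < rmem s rTau 0 then rmem s rBound 0 else rmem s rTau 0"
  shows "runs evaluate_com s (150 * n + 100) (\<lambda>s'. rmem s' rTau 0 = \<theta> \<and>
    (L - lam) * \<theta> + rmem s' rSum 0 = env n lam L C x \<theta> \<and>
    rmem s' rHi 0 = tail_gt n x C \<theta> \<and> rmem s' rLo 0 = tail_ge n x C \<theta>)" (is "runs _ _ _ ?Q")
  unfolding evaluate_com_def
proof (rule runs_Seq_straight[where l = "150 * n + 55"], simp, rule runs_Seq[where k = "80 * n + 9" and l = "60 * n + 30"])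
  let ?init = "Cond (RLess (RVar rBound) (RVar rTau)) (RSet rTau (RVar rBound)) Skip ;;
      RSet rSum (RConst 0) ;; RSet rP (RVar rTau) ;; ISet vA (IVar vN)"
  let ?s = "effect ?init s"
  let ?c = "RWrite rC (IVar vI) (RRead rC0 (IVar vI)) ;;
        RWrite rX (IVar vI) (RRead rX0 (IVar vI)) ;;
        Cond (RLess (RRead rX0 (IVar vI)) (RVar rTau))
          (RSet rSum (RAdd (RVar rSum) (RMul (RRead rC0 (IVar vI)) (RRead rX0 (IVar vI)))))
          (RSet rSum (RAdd (RVar rSum) (RMul (RRead rC0 (IVar vI)) (RVar rTau))))"
  let ?J = "\<lambda>i s'. rmem s' rSum 0 = (\<Sum>k<i. C k * min (x k) \<theta>) \<and> (\<forall>k<i. rmem s' rC k = C k \<and> rmem s' rX k = x k)"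
  have s': "rmem ?s rTau 0 = \<theta>" "rmem ?s rP 0 = \<theta>" "imem ?s vA 0 = n" "imem ?s vN 0 = n" "rmem ?s rSum 0 = 0"
    using s by (simp_all add: \<theta>_def prepared_def input_def)
  have un0: "unchanged ?init s ?s"
    using exec_straight_line[of ?init s] exec_unchanged by fastforce
  have prep: "prepared ?s"
    by (rule prepared_unchanged[OF s un0]) simp_all
  show "runs (For vI vN ?c) ?s (80 * n + 9) (?J n)"
  proof (rule runs_For[where k = 68 and I = ?J])
    fix i and r :: ram_state
    assume i: "i < imem ?s vN 0" "imem r vI 0 = i" and J: "?J i r" and un: "unchanged (For vI vN ?c) ?s r"
    have i': "i < n"
      using i(1) s'(4) by simp
    have "prepared r"
      by (rule prepared_unchanged[OF prep un]) simp_all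
    then have r: "rmem r rC0 i = C i" "rmem r rX0 i = x i"
      using i' by (simp_all add: prepared_def)
    have th: "rmem r rTau 0 = \<theta>"
      using unchanged_rmem[OF un, of rTau] s'(1) by simp
    show "runs ?c r 68 (\<lambda>s''. ?J (Suc i) (iwrite vI 0 (Suc i) s''))"
      by (intro runs_straight_line) (use i(2) J r th in \<open>auto simp: less_Suc_eq min_def\<close>)
  qed (use s' in simp_all)
  fix r :: ram_state
  assume J: "?J n r" and un: "unchanged (For vI vN ?c) ?s r"
  have r: "rmem r rTau 0 = \<theta>" "rmem r rP 0 = \<theta>" "imem r vA 0 = n"
    using unchanged_rmem[OF un, of rTau] unchanged_rmem[OF un, of rP] unchanged_imem[OF un, of vA] s' by simp_all
  have tails: "tail_gt n (rmem r rX) (rmem r rC) \<theta> = tail_gt n x C \<theta>" "tail_ge n (rmem r rX) (rmem r rC) \<theta> = tail_ge n x C \<theta>"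
    using J by (simp_all add: tail_cong)
  show "runs tails_com r (60 * n + 30) ?Q"
  proof (rule runs_weaken[OF runs_tails])
    fix q :: ram_state
    assume q: "rmem q rHi 0 = tail_gt (imem r vA 0) (rmem r rX) (rmem r rC) (rmem r rP 0) \<and>
      rmem q rLo 0 = tail_ge (imem r vA 0) (rmem r rX) (rmem r rC) (rmem r rP 0)" and un2: "unchanged tails_com r q"
    show "?Q q"
      using q unchanged_rmem[OF un2, of rTau] unchanged_rmem[OF un2, of rSum] J by (simp add: r tails env_def)
  qed (simp add: r)
qed simp_all

lemma runs_multipliers:
  assumes s: "prepared s" and hi: "rmem s rHi 0 = h0" and lo: "rmem s rLo 0 = l0"
  defines "h \<equiv> L - lam + h0" and "l \<equiv> L - lam + l0"
  defines "\<rho> \<equiv> tie_weight h l"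
  defines "S \<equiv> h + \<rho> * (l - h)"
  shows "runs multipliers_com s 100 (\<lambda>s'. imem s' vVerdict 0 = 1 \<and> rmem s' rRho 0 = \<rho> \<and>
    rmem s' rMu 0 = mix_weight lam (rmem s rBound 0) S \<and> rmem s' rEx 0 = excess (rmem s rBound 0) S)"
proof (rule runs_straight_line)
  have "rmem s rL 0 = L" "rmem s rIn 0 = lam"
    using s by (simp_all add: prepared_def input_def)
  then show "imem (effect multipliers_com s) vVerdict 0 = 1 \<and> rmem (effect multipliers_com s) rRho 0 = \<rho> \<and>
    rmem (effect multipliers_com s) rMu 0 = mix_weight lam (rmem s rBound 0) S \<and>
    rmem (effect multipliers_com s) rEx 0 = excess (rmem s rBound 0) S"
    using hi lo
    by (simp add: multipliers_com_def S_def \<rho>_def h_def l_def tie_weight_def mix_weight_def excess_def)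
qed (simp_all add: multipliers_com_def)

lemma runs_emit:
  assumes s: "prepared s"
  defines "\<mu> \<equiv> rmem s rMu 0" and "r \<equiv> split_weight x (rmem s rTau 0) (rmem s rRho 0)"
  shows "runs (emit_com sg) s (100 * n + 60) (\<lambda>s'.
    (\<forall>i<n. rmem s' 5 i = - ((\<mu> + (1 - \<mu>) * r i) * a' i)) \<and> rmem s' 6 0 = of_int sg \<and>
    rmem s' 6 1 = \<mu> * lam + rmem s rEx 0 - (1 - \<mu>) * (\<Sum>i<n. r i * (a' i * e i)))" (is "runs _ _ _ ?Q")
  unfolding emit_com_def
proof (rule runs_Seq_straight[where l = "100 * n + 50"], simp, rule runs_Seq[where k = "100 * n + 9" and l = 40])
  let ?s = "effect (RSet rSum (RConst 0)) s"
  let ?t = "Cond (RLess (RRead rX0 (IVar vI)) (RVar rTau)) (RSet rTmp (RConst 1))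
         (Cond (RLess (RVar rTau) (RRead rX0 (IVar vI))) (RSet rTmp (RConst 0))
           (RSet rTmp (RSub (RConst 1) (RVar rRho))))"
  let ?c = "?t ;; RWrite 5 (IVar vI) (RSub (RConst 0)
          (RMul (RAdd (RVar rMu) (RMul (RSub (RConst 1) (RVar rMu)) (RVar rTmp))) (a_exp sg))) ;;
        RSet rSum (RAdd (RVar rSum) (RMul (RVar rTmp) (RMul (a_exp sg) (RRead rE (IVar vI)))))"
  let ?J = "\<lambda>i s'. (\<forall>k<i. rmem s' 5 k = - ((\<mu> + (1 - \<mu>) * r k) * a' k)) \<and> rmem s' rSum 0 = (\<Sum>k<i. r k * (a' k * e k))"
  have un0: "unchanged (RSet rSum (RConst 0)) s ?s"
    by (simp add: unchanged_def)
  have prep: "prepared ?s"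
    by (rule prepared_unchanged[OF s un0]) simp_all
  have sv: "rmem ?s rTau = rmem s rTau" "rmem ?s rRho = rmem s rRho" "rmem ?s rMu = rmem s rMu" "rmem ?s rEx = rmem s rEx"
    by simp_all
  have vN: "imem ?s vN 0 = n"
    using prep by (simp add: prepared_def input_def)
  show "runs (For vI vN ?c) ?s (100 * n + 9) (?J n)"
  proof (rule runs_For[where k = 88 and I = ?J])
    fix i and q :: ram_state
    assume i: "i < imem ?s vN 0" "imem q vI 0 = i" and J: "?J i q" and un: "unchanged (For vI vN ?c) ?s q"
    have i': "i < n"
      using i(1) vN by simp
    have "prepared q"
      by (rule prepared_unchanged[OF prep un]) simp_all
    then have q: "rmem q rX0 i = x i" "rmem q rE i = e i" "rmem q 0 = Poly_Mapping.lookup a"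
      using i' by (simp_all add: prepared_def input_def)
    have v: "rmem q rTau 0 = rmem s rTau 0" "rmem q rRho 0 = rmem s rRho 0" "rmem q rMu 0 = \<mu>"
      using unchanged_rmem[OF un, of rTau] unchanged_rmem[OF un, of rRho] unchanged_rmem[OF un, of rMu] by (simp_all add: sv \<mu>_def)
    show "runs ?c q 88 (\<lambda>s''. ?J (Suc i) (iwrite vI 0 (Suc i) s''))"
    proof (rule runs_Seq[where k = 40 and l = 48 and R = "\<lambda>q'. rmem q' rTmp 0 = r i"])
      show "runs ?t q 40 (\<lambda>q'. rmem q' rTmp 0 = r i)"
        by (intro runs_straight_line) (simp_all add: i(2) q v r_def split_weight_def)
    next
      fix q' :: ram_state
      assume q': "rmem q' rTmp 0 = r i" and un': "unchanged ?t q q'"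
      have "imem q' vI = imem q vI" "rmem q' 5 = rmem q 5" "rmem q' rSum = rmem q rSum" "rmem q' rMu = rmem q rMu"
        "rmem q' rE = rmem q rE" "rmem q' 0 = rmem q 0"
        using unchanged_mem[OF un'] by simp_all
      then show "runs (RWrite 5 (IVar vI) (RSub (RConst 0)
          (RMul (RAdd (RVar rMu) (RMul (RSub (RConst 1) (RVar rMu)) (RVar rTmp))) (a_exp sg))) ;;
        RSet rSum (RAdd (RVar rSum) (RMul (RVar rTmp) (RMul (a_exp sg) (RRead rE (IVar vI)))))) q' 48
          (\<lambda>s''. ?J (Suc i) (iwrite vI 0 (Suc i) s''))"
        using J q' by (intro runs_straight_line) (auto simp: i(2) q v a'_def less_Suc_eq)
    qed simp
  qed (use vN in simp_all)
  fix q :: ram_state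
  assume J: "?J n q" and un: "unchanged (For vI vN ?c) ?s q"
  have "prepared q"
    by (rule prepared_unchanged[OF prep un]) simp_all
  moreover have "rmem q rEx 0 = rmem s rEx 0" "rmem q rMu 0 = \<mu>"
    using unchanged_rmem[OF un, of rEx] unchanged_rmem[OF un, of rMu] by (simp_all add: sv \<mu>_def)
  ultimately show "runs (RSet 6 (RConst sg) ;;
      RWrite 6 (IConst 1) (RSub (RAdd (RMul (RVar rMu) lam_exp) (RVar rEx))
        (RMul (RSub (RConst 1) (RVar rMu)) (RVar rSum)))) q 40 ?Q"
    using J by (intro runs_straight_line) (simp_all add: prepared_def input_def)
qed simp_all

text \<open>Verdict 0 is only half of membership here: the vertical line through y meets the hull at
  or beyond w in the direction of \<open>sg\<close>.\<close>

definition meets_side :: "ram_state \<Rightarrow> bool" where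
  "meets_side s \<longleftrightarrow>
     (imem s vVerdict 0 = 0 \<and> (\<exists>v. (y, v) \<in> convex hull (Phi n a yl yu lam) \<and> of_int sg * w \<le> of_int sg * v)) \<or>
     (imem s vVerdict 0 \<noteq> 0 \<and> separates n (convex hull (Phi n a yl yu lam)) y w (output_of s))"

lemma separates_emitted:
  fixes \<mu> \<rho> \<theta> ex :: real and s :: ram_state
  assumes \<rho>: "0 \<le> \<rho>" "\<rho> \<le> 1" and \<mu>: "0 \<le> \<mu>" "\<mu> \<le> 1" and ex: "0 \<le> ex"
    and slack: "(1 - \<mu>) * (L - lam + (\<Sum>i<n. (1 - split_weight x \<theta> \<rho> i) * C i)) - 2 * lam * \<mu> \<le> ex"
    and viol: "\<mu> * (L + V + lam) + (1 - \<mu>) * (\<Sum>i<n. split_weight x \<theta> \<rho> i * (C i * x i)) + ex < of_int sg * w"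
    and out: "\<forall>i<n. rmem s 5 i = - ((\<mu> + (1 - \<mu>) * split_weight x \<theta> \<rho> i) * a' i)" "rmem s 6 0 = of_int sg"
      "rmem s 6 1 = \<mu> * lam + ex - (1 - \<mu>) * (\<Sum>i<n. split_weight x \<theta> \<rho> i * (a' i * e i))"
    and verdict: "imem s vVerdict 0 \<noteq> 0"
  shows "meets_side s"
proof -
  have "separates n (convex hull (Phi n a yl yu lam)) y w (Cut (rmem s 5) (of_int sg) (rmem s 6 1))"
  proof (rule oriented_cut_separates[OF _ lam oriented _ y \<mu>, where r = "split_weight x \<theta> \<rho>" and ex = ex])
    show "real_of_int sg = 1 \<or> real_of_int sg = - 1"
      using sg by auto
    show "a' = (\<lambda>i. real_of_int sg * Poly_Mapping.lookup a i)"
      by (simp add: a'_def fun_eq_iff)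
    show "0 \<le> split_weight x \<theta> \<rho> i \<and> split_weight x \<theta> \<rho> i \<le> 1" for i
      using \<rho> by (simp add: split_weight_def)
  qed (use ex slack viol out in \<open>simp_all add: L_def V_def C_def x_def[abs_def]\<close>)
  then show ?thesis
    using verdict out(2) by (simp add: meets_side_def output_of_def)
qed

text \<open>Interface between search and output: the immediate case \<mu> = 1 and the full search
  both end with multipliers as \<open>separates_emitted\<close> needs them, so one program can write
  down the cut.\<close>

definition decided :: "ram_state \<Rightarrow> bool" where
  "decided s \<longleftrightarrow> prepared s \<and>
     ((imem s vVerdict 0 = 0 \<and> (\<exists>v. (y, v) \<in> convex hull (Phi n a yl yu lam) \<and> of_int sg * w \<le> of_int sg * v)) \<or>
      (imem s vVerdict 0 = 1 \<and> (\<exists>\<mu> \<rho> \<theta> ex. rmem s rMu 0 = \<mu> \<and> rmem s rRho 0 = \<rho> \<and> rmem s rTau 0 = \<theta> \<and> rmem s rEx 0 = ex \<and>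
         0 \<le> \<rho> \<and> \<rho> \<le> 1 \<and> 0 \<le> \<mu> \<and> \<mu> \<le> 1 \<and> 0 \<le> ex \<and>
         (1 - \<mu>) * (L - lam + (\<Sum>i<n. (1 - split_weight x \<theta> \<rho> i) * C i)) - 2 * lam * \<mu> \<le> ex \<and>
         \<mu> * (L + V + lam) + (1 - \<mu>) * (\<Sum>i<n. split_weight x \<theta> \<rho> i * (C i * x i)) + ex < of_int sg * w)))"

lemma runs_emit_decided:
  assumes "decided s"
  shows "runs (Cond (ILess (IConst 0) (IVar vVerdict)) (emit_com sg) Skip) s (100 * n + 70) meets_side"
proof (rule runs_Cond[where k = "100 * n + 60"])
  assume "tval s (ILess (IConst 0) (IVar vVerdict))"
  then have d: "prepared s" "imem s vVerdict 0 = 1"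
    "0 \<le> rmem s rRho 0" "rmem s rRho 0 \<le> 1" "0 \<le> rmem s rMu 0" "rmem s rMu 0 \<le> 1" "0 \<le> rmem s rEx 0"
    "(1 - rmem s rMu 0) * (L - lam + (\<Sum>i<n. (1 - split_weight x (rmem s rTau 0) (rmem s rRho 0) i) * C i)) - 2 * lam * rmem s rMu 0 \<le> rmem s rEx 0"
    "rmem s rMu 0 * (L + V + lam) + (1 - rmem s rMu 0) * (\<Sum>i<n. split_weight x (rmem s rTau 0) (rmem s rRho 0) i * (C i * x i)) + rmem s rEx 0 < of_int sg * w"
    using assms by (auto simp: decided_def)
  show "runs (emit_com sg) s (100 * n + 60) meets_side"
  proof (rule runs_weaken[OF runs_emit[OF d(1)]])
    fix s' :: ram_state
    assume out: "(\<forall>i<n. rmem s' 5 i = - ((rmem s rMu 0 + (1 - rmem s rMu 0) * split_weight x (rmem s rTau 0) (rmem s rRho 0) i) * a' i)) \<and>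
        rmem s' 6 0 = of_int sg \<and>
        rmem s' 6 1 = rmem s rMu 0 * lam + rmem s rEx 0 - (1 - rmem s rMu 0) * (\<Sum>i<n. split_weight x (rmem s rTau 0) (rmem s rRho 0) i * (a' i * e i))"
      and un: "unchanged (emit_com sg) s s'"
    have "imem s' vVerdict 0 \<noteq> 0"
      using unchanged_imem[OF un, of vVerdict] d(2) by simp
    then show "meets_side s'"
      using out by (intro separates_emitted[OF d(3-9)]) simp_all
  qed simp
next
  assume "\<not> tval s (ILess (IConst 0) (IVar vVerdict))"
  then show "runs Skip s (100 * n + 60) meets_side"
    using assms by (intro runs_straight_line) (simp_all add: decided_def meets_side_def)
qed simp

lemma runs_search:
  assumes s: "prepared s" and copies: "imem s vA 0 = n" "\<forall>k<n. rmem s rC k = C k \<and> rmem s rX k = x k"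
    and verdict: "imem s vVerdict 0 = 0" and bound: "rmem s rBound 0 = L + V + lam - of_int sg * w" "0 \<le> rmem s rBound 0"
  shows "runs (RSet rBound (RDiv (RVar rBound) (RMul (RConst 2) lam_exp)) ;;
        Cond (RLess (RConst 1) (RVar rBound)) (RSet rBound (RConst 1)) Skip ;;
        quantile_com ;;
        evaluate_com ;;
        Cond (RLess (RAdd (RMul (RSub (RVar rL) lam_exp) (RVar rTau)) (RVar rSum)) (w_exp sg))
          multipliers_com Skip) s (144400 * n + 400) decided"
proof (rule runs_Seq_straight[where l = "144400 * n + 380"], simp, rule runs_Seq_straight[where l = "144400 * n + 360"], simp)
  let ?s = "effect (Cond (RLess (RConst 1) (RVar rBound)) (RSet rBound (RConst 1)) Skip)
    (effect (RSet rBound (RDiv (RVar rBound) (RMul (RConst 2) lam_exp))) s)"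
  define \<theta>0 where "\<theta>0 = min 1 ((L + V + lam - of_int sg * w) / (2 * lam))"
  have \<theta>0: "0 \<le> \<theta>0" "\<theta>0 \<le> 1"
    using bound lam by (simp_all add: \<theta>0_def)
  have lam_s: "rmem s rIn 0 = lam"
    using s by (simp add: prepared_def input_def)
  have s': "rmem ?s rBound 0 = \<theta>0" "imem ?s vA 0 = n" "\<forall>k<n. rmem ?s rC k = C k \<and> rmem ?s rX k = x k" "imem ?s vVerdict 0 = 0"
    using lam_s bound(1) copies verdict by (simp_all add: \<theta>0_def)
  have prep: "prepared ?s"
    using s by (simp add: prepared_def input_def)
  show "runs (quantile_com ;; evaluate_com ;;
        Cond (RLess (RAdd (RMul (RSub (RVar rL) lam_exp) (RVar rTau)) (RVar rSum)) (w_exp sg))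
          multipliers_com Skip) ?s (144400 * n + 360) decided"
  proof (rule runs_Seq[OF runs_quantile[OF prep s'(2,3)], where l = "150 * n + 250"])
    fix s2 :: ram_state
    let ?\<tau> = "rmem s2 rTau 0"
    assume q: "let \<tau> = ?\<tau>; D = lam - L in (D \<le> 0 \<and> \<tau> = 1) \<or> ((\<Sum>i<n. C i) \<le> D \<and> \<tau> = 0) \<or>
      (D < (\<Sum>i<n. C i) \<and> tail_gt n x C \<tau> \<le> D \<and> D \<le> tail_ge n x C \<tau>)"
      and un2: "unchanged quantile_com ?s s2"
    have prep2: "prepared s2"
      by (rule prepared_unchanged[OF prep un2]) simp_all
    have b2: "rmem s2 rBound 0 = \<theta>0" "imem s2 vVerdict 0 = 0"
      using unchanged_rmem[OF un2, of rBound] unchanged_imem[OF un2, of vVerdict] s'(1,4) by simp_all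
    define \<theta> where "\<theta> = (if \<theta>0 < ?\<tau> then \<theta>0 else ?\<tau>)"
    have \<theta>: "0 \<le> \<theta>" "\<theta> \<le> \<theta>0" "tail_gt n x C \<theta> \<le> lam - L \<or> \<theta> = \<theta>0" "lam - L \<le> tail_ge n x C \<theta> \<or> \<theta> = 0"
      unfolding \<theta>_def
      by (rule clamped_quantile[where D = "lam - L"]; use C_nonneg x_bounds \<theta>0 q in \<open>simp add: Let_def\<close>)+
    show "runs (evaluate_com ;;
        Cond (RLess (RAdd (RMul (RSub (RVar rL) lam_exp) (RVar rTau)) (RVar rSum)) (w_exp sg))
          multipliers_com Skip) s2 (150 * n + 250) decided"
    proof (rule runs_Seq[OF runs_evaluate[OF prep2], where l = 150])
      fix s3 :: ram_state
      assume ev: "rmem s3 rTau 0 = (if rmem s2 rBound 0 < ?\<tau> then rmem s2 rBound 0 else ?\<tau>) \<and>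
          (L - lam) * (if rmem s2 rBound 0 < ?\<tau> then rmem s2 rBound 0 else ?\<tau>) + rmem s3 rSum 0 =
            env n lam L C x (if rmem s2 rBound 0 < ?\<tau> then rmem s2 rBound 0 else ?\<tau>) \<and>
          rmem s3 rHi 0 = tail_gt n x C (if rmem s2 rBound 0 < ?\<tau> then rmem s2 rBound 0 else ?\<tau>) \<and>
          rmem s3 rLo 0 = tail_ge n x C (if rmem s2 rBound 0 < ?\<tau> then rmem s2 rBound 0 else ?\<tau>)"
        and un3: "unchanged evaluate_com s2 s3"
      have prep3: "prepared s3"
        by (rule prepared_unchanged[OF prep2 un3]) simp_all
      have b3: "rmem s3 rBound 0 = \<theta>0" "imem s3 vVerdict 0 = 0"
        using unchanged_rmem[OF un3, of rBound] unchanged_imem[OF un3, of vVerdict] b2 by simp_all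
      have e3: "rmem s3 rTau 0 = \<theta>" "(L - lam) * \<theta> + rmem s3 rSum 0 = env n lam L C x \<theta>"
        "rmem s3 rHi 0 = tail_gt n x C \<theta>" "rmem s3 rLo 0 = tail_ge n x C \<theta>"
        using ev by (simp_all only: b2 \<theta>_def[symmetric])
      have in3: "rmem s3 rL 0 = L" "rmem s3 rIn 0 = lam" "rmem s3 rIn 1 = w"
        using prep3 by (simp_all add: prepared_def input_def)
      have test: "tval s3 (RLess (RAdd (RMul (RSub (RVar rL) lam_exp) (RVar rTau)) (RVar rSum)) (w_exp sg)) \<longleftrightarrow>
          env n lam L C x \<theta> < of_int sg * w"
        using in3 e3(1) by (simp add: e3(2)[symmetric])
      show "runs (Cond (RLess (RAdd (RMul (RSub (RVar rL) lam_exp) (RVar rTau)) (RVar rSum)) (w_exp sg))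
          multipliers_com Skip) s3 150 decided"
      proof (rule runs_Cond[where k = 100])
        assume "tval s3 (RLess (RAdd (RMul (RSub (RVar rL) lam_exp) (RVar rTau)) (RVar rSum)) (w_exp sg))"
        then have lt: "env n lam L C x \<theta> < of_int sg * w"
          by (simp only: test)
        show "runs multipliers_com s3 100 decided"
        proof (rule runs_weaken[OF runs_multipliers[OF prep3 e3(3,4)]])
          fix s4 :: ram_state
          let ?h = "L - lam + tail_gt n x C \<theta>" and ?l = "L - lam + tail_ge n x C \<theta>"
          let ?\<rho> = "tie_weight ?h ?l"
          let ?S = "?h + ?\<rho> * (?l - ?h)"
          assume m: "imem s4 vVerdict 0 = 1 \<and> rmem s4 rRho 0 = ?\<rho> \<and>
              rmem s4 rMu 0 = mix_weight lam (rmem s3 rBound 0) ?S \<and> rmem s4 rEx 0 = excess (rmem s3 rBound 0) ?S"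
            and un4: "unchanged multipliers_com s3 s4"
          have "prepared s4"
            by (rule prepared_unchanged[OF prep3 un4]) simp_all
          moreover have "rmem s4 rTau 0 = \<theta>"
            using unchanged_rmem[OF un4, of rTau] e3(1) by simp
          moreover note cut_multipliers[OF lam C_nonneg \<theta>0(1) \<theta>0_def[unfolded V_def] \<theta>(3,4) lt]
          ultimately show "decided s4"
            unfolding decided_def V_def using m b3(1) by simp
        qed simp
      next
        assume "\<not> tval s3 (RLess (RAdd (RMul (RSub (RVar rL) lam_exp) (RVar rTau)) (RVar rSum)) (w_exp sg))"
        then have ge: "of_int sg * w \<le> env n lam L C x \<theta>"
          by (simp only: test not_less)
        \<comment> \<open>The cap on \<theta> is the second condition of
          \<open>hull_point_above\<close>; the failed test is the first.\<close>
        have "\<theta> \<le> (L + V + lam - of_int sg * w) / (2 * lam)"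
          using \<theta>(2) by (simp add: \<theta>0_def)
        then have "of_int sg * w \<le> L + V + lam - 2 * lam * \<theta>"
          using lam by (simp add: field_simps)
        then have "\<exists>v. (y, v) \<in> convex hull (Phi n a yl yu lam) \<and> of_int sg * w \<le> of_int sg * v"
          using sg ge \<theta>(1,2) \<theta>0(2)
          by (intro hull_point_above[OF _ lam oriented box _ y, where \<theta> = \<theta>])
            (auto simp: a'_def fun_eq_iff C_def[abs_def] x_def[abs_def] L_def V_def)
        then show "runs Skip s3 100 decided"
          using prep3 b3(2) by (intro runs_straight_line) (simp_all add: decided_def)
      qed simp
    qed simp
  qed simp
qed simp_all

lemma runs_side:
  assumes s: "input s" and verdict: "imem s vVerdict 0 = 0"
  shows "runs (side_com sg) s (144700 * n + 700) meets_side"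
  unfolding side_com_def
proof (rule runs_Seq[OF runs_ends[OF s], where l = "144640 * n + 680"])
  fix s1 :: ram_state
  assume s1: "input s1 \<and> (\<forall>k<n. rmem s1 rE k = e k \<and> rmem s1 rF k = f k)" and un1: "unchanged (ends_com sg) s s1"
  let ?bound = "RSet rBound (RSub (RAdd (RAdd (RVar rL) (RVar rV)) lam_exp) (w_exp sg))"
  let ?stop = "RSet rMu (RConst 1) ;; RSet rEx (RConst 0) ;; RSet rRho (RConst 0) ;; ISet vVerdict (IConst 1)"
  let ?search = "RSet rBound (RDiv (RVar rBound) (RMul (RConst 2) lam_exp)) ;;
        Cond (RLess (RConst 1) (RVar rBound)) (RSet rBound (RConst 1)) Skip ;;
        quantile_com ;;
        evaluate_com ;;
        Cond (RLess (RAdd (RMul (RSub (RVar rL) lam_exp) (RVar rTau)) (RVar rSum)) (w_exp sg))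
          multipliers_com Skip"
  let ?emit = "Cond (ILess (IConst 0) (IVar vVerdict)) (emit_com sg) Skip"
  have v1: "imem s1 vVerdict 0 = 0"
    using unchanged_imem[OF un1, of vVerdict] verdict by simp
  show "runs (coords_com sg ;; ?bound ;; Cond (RLess (RVar rBound) (RConst 0)) ?stop ?search ;; ?emit) s1 (144640 * n + 680) meets_side"
  proof (rule runs_Seq[OF runs_coords, where l = "144510 * n + 600"])
    fix s2 :: ram_state
    assume s2: "prepared s2 \<and> imem s2 vA 0 = n \<and> (\<forall>k<n. rmem s2 rC k = C k \<and> rmem s2 rX k = x k)"
      and un2: "unchanged (coords_com sg) s1 s2"
    have v2: "imem s2 vVerdict 0 = 0"
      using unchanged_imem[OF un2, of vVerdict] v1 by simp
    show "runs (?bound ;; Cond (RLess (RVar rBound) (RConst 0)) ?stop ?search ;; ?emit) s2 (144510 * n + 600) meets_side"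
    proof (rule runs_Seq_straight[where l = "144510 * n + 550"], simp)
      let ?s = "effect ?bound s2"
      have s': "prepared ?s" "imem ?s vA 0 = n" "\<forall>k<n. rmem ?s rC k = C k \<and> rmem ?s rX k = x k" "imem ?s vVerdict 0 = 0"
        "rmem ?s rBound 0 = L + V + lam - of_int sg * w"
        using s2 v2 by (simp_all add: prepared_def input_def)
      show "runs (Cond (RLess (RVar rBound) (RConst 0)) ?stop ?search ;; ?emit) ?s (144510 * n + 550) meets_side"
      proof (rule runs_Seq[OF _ runs_emit_decided, where k = "144400 * n + 450"])
        show "runs (Cond (RLess (RVar rBound) (RConst 0)) ?stop ?search) ?s (144400 * n + 450) decided"
        proof (rule runs_Cond[where k = "144400 * n + 400"])
          assume "tval ?s (RLess (RVar rBound) (RConst 0))"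
          then have "L + V + lam < of_int sg * w"
            using s'(5) by simp
          \<comment> \<open>With \<mu> = 1 the split weights have coefficient 0, so the content of
            \<open>rTau\<close> may be arbitrary, and \<rho> = 0 only has to lie in [0, 1].\<close>
          then have "decided (effect ?stop ?s)"
            using s' lam by (simp add: decided_def prepared_def input_def)
          then show "runs ?stop ?s (144400 * n + 400) decided"
            by (intro runs_straight_line) simp_all
        next
          assume "\<not> tval ?s (RLess (RVar rBound) (RConst 0))"
          then have "0 \<le> rmem ?s rBound 0"
            by simp
          then show "runs ?search ?s (144400 * n + 400) decided"
            by (rule runs_search[OF s'])
        qed simp
      qed simp_all
    qed simp
  qed (use s1 in simp_all)
qed simp

end

section \<open>Points outside the box, and the two signs together\<close>

definition box_com :: com where
  "box_com =
     (RSet 6 (RConst 0) ;; RWrite 6 (IConst 1) (RConst 0)) ;;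
     For vI vN
       (Cond (RLess (RRead 3 (IVar vI)) (RRead 1 (IVar vI)))
         (RWrite 5 (IVar vI) (RConst (-1)) ;;
          RWrite 6 (IConst 1) (RSub (RRead 6 (IConst 1)) (RRead 1 (IVar vI))) ;;
          ISet vVerdict (IConst 1))
         (Cond (RLess (RRead 2 (IVar vI)) (RRead 3 (IVar vI)))
           (RWrite 5 (IVar vI) (RConst 1) ;;
            RWrite 6 (IConst 1) (RAdd (RRead 6 (IConst 1)) (RRead 2 (IVar vI))) ;;
            ISet vVerdict (IConst 1))
           (RWrite 5 (IVar vI) (RConst 0))))"

definition separation_com :: com where
  "separation_com =
     box_com ;;
     Cond (ILess (IVar vVerdict) (IConst 1)) (side_com 1) Skip ;;
     Cond (ILess (IVar vVerdict) (IConst 1)) (side_com (-1)) Skip"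

lemma writes_box [simp]: "iwrites box_com = {vI, vVerdict}" "rwrites box_com = {5, 6}"
  by (auto simp: box_com_def)

lemma writes_side [simp]:
  "iwrites (side_com sg) = {vI, vJ, vB, vK, vT, vM, vG, vH, vA, vF, vVerdict}"
  "rwrites (side_com sg) = {rE, rF, rL, rV, rCsum, rC0, rX0, rC, rX, rBound, rMu, rEx, rRho, rS, rTmp, rP,
     rHi, rLo, rD, rTau, rSum, rSlope, 5, 6}"
  by (auto simp: side_com_def)

lemma runs_Cond_skip: "\<not> tval s b \<Longrightarrow> Q s \<Longrightarrow> 2 + tcost b \<le> k \<Longrightarrow> runs (Cond b c Skip) s k Q"
  by (rule runs_Cond[where k = 1]) (auto intro: runs_straight_line)

text \<open>The violated bounds are added up, so that the loop need not stop at the first one.\<close>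

definition bound_coeff :: "real \<Rightarrow> real \<Rightarrow> real \<Rightarrow> real" where
  "bound_coeff l u y = (if y < l then -1 else if u < y then 1 else 0)"

definition bound_rhs :: "real \<Rightarrow> real \<Rightarrow> real \<Rightarrow> real" where
  "bound_rhs l u y = (if y < l then - l else if u < y then u else 0)"

lemma runs_box:
  fixes s :: ram_state
  defines "n \<equiv> imem s vN 0" and "l \<equiv> rmem s 1" and "u \<equiv> rmem s 2" and "y \<equiv> rmem s 3"
  assumes verdict: "imem s vVerdict 0 = 0"
  shows "runs box_com s (80 * n + 20) (\<lambda>s'.
    (\<forall>i<n. rmem s' 5 i = bound_coeff (l i) (u i) (y i)) \<and> rmem s' 6 0 = 0 \<and>
    rmem s' 6 1 = (\<Sum>i<n. bound_rhs (l i) (u i) (y i)) \<and>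
    (imem s' vVerdict 0 = 0 \<longleftrightarrow> (\<forall>i<n. l i \<le> y i \<and> y i \<le> u i)))"
    (is "runs _ _ _ ?Q")
  unfolding box_com_def
proof (rule runs_Seq_straight[where l = "80 * n + 9"], simp, rule runs_For[where k = 68 and I = "\<lambda>i s'.
    (\<forall>k<i. rmem s' 5 k = bound_coeff (l k) (u k) (y k)) \<and> rmem s' 6 0 = 0 \<and>
    rmem s' 6 1 = (\<Sum>k<i. bound_rhs (l k) (u k) (y k)) \<and>
    (imem s' vVerdict 0 = 0 \<longleftrightarrow> (\<forall>k<i. l k \<le> y k \<and> y k \<le> u k))"], goal_cases)
  case (5 i r)
  have un: "unchanged box_com s r"
    using 5(4) by (auto simp: unchanged_def box_com_def)
  have r: "rmem r (Suc 0) = l" "rmem r 2 = u" "rmem r 3 = y"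
    using unchanged_rmem[OF un] by (simp_all add: l_def u_def y_def)
  show ?case
    by (intro runs_straight_line)
      (use 5(2,3) in \<open>auto simp: r less_Suc_eq bound_coeff_def bound_rhs_def not_less\<close>)
qed (use verdict in \<open>simp_all add: n_def\<close>)

text \<open>The inequality holds coordinate by coordinate: a coordinate of y inside its bounds
  contributes zero to both sides, one outside contributes a bound that is valid on the box and
  strictly violated by y. One coordinate outside thus makes the sum strictly violated.\<close>

lemma separates_box:
  assumes out: "\<forall>i<n. \<alpha> i = bound_coeff (Poly_Mapping.lookup yl i) (Poly_Mapping.lookup yu i) (Poly_Mapping.lookup y i)"
    "\<gamma> = (\<Sum>i<n. bound_rhs (Poly_Mapping.lookup yl i) (Poly_Mapping.lookup yu i) (Poly_Mapping.lookup y i))"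
    and j: "j < n" "\<not> (Poly_Mapping.lookup yl j \<le> Poly_Mapping.lookup y j \<and> Poly_Mapping.lookup y j \<le> Poly_Mapping.lookup yu j)"
  shows "separates n (convex hull (Phi n a yl yu lam)) y w (Cut \<alpha> 0 \<gamma>)"
proof -
  have "dot n \<alpha> z + 0 * v \<le> \<gamma>" if "(z, v) \<in> Phi n a yl yu lam" for z v
  proof -
    have "dot n \<alpha> z \<le> \<gamma>"
      unfolding dot_def out(2)
    proof (rule sum_mono)
      fix i assume "i \<in> {..<n}"
      then show "\<alpha> i * Poly_Mapping.lookup z i \<le>
        bound_rhs (Poly_Mapping.lookup yl i) (Poly_Mapping.lookup yu i) (Poly_Mapping.lookup y i)"
        using that out(1) by (auto simp: Phi_def vec_box_def vec_le_def bound_coeff_def bound_rhs_def)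
    qed
    then show ?thesis
      by simp
  qed
  then have "\<forall>(z, v)\<in>convex hull (Phi n a yl yu lam). dot n \<alpha> z + 0 * v \<le> \<gamma>"
    using halfspace_hull by blast
  moreover have "\<gamma> < dot n \<alpha> y"
    unfolding dot_def out(2)
    by (rule sum_strict_mono_ex1) (use j out(1) in \<open>auto simp: bound_coeff_def bound_rhs_def intro!: bexI[of _ j]\<close>)
  ultimately show ?thesis
    by simp
qed

lemma runs_sides:
  assumes lam: "0 < lam" and box: "vec_le n yl yu" and y: "y \<in> vec_box n yl yu"
    and s: "box_side.input n a yl yu y lam w s" and verdict: "imem s vVerdict 0 = 0"
  shows "runs (Cond (ILess (IVar vVerdict) (IConst 1)) (side_com 1) Skip ;;
     Cond (ILess (IVar vVerdict) (IConst 1)) (side_com (-1)) Skip) s (289400 * n + 1420)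
    (\<lambda>s'. separates n (convex hull (Phi n a yl yu lam)) y w (output_of s'))" (is "runs _ _ _ ?Q")
proof -
  interpret up: box_side n a yl yu y lam w 1
    by standard (use lam box y in simp_all)
  interpret down: box_side n a yl yu y lam w "-1"
    by standard (use lam box y in simp_all)
  show ?thesis
  proof (rule runs_Seq)
    show "runs (Cond (ILess (IVar vVerdict) (IConst 1)) (side_com 1) Skip) s (144700 * n + 710) up.meets_side"
      by (rule runs_Cond[OF up.runs_side[OF s verdict]]) (use verdict in simp_all)
    fix s1 :: ram_state
    assume up: "up.meets_side s1" and "unchanged (Cond (ILess (IVar vVerdict) (IConst 1)) (side_com 1) Skip) s s1"
    then have un: "unchanged (side_com 1) s s1"
      by (simp add: unchanged_def)
    \<comment> \<open>\<open>input\<close> does not depend on the sign, so the state left by the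
      first side is an input for the second as well.\<close>
    have s1: "up.input s1"
      by (rule up.input_unchanged[OF s un]) simp_all
    show "runs (Cond (ILess (IVar vVerdict) (IConst 1)) (side_com (-1)) Skip) s1 (144700 * n + 710) ?Q"
    proof (rule runs_Cond[where k = "144700 * n + 700"])
      assume "tval s1 (ILess (IVar vVerdict) (IConst 1))"
      then have v1: "imem s1 vVerdict 0 = 0"
        by simp
      then obtain v where v: "(y, v) \<in> convex hull (Phi n a yl yu lam)" "w \<le> v"
        using up by (auto simp: up.meets_side_def)
      show "runs (side_com (-1)) s1 (144700 * n + 700) ?Q"
      proof (rule runs_weaken[OF down.runs_side[OF s1 v1]])
        fix s2 :: ram_state
        assume "down.meets_side s2"
        \<comment> \<open>With verdict 0 the second side supplies a hull point at or below w, so w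
          lies between two hull points over y.\<close>
        then show "?Q s2"
          using hull_between[OF _ v(1) _ v(2)] by (auto simp: down.meets_side_def output_of_def)
      qed simp
    next
      assume "\<not> tval s1 (ILess (IVar vVerdict) (IConst 1))"
      then show "runs Skip s1 (144700 * n + 700) ?Q"
        using up by (intro runs_straight_line) (simp_all add: up.meets_side_def)
    qed simp
  qed simp
qed

theorem proposition2p1:
  shows "\<exists>(prog :: com) (T :: nat \<Rightarrow> nat).
    (\<lambda>n. real (T n)) \<in> O(\<lambda>n. real n) \<and>
    (\<forall>d p a yl yu lam yhat what.
       a \<in> Rn (d + p) \<longrightarrow> yl \<in> Rn (d + p) \<longrightarrow> yu \<in> Rn (d + p) \<longrightarrow> vec_le (d + p) yl yu \<longrightarrow>
       lam > 0 \<longrightarrow> yhat \<in> Rn (d + p) \<longrightarrow>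
       (\<exists>t s. exec prog (input_state (d + p) a yl yu lam yhat what) t s \<and>
          t \<le> T (d + p) \<and>
          separates (d + p) (convex hull (Phi (d + p) a yl yu lam)) yhat what (output_of s)))"
proof (rule exI[of _ separation_com], rule exI[of _ "\<lambda>n. 290000 * n + 1500"], intro conjI allI impI)
  \<comment> \<open>291500 is 290000 + 1500; the additive constant is absorbed from n = 1
    on.\<close>
  show "(\<lambda>n. real (290000 * n + 1500)) \<in> O(\<lambda>n. real n)"
    by (rule bigoI[of _ 291500]) (auto intro: eventually_at_top_linorderI[of 1])
next
  fix d p :: nat and a yl yu yhat :: rvec and lam what :: real
  define n where "n = d + p"
  assume "vec_le (d + p) yl yu" and lam: "0 < lam" and "yhat \<in> Rn (d + p)"
  then have box: "vec_le n yl yu" and yhat: "yhat \<in> Rn n"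
    by (simp_all add: n_def)
  let ?s = "input_state n a yl yu lam yhat what"
  let ?Q = "\<lambda>s. separates n (convex hull (Phi n a yl yu lam)) yhat what (output_of s)"
  have s: "imem ?s vN 0 = n" "imem ?s vVerdict 0 = 0" "rmem ?s 1 = Poly_Mapping.lookup yl"
    "rmem ?s 2 = Poly_Mapping.lookup yu" "rmem ?s 3 = Poly_Mapping.lookup yhat"
    by (simp_all add: input_state_def)
  have "runs separation_com ?s (290000 * n + 1500) ?Q"
    unfolding separation_com_def
  proof (rule runs_Seq[OF runs_box[OF s(2)], where l = "289400 * n + 1440"])
    fix s1 :: ram_state
    assume s1: "(\<forall>i<imem ?s vN 0. rmem s1 5 i = bound_coeff (rmem ?s 1 i) (rmem ?s 2 i) (rmem ?s 3 i)) \<and>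
        rmem s1 6 0 = 0 \<and> rmem s1 6 1 = (\<Sum>i<imem ?s vN 0. bound_rhs (rmem ?s 1 i) (rmem ?s 2 i) (rmem ?s 3 i)) \<and>
        (imem s1 vVerdict 0 = 0 \<longleftrightarrow> (\<forall>i<imem ?s vN 0. rmem ?s 1 i \<le> rmem ?s 3 i \<and> rmem ?s 3 i \<le> rmem ?s 2 i))"
      and un: "unchanged box_com ?s s1"
    note out = s1[unfolded s]
    show "runs (Cond (ILess (IVar vVerdict) (IConst 1)) (side_com 1) Skip ;;
        Cond (ILess (IVar vVerdict) (IConst 1)) (side_com (-1)) Skip) s1 (289400 * n + 1440) ?Q"
    proof (cases "imem s1 vVerdict 0 = 0")
      case True
      then have y: "yhat \<in> vec_box n yl yu"
        using out yhat by (simp add: vec_box_def vec_le_def)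
      interpret box_side n a yl yu yhat lam what 1
        by standard (use lam box y in simp_all)
      have "input s1"
        using unchanged_mem[OF un] by (simp add: input_def input_state_def)
      then show ?thesis
        using lam box y True by (intro runs_weaken[OF runs_sides]) simp_all
    next
      case False
      then have "\<not> (\<forall>i<n. Poly_Mapping.lookup yl i \<le> Poly_Mapping.lookup yhat i \<and> Poly_Mapping.lookup yhat i \<le> Poly_Mapping.lookup yu i)"
        using out by simp
      then obtain j where "j < n" "\<not> (Poly_Mapping.lookup yl j \<le> Poly_Mapping.lookup yhat j \<and> Poly_Mapping.lookup yhat j \<le> Poly_Mapping.lookup yu j)"
        by blast
      then have "separates n (convex hull (Phi n a yl yu lam)) yhat what (Cut (rmem s1 5) 0 (rmem s1 6 1))"
        using out by (intro separates_box) simp_all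
      moreover have "rmem s1 6 0 = 0"
        using out by blast
      ultimately have "?Q s1"
        using False by (simp add: output_of_def)
      then have skip1: "runs (Cond (ILess (IVar vVerdict) (IConst 1)) (side_com 1) Skip) s1 10 (\<lambda>s'. s' = s1)"
        and skip2: "runs (Cond (ILess (IVar vVerdict) (IConst 1)) (side_com (-1)) Skip) s1 10 ?Q"
        using False by (auto intro!: runs_Cond_skip)
      show ?thesis
        by (rule runs_Seq[OF skip1, where l = 10]) (use skip2 in simp_all)
    qed
  qed (simp add: s)
  then show "\<exists>t s. exec separation_com (input_state (d + p) a yl yu lam yhat what) t s \<and> t \<le> 290000 * (d + p) + 1500 \<and>
      separates (d + p) (convex hull (Phi (d + p) a yl yu lam)) yhat what (output_of s)"
    by (simp add: runs_def n_def)
qed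

end
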